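(* A subset $\mathcal{S}\subseteq\mathrm{CQM}$ is totally bounded (with respect to $\mathrm{dist}_{\mathrm{q}}$) if and only if (1') there is a constant $D'$ such that $\mathrm{diam}(\mathcal{D}(A))\le D'$ for all $(A,L)\in\mathcal{S}$; (2') for any $\varepsilon>0$, there exists a constant $K'_\varepsilon>0$ such that $\mathrm{Cov}(\mathcal{D}(A),\varepsilon)\le K'_\varepsilon$ for all $(A,L)\in\mathcal{S}$.
   Context: An order-unit space is a real partially ordered vector space $A$ with a distinguished element $e=e_A$ (the order unit) such that (i) for each $a\in A$ there is $r\in\mathbb{R}$ with $a\le re$; (ii) if $a\le re$ for all real $r>0$ then $a\le 0$. Its norm is $\|a\|=\inf\{r\in\mathbb{R}:-re\le a\le re\}$. A state is a $\mu$ in the dual $A'$ with $\mu(e)=\|\mu\|'=1$; $S(A)$ is the (nonempty) set of states with the weak-$*$ topology. For a seminorm $L$ on $A$ put $\rho_L(\mu,\nu)=\sup\{|\mu(a)-\nu(a)|:a\in A,\ L(a)\le1\}$. $L$ is a Lip-norm, and $(A,L)$ is a compact quantum metric space, if (1) $L(a)=0$ if and only if $a\in\mathbb{R}e$; (2) the topology on $S(A)$ induced by $\rho_L$ is the weak-$*$ topology. The radius $r_A$ is half the diameter of $(S(A),\rho_L)$. Let $\mathcal{D}(A)=\{a\in A:L(a)\le1,\ \|a\|\le r_A\}$, with the metric induced by the norm. $\mathrm{diam}$ is the diameter of a metric space, and $\mathrm{Cov}(X,\varepsilon)$ is the smallest number of open balls of radius $\varepsilon$ whose union covers the metric space $X$.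 Closure and isometry: let $\bar A$ be the norm completion of $A$, $\bar L(b)=\inf\{\liminf_n L(a_n):a_n\in A,\ a_n\to b\}$ for $b\in\bar A$, $A^c=\{b\in\bar A:\bar L(b)<\infty\}$ and $L^c=\bar L|_{A^c}$. $L$ is closed if it equals $L^c$. An isometry from $(A,L_A)$ to $(B,L_B)$ is an order isomorphism $\varphi$ (preserving order units) of $A^c$ onto $B^c$ with $L_A^c=L_B^c\circ\varphi$. $\mathrm{CQM}$ is the set of isometry classes of compact quantum metric spaces; an element of $\mathrm{CQM}$ is denoted by a representative $(A,L)$, which may be taken closed. Rieffel's distance: $A\oplus B$ with order unit $(e_A,e_B)$ and the natural order is an order-unit space; via the coordinate projections, $S(A)$ and $S(B)$ are regarded as subsets of $S(A\oplus B)$. A Lip-norm $L$ on $A\oplus B$ is admissible if its quotient seminorms on $A$ and $B$ under the coordinate projections are $L_A$ and $L_B$. Then $\mathrm{dist}_{\mathrm{q}}(A,B)=\inf\{\mathrm{dist}_{\mathrm{H}}^{\rho_L}(S(A),S(B)):L\text{ an admissible Lip-norm on }A\oplus B\}$, where $\mathrm{dist}_{\mathrm{H}}^{\rho_L}$ is the Hausdorff distance for $\rho_L$. $\mathrm{dist}_{\mathrm{q}}$ is a metric on $\mathrm{CQM}$. *)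

theory Defs
  imports "HOL-Analysis.Analysis" "HOL-Library.Extended_Nat"
begin

section \<open>Order-unit spaces\<close>

text \<open>The underlying vector space is a linear subspace \<open>carr\<close> of an ambient real vector space type;
  the values of \<open>leq\<close> (and of seminorms) off the carrier are irrelevant. Every real vector space
  is isomorphic to a subspace of a large enough ambient type. A compact quantum metric space has
  the cardinality of the continuum, so a single ambient type of dimension at least the continuum
  already contains representatives of all isometry classes.\<close>

record 'a order_unit_space =
  carr :: "'a set"
  leq :: "'a \<Rightarrow> 'a \<Rightarrow> bool"
  ounit :: 'a

definition partially_ordered_vector_space :: "'a::real_vector order_unit_space \<Rightarrow> bool" where
  "partially_ordered_vector_space A \<longleftrightarrow>
     subspace (carr A) \<and>
     (\<forall>a\<in>carr A. leq A a a) \<and>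
     (\<forall>a\<in>carr A. \<forall>b\<in>carr A. leq A a b \<longrightarrow> leq A b a \<longrightarrow> a = b) \<and>
     (\<forall>a\<in>carr A. \<forall>b\<in>carr A. \<forall>c\<in>carr A. leq A a b \<longrightarrow> leq A b c \<longrightarrow> leq A a c) \<and>
     (\<forall>a\<in>carr A. \<forall>b\<in>carr A. \<forall>c\<in>carr A. leq A a b \<longrightarrow> leq A (a + c) (b + c)) \<and>
     (\<forall>a\<in>carr A. \<forall>b\<in>carr A. \<forall>r\<ge>0. leq A a b \<longrightarrow> leq A (r *\<^sub>R a) (r *\<^sub>R b))"

text \<open>The condition \<open>ounit A \<noteq> 0\<close> excludes only the zero space, which has no states.\<close>

definition is_order_unit_space :: "'a::real_vector order_unit_space \<Rightarrow> bool" where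
  "is_order_unit_space A \<longleftrightarrow>
     partially_ordered_vector_space A \<and>
     ounit A \<in> carr A \<and> ounit A \<noteq> 0 \<and>
     (\<forall>a\<in>carr A. \<exists>r::real. leq A a (r *\<^sub>R ounit A)) \<and>
     (\<forall>a\<in>carr A. (\<forall>r::real. r > 0 \<longrightarrow> leq A a (r *\<^sub>R ounit A)) \<longrightarrow> leq A a 0)"

definition ou_norm :: "'a::real_vector order_unit_space \<Rightarrow> 'a \<Rightarrow> real" where
  "ou_norm A a = Inf {r. leq A (- (r *\<^sub>R ounit A)) a \<and> leq A a (r *\<^sub>R ounit A)}"

definition ou_dist :: "'a::real_vector order_unit_space \<Rightarrow> 'a \<Rightarrow> 'a \<Rightarrow> ereal" where
  "ou_dist A a b = ereal (ou_norm A (a - b))"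


section \<open>States\<close>

text \<open>Functionals on \<open>carr A\<close> are extensional, so that they are determined by their values on
  the carrier.\<close>

definition dual_space :: "'a::real_vector order_unit_space \<Rightarrow> ('a \<Rightarrow> real) set" where
  "dual_space A = {\<mu> \<in> extensional (carr A).
     (\<forall>a\<in>carr A. \<forall>b\<in>carr A. \<mu> (a + b) = \<mu> a + \<mu> b) \<and>
     (\<forall>a\<in>carr A. \<forall>r. \<mu> (r *\<^sub>R a) = r * \<mu> a) \<and>
     (\<exists>K. \<forall>a\<in>carr A. \<bar>\<mu> a\<bar> \<le> K * ou_norm A a)}"

definition dual_norm :: "'a::real_vector order_unit_space \<Rightarrow> ('a \<Rightarrow> real) \<Rightarrow> real" where
  "dual_norm A \<mu> = Sup {\<bar>\<mu> a\<bar> |a. a \<in> carr A \<and> ou_norm A a \<le> 1}"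

definition states :: "'a::real_vector order_unit_space \<Rightarrow> ('a \<Rightarrow> real) set" where
  "states A = {\<mu> \<in> dual_space A. \<mu> (ounit A) = 1 \<and> dual_norm A \<mu> = 1}"

definition weak_star :: "'a::real_vector order_unit_space \<Rightarrow> ('a \<Rightarrow> real) topology" where
  "weak_star A = subtopology (product_topology (\<lambda>_. euclideanreal) (carr A)) (states A)"


section \<open>Extended-real-valued metrics\<close>

definition metric_diam :: "('x \<Rightarrow> 'x \<Rightarrow> ereal) \<Rightarrow> 'x set \<Rightarrow> ereal" where
  "metric_diam d X = (SUP x\<in>X. SUP y\<in>X. d x y)"

definition hausdorff_dist :: "('x \<Rightarrow> 'x \<Rightarrow> ereal) \<Rightarrow> 'x set \<Rightarrow> 'x set \<Rightarrow> ereal" where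
  "hausdorff_dist d X Y = max (SUP x\<in>X. INF y\<in>Y. d x y) (SUP y\<in>Y. INF x\<in>X. d x y)"

text \<open>The covering number is \<open>\<infinity>\<close> if there is no finite cover. The centres lie in \<open>X\<close>, as the
  balls are those of the metric space \<open>X\<close>.\<close>

definition Cov :: "('x \<Rightarrow> 'x \<Rightarrow> ereal) \<Rightarrow> 'x set \<Rightarrow> real \<Rightarrow> enat" where
  "Cov d X \<epsilon> = Inf {enat (card F) |F.
     finite F \<and> F \<subseteq> X \<and> X \<subseteq> (\<Union>x\<in>F. {y\<in>X. d x y < ereal \<epsilon>})}"

definition totally_bounded_wrt :: "('x \<Rightarrow> 'x \<Rightarrow> ereal) \<Rightarrow> 'x set \<Rightarrow> bool" where
  "totally_bounded_wrt d X \<longleftrightarrow>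
     (\<forall>\<epsilon>::real. \<epsilon> > 0 \<longrightarrow> (\<exists>F. finite F \<and> F \<subseteq> X \<and> X \<subseteq> (\<Union>x\<in>F. {y. d x y < ereal \<epsilon>})))"


section \<open>Compact quantum metric spaces\<close>

definition is_seminorm :: "'a::real_vector order_unit_space \<Rightarrow> ('a \<Rightarrow> real) \<Rightarrow> bool" where
  "is_seminorm A L \<longleftrightarrow>
     (\<forall>a\<in>carr A. 0 \<le> L a) \<and>
     (\<forall>a\<in>carr A. \<forall>b\<in>carr A. L (a + b) \<le> L a + L b) \<and>
     (\<forall>a\<in>carr A. \<forall>r. L (r *\<^sub>R a) = \<bar>r\<bar> * L a)"

definition rho :: "'a::real_vector order_unit_space \<Rightarrow> ('a \<Rightarrow> real)
    \<Rightarrow> ('a \<Rightarrow> real) \<Rightarrow> ('a \<Rightarrow> real) \<Rightarrow> ereal" where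
  "rho A L \<mu> \<nu> = (SUP a\<in>{a\<in>carr A. L a \<le> 1}. ereal \<bar>\<mu> a - \<nu> a\<bar>)"

text \<open>The second condition says that the metric topology of \<open>rho A L\<close> is the weak-* topology;
  a priori \<open>rho A L\<close> may take the value \<open>\<infinity>\<close>.\<close>

definition is_Lip_norm :: "'a::real_vector order_unit_space \<Rightarrow> ('a \<Rightarrow> real) \<Rightarrow> bool" where
  "is_Lip_norm A L \<longleftrightarrow>
     is_seminorm A L \<and>
     (\<forall>a\<in>carr A. L a = 0 \<longleftrightarrow> (\<exists>r. a = r *\<^sub>R ounit A)) \<and>
     (\<forall>U. U \<subseteq> states A \<longrightarrow>
        (openin (weak_star A) U \<longleftrightarrow>
         (\<forall>\<mu>\<in>U. \<exists>\<epsilon>::real. \<epsilon> > 0 \<and> {\<nu>\<in>states A. rho A L \<mu> \<nu> < ereal \<epsilon>} \<subseteq> U)))"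

type_synonym 'a qms = "'a order_unit_space \<times> ('a \<Rightarrow> real)"

definition compact_quantum_metric_spaces :: "'a::real_vector qms set" where
  "compact_quantum_metric_spaces = {(A, L). is_order_unit_space A \<and> is_Lip_norm A L}"

definition radius :: "'a::real_vector order_unit_space \<Rightarrow> ('a \<Rightarrow> real) \<Rightarrow> real" where
  "radius A L = real_of_ereal (metric_diam (rho A L) (states A)) / 2"

definition Lip_ball :: "'a::real_vector order_unit_space \<Rightarrow> ('a \<Rightarrow> real) \<Rightarrow> 'a set" where
  "Lip_ball A L = {a\<in>carr A. L a \<le> 1 \<and> ou_norm A a \<le> radius A L}"


section \<open>Closure and isometry\<close>

definition cauchy_seqs :: "'a::real_vector order_unit_space \<Rightarrow> (nat \<Rightarrow> 'a) set" where
  "cauchy_seqs A = {x. (\<forall>n. x n \<in> carr A) \<and>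
     (\<forall>\<epsilon>>0. \<exists>N. \<forall>m\<ge>N. \<forall>n\<ge>N. ou_norm A (x m - x n) < \<epsilon>)}"

definition null_rel :: "'a::real_vector order_unit_space \<Rightarrow> ((nat \<Rightarrow> 'a) \<times> (nat \<Rightarrow> 'a)) set" where
  "null_rel A = {(x, y). x \<in> cauchy_seqs A \<and> y \<in> cauchy_seqs A \<and>
     (\<lambda>n. ou_norm A (x n - y n)) \<longlonglongrightarrow> 0}"

text \<open>The norm completion, with its vector space operations, its order (whose positive cone is the
  closure of the positive cone of \<open>A\<close>) and its order unit. A point of the completion is the set of
  all sequences in \<open>carr A\<close> that converge to it.\<close>

definition completion :: "'a::real_vector order_unit_space \<Rightarrow> (nat \<Rightarrow> 'a) set set" where
  "completion A = cauchy_seqs A // null_rel A"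

definition compl_add :: "'a::real_vector order_unit_space
    \<Rightarrow> (nat \<Rightarrow> 'a) set \<Rightarrow> (nat \<Rightarrow> 'a) set \<Rightarrow> (nat \<Rightarrow> 'a) set" where
  "compl_add A X Y = (\<Union>x\<in>X. \<Union>y\<in>Y. null_rel A `` {\<lambda>n. x n + y n})"

definition compl_scale :: "'a::real_vector order_unit_space
    \<Rightarrow> real \<Rightarrow> (nat \<Rightarrow> 'a) set \<Rightarrow> (nat \<Rightarrow> 'a) set" where
  "compl_scale A r X = (\<Union>x\<in>X. null_rel A `` {\<lambda>n. r *\<^sub>R x n})"

definition compl_leq :: "'a::real_vector order_unit_space
    \<Rightarrow> (nat \<Rightarrow> 'a) set \<Rightarrow> (nat \<Rightarrow> 'a) set \<Rightarrow> bool" where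
  "compl_leq A X Y \<longleftrightarrow> (\<exists>x\<in>X. \<exists>y\<in>Y. \<forall>n. leq A (x n) (y n))"

definition compl_unit :: "'a::real_vector order_unit_space \<Rightarrow> (nat \<Rightarrow> 'a) set" where
  "compl_unit A = null_rel A `` {\<lambda>_. ounit A}"

definition compl_Lip :: "('a \<Rightarrow> real) \<Rightarrow> (nat \<Rightarrow> 'a) set \<Rightarrow> ereal" where
  "compl_Lip L X = (INF x\<in>X. liminf (\<lambda>n. ereal (L (x n))))"

definition closure_carr ::
    "'a::real_vector order_unit_space \<Rightarrow> ('a \<Rightarrow> real) \<Rightarrow> (nat \<Rightarrow> 'a) set set" where
  "closure_carr A L = {X\<in>completion A. compl_Lip L X < \<infinity>}"

definition isometric :: "'a::real_vector qms \<Rightarrow> 'b::real_vector qms \<Rightarrow> bool" where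
  "isometric P Q \<longleftrightarrow> (case (P, Q) of ((A, LA), (B, LB)) \<Rightarrow>
     (\<exists>\<phi>. bij_betw \<phi> (closure_carr A LA) (closure_carr B LB) \<and>
        (\<forall>X\<in>closure_carr A LA. \<forall>Y\<in>closure_carr A LA.
           \<phi> (compl_add A X Y) = compl_add B (\<phi> X) (\<phi> Y)) \<and>
        (\<forall>X\<in>closure_carr A LA. \<forall>r. \<phi> (compl_scale A r X) = compl_scale B r (\<phi> X)) \<and>
        (\<forall>X\<in>closure_carr A LA. \<forall>Y\<in>closure_carr A LA.
           compl_leq A X Y \<longleftrightarrow> compl_leq B (\<phi> X) (\<phi> Y)) \<and>
        \<phi> (compl_unit A) = compl_unit B \<and>
        (\<forall>X\<in>closure_carr A LA. compl_Lip LA X = compl_Lip LB (\<phi> X))))"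

definition CQM :: "'a::real_vector qms set set" where
  "CQM = compact_quantum_metric_spaces //
     {(P, Q). P \<in> compact_quantum_metric_spaces \<and> Q \<in> compact_quantum_metric_spaces \<and>
       isometric P Q}"


section \<open>The quantum Gromov--Hausdorff distance\<close>

definition direct_sum :: "'a::real_vector order_unit_space \<Rightarrow> 'b::real_vector order_unit_space
    \<Rightarrow> ('a \<times> 'b) order_unit_space" where
  "direct_sum A B = \<lparr>carr = carr A \<times> carr B,
     leq = (\<lambda>p q. leq A (fst p) (fst q) \<and> leq B (snd p) (snd q)),
     ounit = (ounit A, ounit B)\<rparr>"

definition admissible :: "'a::real_vector order_unit_space \<Rightarrow> ('a \<Rightarrow> real)
    \<Rightarrow> 'b::real_vector order_unit_space \<Rightarrow> ('b \<Rightarrow> real) \<Rightarrow> ('a \<times> 'b \<Rightarrow> real) \<Rightarrow> bool" where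
  "admissible A LA B LB L \<longleftrightarrow>
     is_Lip_norm (direct_sum A B) L \<and>
     (\<forall>a\<in>carr A. LA a = (INF b\<in>carr B. L (a, b))) \<and>
     (\<forall>b\<in>carr B. LB b = (INF a\<in>carr A. L (a, b)))"

definition states_left :: "'a::real_vector order_unit_space \<Rightarrow> 'b::real_vector order_unit_space
    \<Rightarrow> ('a \<times> 'b \<Rightarrow> real) set" where
  "states_left A B = (\<lambda>\<mu>. restrict (\<lambda>p. \<mu> (fst p)) (carr A \<times> carr B)) ` states A"

definition states_right :: "'a::real_vector order_unit_space \<Rightarrow> 'b::real_vector order_unit_space
    \<Rightarrow> ('a \<times> 'b \<Rightarrow> real) set" where
  "states_right A B = (\<lambda>\<nu>. restrict (\<lambda>p. \<nu> (snd p)) (carr A \<times> carr B)) ` states B"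

definition dist_q :: "'a::real_vector qms \<Rightarrow> 'b::real_vector qms \<Rightarrow> ereal" where
  "dist_q P Q = (case (P, Q) of ((A, LA), (B, LB)) \<Rightarrow>
     (INF L\<in>{L. admissible A LA B LB L}.
        hausdorff_dist (rho (direct_sum A B) L) (states_left A B) (states_right A B)))"

text \<open>The distance of two isometry classes, computed on chosen representatives;
  the value does not depend on the choice.\<close>

definition CQM_dist :: "'a::real_vector qms set \<Rightarrow> 'b::real_vector qms set \<Rightarrow> ereal" where
  "CQM_dist X Y = dist_q (SOME P. P \<in> X) (SOME Q. Q \<in> Y)"

end

theory Submission
  imports Defs
begin

text \<open>A compact quantum metric space is controlled by its Lipschitz ball \<open>Lip_ball A L\<close>: the elements of
\<open>A\<close> are functions on the state space, those with \<open>L a \<le> 1\<close> are \<open>1\<close>-Lipschitz, and the norm of an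
element is its maximal absolute value on the states, by a Hahn--Banach argument
(\<open>ex_state_attaining_upper\<close>). Two kinds of comparison between spaces \<open>A\<close> and \<open>B\<close> carry the proof.

\<^bold>\<open>Bounds imply total boundedness.\<close> Fix \<open>\<delta> > 0\<close>. By hypothesis each Lipschitz ball in the family has
a \<open>\<delta>\<close>-net \<open>x\<^sub>0, \<dots>, x\<^sub>n\<^sub>-\<^sub>1\<close> of uniform length \<open>n\<close>, and the values \<open>\<mu> (x\<^sub>i)\<close> at states \<open>\<mu>\<close> lie in a
fixed bounded interval, because the radius is half the diameter of the ball. Rounding these values
down to multiples of \<open>\<delta>\<close> attaches to every space a set of integer \<open>n\<close>-tuples, one tuple for each
state, and only finitely many such sets can occur. If \<open>A\<close> and \<open>B\<close> have the same set, then every state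
of one space has a partner among the states of the other that agrees with it on the nets up to \<open>\<delta>\<close>.
The relation \<open>R\<close> of partners defines a seminorm \<open>\<beta> (a, b) = sup \<bar>\<mu> a - \<nu> b\<bar> / (2 \<delta>)\<close> over \<open>(\<mu>, \<nu>)\<close> in
\<open>R\<close>, and the maximum of \<open>L\<^sub>A\<close>, \<open>L\<^sub>B\<close> and \<open>\<beta>\<close> is an admissible Lip-norm for which partners have distance
at most \<open>2 \<delta>\<close> (\<open>dist_q_le_if_correspondence\<close>, \<open>dist_q_le_if_matching_nets\<close>). Choosing one member of the
family for each set that occurs gives a finite net.

\<^bold>\<open>Total boundedness implies bounds.\<close> If \<open>dist_q A B < \<epsilon>\<close>, an admissible Lip-norm provides for every
\<open>b\<close> in the unit ball of \<open>L\<^sub>B\<close> an \<open>a\<close> in the unit ball of \<open>L\<^sub>A\<close> that agrees with \<open>b\<close> up to \<open>2 \<epsilon>\<close> on close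
pairs of states. This map decreases distances by at most \<open>4 \<epsilon>\<close> (\<open>Lip_close_if_dist_q_less\<close>), so it
transports bounds on the radius and on covering numbers. For a single space the covering numbers are
finite by an Arzela--Ascoli argument on the compact state space (\<open>totally_bounded_Lip_set\<close>), and the
radius is finite because the state space is convex (\<open>rho_pairwise_finite\<close>). Since the two conditions
speak about every representative of an isometry class whereas the distance uses a chosen one, isometric
spaces have to be compared as well; an isometry of closures gives maps of the same kind with arbitrarily small distortion
(\<open>Lip_close_if_isometric\<close>).

\<^bold>\<open>Improper spaces.\<close> The axioms leave the sign of the order unit open: for instance the real line with
its usual order and \<open>e = -1\<close> satisfies them. Spaces without \<open>0 \<le> e\<close> have no states at all. They are
at distance \<open>-\<infinity>\<close> from each other and at distance \<open>\<infinity>\<close> from the proper ones, and their Lipschitz balls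
are covered by at most one ball of any radius, so they respect both directions of the equivalence.\<close>

section \<open>Order-unit spaces and their norm\<close>

locale order_unit_space =
  fixes A :: "'a::real_vector order_unit_space"
  assumes order_unit_space: "is_order_unit_space A"
begin

abbreviation V :: "'a set" where "V \<equiv> carr A"
abbreviation e :: 'a where "e \<equiv> ounit A"
abbreviation le :: "'a \<Rightarrow> 'a \<Rightarrow> bool" (infix "\<preceq>" 50) where "a \<preceq> b \<equiv> leq A a b"
abbreviation N :: "'a \<Rightarrow> real" where "N \<equiv> ou_norm A"

lemma pov: "partially_ordered_vector_space A"
  using order_unit_space by (simp add: is_order_unit_space_def)

lemma subspace_V: "subspace V"
  using pov by (simp add: partially_ordered_vector_space_def)

lemma V_closed [simp, intro]:
  "0 \<in> V" "e \<in> V"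
  "a \<in> V \<Longrightarrow> b \<in> V \<Longrightarrow> a + b \<in> V"
  "a \<in> V \<Longrightarrow> b \<in> V \<Longrightarrow> a - b \<in> V"
  "a \<in> V \<Longrightarrow> - a \<in> V"
  "a \<in> V \<Longrightarrow> r *\<^sub>R a \<in> V"
  using subspace_V order_unit_space
  by (auto simp: is_order_unit_space_def subspace_0 subspace_add subspace_diff subspace_neg
      subspace_mul)

lemma e_nz: "e \<noteq> 0"
  using order_unit_space by (simp add: is_order_unit_space_def)

lemma le_refl [simp]: "a \<in> V \<Longrightarrow> a \<preceq> a"
  using pov by (simp add: partially_ordered_vector_space_def)

lemma le_antisym: "a \<in> V \<Longrightarrow> b \<in> V \<Longrightarrow> a \<preceq> b \<Longrightarrow> b \<preceq> a \<Longrightarrow> a = b"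
  using pov unfolding partially_ordered_vector_space_def by blast

lemma le_trans: "a \<in> V \<Longrightarrow> b \<in> V \<Longrightarrow> c \<in> V \<Longrightarrow> a \<preceq> b \<Longrightarrow> b \<preceq> c \<Longrightarrow> a \<preceq> c"
  using pov unfolding partially_ordered_vector_space_def by blast

lemma le_add_right: "a \<in> V \<Longrightarrow> b \<in> V \<Longrightarrow> c \<in> V \<Longrightarrow> a \<preceq> b \<Longrightarrow> a + c \<preceq> b + c"
  using pov unfolding partially_ordered_vector_space_def by blast

lemma le_scaleR: "a \<in> V \<Longrightarrow> b \<in> V \<Longrightarrow> 0 \<le> r \<Longrightarrow> a \<preceq> b \<Longrightarrow> r *\<^sub>R a \<preceq> r *\<^sub>R b"
  using pov unfolding partially_ordered_vector_space_def by blast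

lemma le_add:
  assumes "a \<in> V" "b \<in> V" "c \<in> V" "d \<in> V" "a \<preceq> b" "c \<preceq> d"
  shows "a + c \<preceq> b + d"
proof -
  have "a + c \<preceq> b + c" using assms by (intro le_add_right)
  moreover have "b + c \<preceq> b + d" using le_add_right[of c d b] assms by (simp add: add.commute)
  ultimately show ?thesis using le_trans[of "a + c" "b + c" "b + d"] assms by blast
qed

lemma le_add_cancel:
  assumes "a \<in> V" "b \<in> V" "c \<in> V" shows "a + c \<preceq> b + c \<longleftrightarrow> a \<preceq> b"
  using le_add_right[of a b c] le_add_right[of "a + c" "b + c" "- c"] assms by auto

lemma unit_bound: "a \<in> V \<Longrightarrow> \<exists>r. a \<preceq> r *\<^sub>R e"
  using order_unit_space by (simp add: is_order_unit_space_def)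

end

text \<open>The unit need not be positive: condition (i) for \<open>a\<close> and \<open>-a\<close> only says that some multiple of \<open>e\<close>,
possibly a nonpositive one, is nonnegative.\<close>

locale proper_order_unit_space = order_unit_space +
  assumes unit_pos: "0 \<preceq> e"
begin

lemma unit_nonneg: "0 \<preceq> r *\<^sub>R e \<longleftrightarrow> 0 \<le> r"
proof
  assume r: "0 \<preceq> r *\<^sub>R e"
  show "0 \<le> r"
  proof (rule ccontr)
    assume "\<not> 0 \<le> r"
    then have "(1 / (- r)) *\<^sub>R 0 \<preceq> (1 / (- r)) *\<^sub>R (r *\<^sub>R e)"
      using le_scaleR[OF _ _ _ r, of "1 / (- r)"] by (simp add: field_simps)
    then have "0 \<preceq> - e" using \<open>\<not> 0 \<le> r\<close> by simp
    then have "e \<preceq> 0" using le_add_right[of 0 "- e" e] by simp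
    then show False using le_antisym[OF _ _ unit_pos] e_nz by auto
  qed
next
  assume "0 \<le> r" then show "0 \<preceq> r *\<^sub>R e" using le_scaleR[OF _ _ _ unit_pos, of r] by simp
qed

lemma unit_le_iff: "r *\<^sub>R e \<preceq> s *\<^sub>R e \<longleftrightarrow> r \<le> s"
  using le_add_cancel[of 0 "(s - r) *\<^sub>R e" "r *\<^sub>R e"] unit_nonneg[of "s - r"]
  by (simp add: algebra_simps)

lemma archimedean:
  assumes a: "a \<in> V" and s: "\<And>s. s > c \<Longrightarrow> a \<preceq> s *\<^sub>R e" shows "a \<preceq> c *\<^sub>R e"
proof -
  have "a - c *\<^sub>R e \<preceq> 0"
  proof -
    have "a - c *\<^sub>R e \<preceq> r *\<^sub>R e" if "r > 0" for r
      using le_add_right[OF a _ _ s[of "c + r"], of "- (c *\<^sub>R e)"] that a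
      by (simp add: algebra_simps)
    then show ?thesis using order_unit_space a by (simp add: is_order_unit_space_def)
  qed
  then show ?thesis using le_add_right[of "a - c *\<^sub>R e" 0 "c *\<^sub>R e"] a by simp
qed

text \<open>The sublinear functional \<open>upper\<close> is the source of all estimates: it attains its infimum by the
Archimedean condition (ii), the norm is \<open>max (upper a) (upper (- a))\<close>, and \<open>upper a\<close> will turn out to
be the largest value of \<open>a\<close> on the states.\<close>

definition upper :: "'a \<Rightarrow> real" where "upper a = Inf {r. a \<preceq> r *\<^sub>R e}"

lemma le_unit_iff:
  assumes a: "a \<in> V" shows "a \<preceq> r *\<^sub>R e \<longleftrightarrow> upper a \<le> r"
proof
  obtain s where s: "- a \<preceq> s *\<^sub>R e" using unit_bound[of "- a"] a by auto
  have lower: "- s \<le> t" if "a \<preceq> t *\<^sub>R e" for t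
    using le_add[OF _ _ _ _ that s] unit_nonneg[of "t + s"] a by (simp add: algebra_simps)
  then have bdd: "bdd_below {r. a \<preceq> r *\<^sub>R e}" by (auto simp: bdd_below_def)
  obtain t where "a \<preceq> t *\<^sub>R e" using unit_bound a by auto
  then have ne: "{r. a \<preceq> r *\<^sub>R e} \<noteq> {}" by auto
  { assume "a \<preceq> r *\<^sub>R e" then show "upper a \<le> r"
      unfolding upper_def using bdd by (intro cInf_lower) auto }
  { assume u: "upper a \<le> r"
    show "a \<preceq> r *\<^sub>R e"
    proof (rule archimedean[OF a])
      fix t assume "t > r"
      with u obtain q where "a \<preceq> q *\<^sub>R e" "q < t"
        unfolding upper_def using cInf_lessD[OF ne, of t] by auto
      then show "a \<preceq> t *\<^sub>R e"
        using le_trans[of a "q *\<^sub>R e" "t *\<^sub>R e"] unit_le_iff a by auto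
    qed }
qed

lemma le_upper: "a \<in> V \<Longrightarrow> a \<preceq> upper a *\<^sub>R e"
  using le_unit_iff by blast

lemma upper_unit [simp]: "upper (c *\<^sub>R e) = c"
proof -
  have "upper (c *\<^sub>R e) \<le> r \<longleftrightarrow> c \<le> r" for r
    using le_unit_iff[of "c *\<^sub>R e" r] unit_le_iff by auto
  then show ?thesis by (meson order_antisym order_refl)
qed

lemma upper_0 [simp]: "upper 0 = 0"
  using upper_unit[of 0] by simp

lemma upper_add: "a \<in> V \<Longrightarrow> b \<in> V \<Longrightarrow> upper (a + b) \<le> upper a + upper b"
  using le_unit_iff[of "a + b" "upper a + upper b"]
    le_add[OF _ _ _ _ le_upper[of a] le_upper[of b]]
  by (simp add: scaleR_add_left)

lemma upper_scaleR:
  assumes a: "a \<in> V" and t: "0 \<le> t" shows "upper (t *\<^sub>R a) = t * upper a"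
proof -
  have le: "upper (t *\<^sub>R a) \<le> t * upper a" if "a \<in> V" "0 \<le> t" for t a
    using le_unit_iff[of "t *\<^sub>R a" "t * upper a"] le_scaleR[OF _ _ _ le_upper[of a], of t] that
    by simp
  show ?thesis
  proof (cases "t = 0")
    case False
    then have "t * upper ((1 / t) *\<^sub>R (t *\<^sub>R a)) \<le> t * ((1 / t) * upper (t *\<^sub>R a))"
      using le[of "t *\<^sub>R a" "1 / t"] a t by (intro mult_left_mono) auto
    then show ?thesis using le[OF a t] False by simp
  qed simp
qed

lemma upper_add_unit: "a \<in> V \<Longrightarrow> upper (a + c *\<^sub>R e) = upper a + c"
  using upper_add[of a "c *\<^sub>R e"] upper_add[of "a + c *\<^sub>R e" "(- c) *\<^sub>R e"]
    upper_unit[of c] upper_unit[of "- c"] by (auto simp del: upper_unit)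

lemma norm_eq:
  assumes a: "a \<in> V" shows "N a = max (upper a) (upper (- a))"
proof -
  have "- (r *\<^sub>R e) \<preceq> a \<longleftrightarrow> - a \<preceq> r *\<^sub>R e" for r
    using le_add_cancel[of "- (r *\<^sub>R e)" a "r *\<^sub>R e - a"] a by (simp add: algebra_simps)
  then have "{r. - (r *\<^sub>R e) \<preceq> a \<and> a \<preceq> r *\<^sub>R e} = {max (upper a) (upper (- a))..}"
    using le_unit_iff[of a] le_unit_iff[of "- a"] a by auto
  then show ?thesis unfolding ou_norm_def by simp
qed

lemma norm_le_iff:
  "a \<in> V \<Longrightarrow> N a \<le> r \<longleftrightarrow> a \<preceq> r *\<^sub>R e \<and> - a \<preceq> r *\<^sub>R e"
  using norm_eq[of a] le_unit_iff[of a] le_unit_iff[of "- a"] by auto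

lemma norm_nonneg: "a \<in> V \<Longrightarrow> 0 \<le> N a"
  using upper_add[of a "- a"] norm_eq[of a] by auto

lemma norm_minus [simp]: "a \<in> V \<Longrightarrow> N (- a) = N a"
  using norm_eq[of a] norm_eq[of "- a"] by (simp add: max.commute)

lemma norm_minus_commute: "a \<in> V \<Longrightarrow> b \<in> V \<Longrightarrow> N (a - b) = N (b - a)"
  using norm_minus[of "a - b"] by simp

lemma norm_add: "a \<in> V \<Longrightarrow> b \<in> V \<Longrightarrow> N (a + b) \<le> N a + N b"
  using upper_add[of a b] upper_add[of "- a" "- b"] norm_eq[of a] norm_eq[of b] norm_eq[of "a + b"]
  by auto

lemma norm_diff: "a \<in> V \<Longrightarrow> b \<in> V \<Longrightarrow> N (a - b) \<le> N a + N b"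
  using norm_add[of a "- b"] by simp

lemma norm_triangle: "a \<in> V \<Longrightarrow> b \<in> V \<Longrightarrow> c \<in> V \<Longrightarrow> N (a - c) \<le> N (a - b) + N (b - c)"
  using norm_add[of "a - b" "b - c"] by simp

lemma norm_scaleR: assumes a: "a \<in> V" shows "N (r *\<^sub>R a) = \<bar>r\<bar> * N a"
proof -
  have *: "N (r *\<^sub>R a) = r * N a" if "0 \<le> r" for r
    using that a upper_scaleR[of a r] upper_scaleR[of "- a" r]
    by (simp add: norm_eq max_mult_distrib_left)
  show ?thesis
    using *[of r] *[of "- r"] norm_minus[of "r *\<^sub>R a"] a by (cases "0 \<le> r") auto
qed

lemma norm_unit [simp]: "N (c *\<^sub>R e) = \<bar>c\<bar>"
  using norm_eq[of "c *\<^sub>R e"] upper_unit[of c] upper_unit[of "- c"] by auto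

lemma norm_e [simp]: "N e = 1"
  using norm_unit[of 1] by simp

lemma norm_0 [simp]: "N 0 = 0"
  using norm_unit[of 0] by simp

text \<open>The unit has norm \<open>1\<close>, so a functional with \<open>\<mu> e = 1\<close> has dual norm at least \<open>1\<close>, and dual norm \<open>1\<close>
amounts to the inequality \<open>\<bar>\<mu> a\<bar> \<le> N a\<close>.\<close>

lemma states_iff:
  "\<mu> \<in> states A \<longleftrightarrow> \<mu> \<in> extensional V \<and>
     (\<forall>a\<in>V. \<forall>b\<in>V. \<mu> (a + b) = \<mu> a + \<mu> b) \<and> (\<forall>a\<in>V. \<forall>r. \<mu> (r *\<^sub>R a) = r * \<mu> a) \<and>
     \<mu> e = 1 \<and> (\<forall>a\<in>V. \<bar>\<mu> a\<bar> \<le> N a)" (is "?l \<longleftrightarrow> ?r")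
proof
  assume l: ?l
  then have d: "\<mu> \<in> dual_space A" "dual_norm A \<mu> = 1" by (auto simp: states_def)
  then obtain K where K: "\<And>a. a \<in> V \<Longrightarrow> \<bar>\<mu> a\<bar> \<le> K * N a"
    unfolding dual_space_def by blast
  have hom: "\<mu> (r *\<^sub>R a) = r * \<mu> a" if "a \<in> V" for a r using d that by (auto simp: dual_space_def)
  have bdd: "bdd_above {\<bar>\<mu> a\<bar> |a. a \<in> V \<and> N a \<le> 1}"
    unfolding bdd_above_def
  proof (intro exI ballI)
    fix x assume "x \<in> {\<bar>\<mu> a\<bar> |a. a \<in> V \<and> N a \<le> 1}"
    then obtain a where a: "x = \<bar>\<mu> a\<bar>" "a \<in> V" "N a \<le> 1" by auto
    have "K * N a \<le> \<bar>K\<bar> * 1" using a norm_nonneg by (intro mult_mono) auto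
    then show "x \<le> \<bar>K\<bar>" using K a by force
  qed
  have "\<bar>\<mu> a\<bar> \<le> N a" if a: "a \<in> V" for a
  proof (cases "N a = 0")
    case True
    then show ?thesis using K[OF a] by simp
  next
    case False
    then have pos: "N a > 0" using norm_nonneg[OF a] by simp
    have "\<bar>\<mu> ((1 / N a) *\<^sub>R a)\<bar> \<le> dual_norm A \<mu>"
      unfolding dual_norm_def using a bdd pos by (intro cSup_upper) (auto simp: norm_scaleR)
    then show ?thesis using hom[OF a] pos d by (simp add: field_simps abs_mult)
  qed
  then show ?r using l by (auto simp: states_def dual_space_def)
next
  assume r: ?r
  have "dual_norm A \<mu> = 1"
    unfolding dual_norm_def
  proof (rule cSup_eq_maximum)
    show "1 \<in> {\<bar>\<mu> a\<bar> |a. a \<in> V \<and> N a \<le> 1}" using r by (auto intro!: exI[of _ e])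
    show "\<And>x. x \<in> {\<bar>\<mu> a\<bar> |a. a \<in> V \<and> N a \<le> 1} \<Longrightarrow> x \<le> 1" using r by force
  qed
  moreover have "\<exists>K. \<forall>a\<in>V. \<bar>\<mu> a\<bar> \<le> K * N a" using r by (auto intro!: exI[of _ 1])
  ultimately show ?l using r by (auto simp: states_def dual_space_def)
qed

lemma state_add: "\<mu> \<in> states A \<Longrightarrow> a \<in> V \<Longrightarrow> b \<in> V \<Longrightarrow> \<mu> (a + b) = \<mu> a + \<mu> b"
  and state_scaleR: "\<mu> \<in> states A \<Longrightarrow> a \<in> V \<Longrightarrow> \<mu> (r *\<^sub>R a) = r * \<mu> a"
  and state_e: "\<mu> \<in> states A \<Longrightarrow> \<mu> e = 1"
  and state_le_norm: "\<mu> \<in> states A \<Longrightarrow> a \<in> V \<Longrightarrow> \<bar>\<mu> a\<bar> \<le> N a"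
  by (simp_all add: states_iff)

lemma state_diff: "\<mu> \<in> states A \<Longrightarrow> a \<in> V \<Longrightarrow> b \<in> V \<Longrightarrow> \<mu> (a - b) = \<mu> a - \<mu> b"
  using state_add[of \<mu> a "(-1) *\<^sub>R b"] state_scaleR[of \<mu> b "-1"] by simp

lemma state_minus: "\<mu> \<in> states A \<Longrightarrow> a \<in> V \<Longrightarrow> \<mu> (- a) = - \<mu> a"
  using state_scaleR[of \<mu> a "-1"] by simp

lemma state_unit: "\<mu> \<in> states A \<Longrightarrow> \<mu> (c *\<^sub>R e) = c"
  using state_scaleR[of \<mu> e c] state_e by simp

end

section \<open>States attaining the upper bound of an element\<close>

definition sublinear_on :: "'a::real_vector set \<Rightarrow> ('a \<Rightarrow> real) \<Rightarrow> bool" where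
  "sublinear_on V p \<longleftrightarrow> (\<forall>x\<in>V. \<forall>y\<in>V. p (x + y) \<le> p x + p y) \<and>
     (\<forall>x\<in>V. \<forall>t\<ge>0. p (t *\<^sub>R x) = t * p x)"

lemma sublinear_on_zero: "sublinear_on V p \<Longrightarrow> subspace V \<Longrightarrow> p 0 = 0"
  unfolding sublinear_on_def using subspace_0[of V]
  by (metis mult_zero_left order_refl scaleR_zero_left)

lemma sublinear_on_minus:
  assumes "sublinear_on V p" "subspace V" "x \<in> V" shows "- p (- x) \<le> p x"
proof -
  have "p (x + - x) \<le> p x + p (- x)"
    using assms subspace_neg[of V x] unfolding sublinear_on_def by blast
  then show ?thesis using sublinear_on_zero[OF assms(1,2)] by simp
qed

text \<open>The tilt of \<open>p\<close> in the direction \<open>y\<close> is a sublinear functional below \<open>p\<close> that takes a value of at most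
\<open>- p y\<close> at \<open>- y\<close>, and therefore is linear along \<open>y\<close>.\<close>

definition tilt :: "'a::real_vector set \<Rightarrow> ('a \<Rightarrow> real) \<Rightarrow> 'a \<Rightarrow> 'a \<Rightarrow> real" where
  "tilt V p y = restrict (\<lambda>x. INF t\<in>{0..}. p (x + t *\<^sub>R y) - t * p y) V"

lemma tilt:
  assumes p: "sublinear_on V p" and V: "subspace V" and y: "y \<in> V"
  shows tilt_le: "\<And>x t. x \<in> V \<Longrightarrow> 0 \<le> t \<Longrightarrow> tilt V p y x \<le> p (x + t *\<^sub>R y) - t * p y"
    and sublinear_tilt: "sublinear_on V (tilt V p y)"
proof -
  note add = V[THEN subspace_add] note mul = V[THEN subspace_mul]
  have padd: "p (x + y) \<le> p x + p y" if "x \<in> V" "y \<in> V" for x y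
    using p that by (auto simp: sublinear_on_def)
  have pmul: "p (t *\<^sub>R x) = t * p x" if "x \<in> V" "t \<ge> 0" for x t
    using p that by (auto simp: sublinear_on_def)
  have lower: "- p (- x) \<le> p (x + t *\<^sub>R y) - t * p y" if "x \<in> V" "0 \<le> t" for x t
    using padd[of "x + t *\<^sub>R y" "- x"] pmul[of y t] that y add mul subspace_neg[OF V] by simp
  have bdd: "bdd_below ((\<lambda>t. p (x + t *\<^sub>R y) - t * p y) ` {0..})" if "x \<in> V" for x
    using lower[OF that] by (auto simp: bdd_below_def)
  show le: "tilt V p y x \<le> p (x + t *\<^sub>R y) - t * p y" if "x \<in> V" "0 \<le> t" for x t
    unfolding tilt_def using that by (simp add: cINF_lower[OF bdd])
  have ge: "c \<le> tilt V p y x" if "x \<in> V" "\<And>t. 0 \<le> t \<Longrightarrow> c \<le> p (x + t *\<^sub>R y) - t * p y" for c x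
    unfolding tilt_def using that by (auto intro!: cINF_greatest)
  have "tilt V p y (x + x') \<le> tilt V p y x + tilt V p y x'" if x: "x \<in> V" "x' \<in> V" for x x'
  proof -
    have "tilt V p y (x + x') - (p (x + t *\<^sub>R y) - t * p y) \<le> tilt V p y x'" if t: "0 \<le> t" for t
    proof (rule ge[OF x(2)])
      fix s :: real assume s: "0 \<le> s"
      have "tilt V p y (x + x') \<le> p (x + x' + (t + s) *\<^sub>R y) - (t + s) * p y"
        using le[of "x + x'" "t + s"] x s t add by simp
      also have "x + x' + (t + s) *\<^sub>R y = (x + t *\<^sub>R y) + (x' + s *\<^sub>R y)"
        by (simp add: algebra_simps)
      finally show "tilt V p y (x + x') - (p (x + t *\<^sub>R y) - t * p y) \<le> p (x' + s *\<^sub>R y) - s * p y"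
        using padd[of "x + t *\<^sub>R y" "x' + s *\<^sub>R y"] x y add mul by (simp add: algebra_simps)
    qed
    then have "tilt V p y (x + x') - tilt V p y x' \<le> tilt V p y x"
      by (intro ge[OF x(1)]) (simp add: algebra_simps)
    then show ?thesis by simp
  qed
  moreover have "tilt V p y (s *\<^sub>R x) = s * tilt V p y x" if x: "x \<in> V" and s: "0 \<le> s" for x s
  proof -
    have *: "tilt V p y (s *\<^sub>R x) \<le> s * tilt V p y x" if x: "x \<in> V" and s: "0 < s" for x s
    proof -
      have "tilt V p y (s *\<^sub>R x) / s \<le> tilt V p y x"
      proof (rule ge[OF x])
        fix t :: real assume t: "0 \<le> t"
        have "tilt V p y (s *\<^sub>R x) \<le> p (s *\<^sub>R x + (s * t) *\<^sub>R y) - (s * t) * p y"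
          using le[of "s *\<^sub>R x" "s * t"] x s t mul by simp
        also have "s *\<^sub>R x + (s * t) *\<^sub>R y = s *\<^sub>R (x + t *\<^sub>R y)" by (simp add: algebra_simps)
        finally show "tilt V p y (s *\<^sub>R x) / s \<le> p (x + t *\<^sub>R y) - t * p y"
          using pmul[of "x + t *\<^sub>R y" s] x y s add mul by (simp add: field_simps)
      qed
      then show ?thesis using s by (simp add: field_simps)
    qed
    show ?thesis
    proof (cases "s = 0")
      case True
      have "tilt V p y 0 \<le> 0"
        using le[of 0 0] subspace_0[OF V] sublinear_on_zero[OF p V] by simp
      moreover have "0 \<le> tilt V p y 0"
        using lower[of 0] by (intro ge) (use subspace_0[OF V] sublinear_on_zero[OF p V] in auto)
      ultimately show ?thesis using True by simp
    next
      case False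
      then have "s * tilt V p y ((1 / s) *\<^sub>R (s *\<^sub>R x)) \<le> s * ((1 / s) * tilt V p y (s *\<^sub>R x))"
        using *[of "s *\<^sub>R x" "1 / s"] x s mul by (intro mult_left_mono) auto
      then show ?thesis using *[OF x, of s] s False by simp
    qed
  qed
  ultimately show "sublinear_on V (tilt V p y)" by (simp add: sublinear_on_def)
qed

text \<open>A minimal \<open>q\<close> equals all of its tilts. Evaluating the infimum in \<open>tilt V q y x\<close> at \<open>t = 1\<close> then gives
\<open>q x + q y \<le> q (x + y)\<close>, the inequality that sublinearity lacks.\<close>

lemma minimal_sublinear_is_linear:
  assumes V: "subspace V" and q: "sublinear_on V q" and ext: "q \<in> extensional V"
    and min: "\<forall>r. sublinear_on V r \<longrightarrow> r \<in> extensional V \<longrightarrow> (\<forall>x\<in>V. r x \<le> q x) \<longrightarrow> r = q"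
  shows "\<And>x y. x \<in> V \<Longrightarrow> y \<in> V \<Longrightarrow> q (x + y) = q x + q y"
    and "\<And>x t. x \<in> V \<Longrightarrow> q (t *\<^sub>R x) = t * q x"
proof -
  show add: "q (x + y) = q x + q y" if x: "x \<in> V" and y: "y \<in> V" for x y
  proof -
    have "\<forall>x\<in>V. tilt V q y x \<le> q x" using tilt_le[OF q V y, of _ 0] by simp
    then have "tilt V q y = q"
      using min sublinear_tilt[OF q V y] by (auto simp: tilt_def)
    then have "q x \<le> q (x + y) - q y" using tilt_le[OF q V y x, of 1] by simp
    then show ?thesis using q x y unfolding sublinear_on_def by force
  qed
  show "q (t *\<^sub>R x) = t * q x" if x: "x \<in> V" for x t
  proof (cases "0 \<le> t")
    case True then show ?thesis using q x by (simp add: sublinear_on_def)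
  next
    case False
    have "q (t *\<^sub>R x + (- t) *\<^sub>R x) = q (t *\<^sub>R x) + q ((- t) *\<^sub>R x)"
      using x by (intro add subspace_mul[OF V])
    moreover have "q ((- t) *\<^sub>R x) = (- t) * q x"
      using q x False unfolding sublinear_on_def by (metis linorder_linear neg_0_le_iff_le)
    ultimately show ?thesis using sublinear_on_zero[OF q V] by (simp add: scaleR_left_distrib[symmetric])
  qed
qed

text \<open>Zorn's lemma applies because the pointwise infimum of a chain of sublinear functionals is sublinear;
it is finite since each \<open>q \<le> p\<close> satisfies \<open>q x \<ge> - q (- x) \<ge> - p (- x)\<close>. Functionals are taken
extensional on \<open>V\<close> to make the pointwise order antisymmetric.\<close>

lemma minimal_sublinear_exists:
  assumes V: "subspace V" and p: "sublinear_on V p"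
  obtains q where "sublinear_on V q" "q \<in> extensional V" "\<forall>x\<in>V. q x \<le> p x"
    "\<forall>r. sublinear_on V r \<longrightarrow> r \<in> extensional V \<longrightarrow> (\<forall>x\<in>V. r x \<le> q x) \<longrightarrow> r = q"
proof -
  define Q where "Q = {q. sublinear_on V q \<and> q \<in> extensional V \<and> (\<forall>x\<in>V. q x \<le> p x)}"
  define P where "P = (\<lambda>q r :: 'a \<Rightarrow> real. \<forall>x\<in>V. r x \<le> q x)"
  have p': "restrict p V \<in> Q"
    using p V by (auto simp: Q_def sublinear_on_def subspace_add subspace_mul)
  have "\<exists>m\<in>Q. \<forall>q\<in>Q. P m q \<longrightarrow> q = m"
  proof (rule predicate_Zorn)
    show "partial_order_on Q (relation_of P Q)"
    proof (rule partial_order_on_relation_ofI)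
      fix q r assume "q \<in> Q" "r \<in> Q" "P q r" "P r q"
      then show "q = r"
        by (intro extensionalityI[of _ V]) (auto simp: P_def Q_def intro: order_antisym)
    qed (auto simp: P_def intro: order_trans)
    fix C assume C: "C \<in> Chains (relation_of P Q)"
    then have CQ: "C \<subseteq> Q" and chain: "\<And>q r. q \<in> C \<Longrightarrow> r \<in> C \<Longrightarrow> P q r \<or> P r q"
      by (auto simp: Chains_def relation_of_def)
    show "\<exists>u\<in>Q. \<forall>q\<in>C. P q u"
    proof (cases "C = {}")
      case True then show ?thesis using p' by auto
    next
      case ne: False
      define u where "u = restrict (\<lambda>x. INF q\<in>C. q x) V"
      have sub: "sublinear_on V q" if "q \<in> C" for q using that CQ by (auto simp: Q_def)
      have bdd: "bdd_below ((\<lambda>q. q x) ` C)" if x: "x \<in> V" for x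
        unfolding bdd_below_def
      proof (intro exI ballI)
        fix r assume "r \<in> (\<lambda>q. q x) ` C"
        then obtain q where q: "q \<in> C" "r = q x" by auto
        have "q (- x) \<le> p (- x)" using q CQ x subspace_neg[OF V] by (auto simp: Q_def)
        then show "- p (- x) \<le> r" using sublinear_on_minus[OF sub[OF q(1)] V x] q by simp
      qed
      have u_le: "u x \<le> q x" if "x \<in> V" "q \<in> C" for x q
        using that by (simp add: u_def cINF_lower[OF bdd])
      have u_ge: "c \<le> u x" if "x \<in> V" "\<And>q. q \<in> C \<Longrightarrow> c \<le> q x" for x c
        using that ne by (auto simp: u_def intro!: cINF_greatest)
      have "u (x + y) \<le> u x + u y" if x: "x \<in> V" and y: "y \<in> V" for x y
      proof -
        have "u (x + y) - q x \<le> u y" if q: "q \<in> C" for q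
        proof (rule u_ge[OF y])
          fix r assume r: "r \<in> C"
          \<comment> \<open>The smaller of the two chain members bounds both summands at once.\<close>
          obtain s where s: "s \<in> C" "s x \<le> q x" "s y \<le> r y"
            using chain[OF q r] q r x y unfolding P_def by blast
          have "u (x + y) \<le> s (x + y)" using u_le x y s subspace_add[OF V] by blast
          also have "\<dots> \<le> s x + s y" using sub[OF s(1)] x y by (auto simp: sublinear_on_def)
          finally show "u (x + y) - q x \<le> r y" using s by linarith
        qed
        then have "u (x + y) - u y \<le> u x" by (intro u_ge[OF x]) (simp add: algebra_simps)
        then show ?thesis by simp
      qed
      moreover have "u (t *\<^sub>R x) = t * u x" if x: "x \<in> V" and t: "0 \<le> t" for x t
      proof (rule antisym)
        have mul: "q (t *\<^sub>R x) = t * q x" if "q \<in> C" for q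
          using sub[OF that] x t by (auto simp: sublinear_on_def)
        have tx: "t *\<^sub>R x \<in> V" using x subspace_mul[OF V] by blast
        show "t * u x \<le> u (t *\<^sub>R x)"
        proof (rule u_ge[OF tx])
          fix q assume "q \<in> C"
          then have "q (t *\<^sub>R x) = t * q x" "u x \<le> q x" using mul u_le[OF x] by auto
          then show "t * u x \<le> q (t *\<^sub>R x)" using t by (simp add: mult_left_mono)
        qed
        show "u (t *\<^sub>R x) \<le> t * u x"
        proof (cases "t = 0")
          case True
          then show ?thesis using ne u_le[OF tx] mul by fastforce
        next
          case False
          then have "u (t *\<^sub>R x) / t \<le> u x"
            using t u_le[OF tx] mul by (intro u_ge[OF x]) (fastforce simp: field_simps)
          then show ?thesis using False t by (simp add: field_simps)
        qed
      qed
      moreover have "\<forall>x\<in>V. u x \<le> p x"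
      proof
        fix x assume x: "x \<in> V"
        obtain q where "q \<in> C" using ne by blast
        then have "u x \<le> q x" "q x \<le> p x" using u_le x CQ by (auto simp: Q_def)
        then show "u x \<le> p x" by linarith
      qed
      ultimately have "u \<in> Q" by (auto simp: Q_def sublinear_on_def u_def)
      moreover have "\<forall>q\<in>C. P q u" using u_le by (auto simp: P_def)
      ultimately show ?thesis by blast
    qed
  qed
  then obtain m where m: "m \<in> Q" "\<And>q. q \<in> Q \<Longrightarrow> P m q \<Longrightarrow> q = m" by blast
  show thesis
  proof (rule that[of m])
    have "r = m" if "sublinear_on V r" "r \<in> extensional V" "\<forall>x\<in>V. r x \<le> m x" for r
      using that m(1) by (intro m(2)) (force simp: Q_def P_def)+
    then show "\<forall>r. sublinear_on V r \<longrightarrow> r \<in> extensional V \<longrightarrow> (\<forall>x\<in>V. r x \<le> m x) \<longrightarrow> r = m"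
      by blast
  qed (use m(1) in \<open>auto simp: Q_def\<close>)
qed

context proper_order_unit_space
begin

text \<open>A linear functional below the tilt of \<open>upper\<close> in the direction \<open>a\<close> has value at least \<open>upper a\<close> at
\<open>a\<close>. Being below \<open>upper\<close> at \<open>e\<close> and at \<open>- e\<close>, it maps \<open>e\<close> to \<open>1\<close>, so it is a state.\<close>

lemma ex_state_attaining_upper:
  assumes a: "a \<in> V" obtains \<mu> where "\<mu> \<in> states A" "a \<preceq> \<mu> a *\<^sub>R e"
proof -
  have sub: "sublinear_on V upper"
    unfolding sublinear_on_def using upper_add upper_scaleR by blast
  define p where "p = tilt V upper a"
  have p: "sublinear_on V p" and ple: "\<And>x. x \<in> V \<Longrightarrow> p x \<le> upper x" and pa: "p (- a) \<le> - upper a"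
    using sublinear_tilt[OF sub subspace_V a] tilt_le[OF sub subspace_V a, of _ 0]
      tilt_le[OF sub subspace_V a, of "- a" 1] a by (auto simp: p_def)
  obtain q where q: "sublinear_on V q" "q \<in> extensional V" "\<forall>x\<in>V. q x \<le> p x"
    and min: "\<forall>r. sublinear_on V r \<longrightarrow> r \<in> extensional V \<longrightarrow> (\<forall>x\<in>V. r x \<le> q x) \<longrightarrow> r = q"
    using minimal_sublinear_exists[OF subspace_V p] by metis
  note lin = minimal_sublinear_is_linear[OF subspace_V q(1,2) min]
  have neg: "q (- x) = - q x" if "x \<in> V" for x using lin(2)[OF that, of "-1"] by simp
  have qle: "q x \<le> upper x" if "x \<in> V" for x using q(3) ple that by fastforce
  have "q e = 1" using qle[of e] qle[of "- e"] neg[of e] upper_unit[of 1] upper_unit[of "- 1"] by simp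
  moreover have "\<bar>q x\<bar> \<le> N x" if "x \<in> V" for x
    using qle[OF that] qle[of "- x"] neg[OF that] norm_eq[OF that] that by auto
  ultimately have "q \<in> states A" using lin q(2) by (simp add: states_iff)
  moreover have "q (- a) \<le> p (- a)" using q(3) a by blast
  then have "upper a \<le> q a" using pa neg[OF a] by simp
  ultimately show thesis using that le_unit_iff[OF a] by blast
qed

lemma le_unit_if_states_le:
  assumes a: "a \<in> V" and c: "\<And>\<mu>. \<mu> \<in> states A \<Longrightarrow> \<mu> a \<le> c" shows "a \<preceq> c *\<^sub>R e"
proof -
  obtain \<mu> where \<mu>: "\<mu> \<in> states A" "a \<preceq> \<mu> a *\<^sub>R e" using ex_state_attaining_upper[OF a] .
  then show ?thesis using c[of \<mu>] le_unit_iff[OF a] by auto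
qed

lemma norm_le_if_states_le:
  assumes a: "a \<in> V" and c: "\<And>\<mu>. \<mu> \<in> states A \<Longrightarrow> \<bar>\<mu> a\<bar> \<le> c" shows "N a \<le> c"
proof -
  have "\<mu> a \<le> c" "\<mu> (- a) \<le> c" if "\<mu> \<in> states A" for \<mu>
    using c[OF that] state_minus[OF that a] by auto
  then show ?thesis using norm_le_iff[OF a] le_unit_if_states_le a by simp
qed

lemma states_nonempty: "states A \<noteq> {}"
  using ex_state_attaining_upper[of 0] by auto

end

section \<open>The weak-* topology and Lip-norms\<close>

context proper_order_unit_space
begin

lemma topspace_weak_star [simp]: "topspace (weak_star A) = states A"
proof -
  have "states A \<subseteq> extensional V" by (auto simp: states_iff)
  then show ?thesis by (auto simp: weak_star_def PiE_def)
qed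

text \<open>Alaoglu's theorem: the states form a closed subset of the product of the intervals \<open>{- N a .. N a}\<close>,
which is compact by Tychonoff's theorem.\<close>

lemma compact_weak_star: "compact_space (weak_star A)"
proof -
  let ?T = "product_topology (\<lambda>_. euclideanreal) V"
  let ?K = "PiE V (\<lambda>a. {- N a .. N a})"
  have K: "compactin ?T ?K" by (auto simp: compactin_PiE)
  have proj: "continuous_map ?T euclideanreal (\<lambda>\<mu>. \<mu> a)" if "a \<in> V" for a
    using that by (rule continuous_map_product_projection)
  define Z where "Z g = {\<mu> \<in> topspace ?T. g \<mu> = (0::real)}" for g
  have Z: "closedin ?T (Z g)" if "continuous_map ?T euclideanreal g" for g
    using closedin_continuous_map_preimage[OF that, of "{0}"] by (simp add: Z_def)
  define F where "F = insert (Z (\<lambda>\<mu>. \<mu> e - 1))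
    ((\<lambda>(a, b). Z (\<lambda>\<mu>. \<mu> (a + b) - \<mu> a - \<mu> b)) ` (V \<times> V) \<union>
     (\<lambda>(a, r). Z (\<lambda>\<mu>. \<mu> (r *\<^sub>R a) - r * \<mu> a)) ` (V \<times> UNIV))"
  have "closedin ?T C" if "C \<in> F" for C
    using that unfolding F_def
    by (auto intro!: Z continuous_map_diff proj continuous_map_real_mult_left)
  then have "closedin ?T (\<Inter>F)" by (intro closedin_Inter) (auto simp: F_def)
  moreover have "states A = ?K \<inter> \<Inter>F"
  proof (intro set_eqI)
    fix \<mu>
    have "\<mu> \<in> \<Inter>F \<longleftrightarrow> \<mu> \<in> extensional V \<and> \<mu> e = 1 \<and>
        (\<forall>a\<in>V. \<forall>b\<in>V. \<mu> (a + b) = \<mu> a + \<mu> b) \<and> (\<forall>a\<in>V. \<forall>r. \<mu> (r *\<^sub>R a) = r * \<mu> a)"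
      unfolding F_def Z_def Inter_iff by (auto simp: ball_Un algebra_simps PiE_iff)
    then show "\<mu> \<in> states A \<longleftrightarrow> \<mu> \<in> ?K \<inter> \<Inter>F"
      by (auto simp: states_iff PiE_iff abs_le_iff minus_le_iff)
  qed
  ultimately have "compactin ?T (states A)"
    using closed_Int_compactin[OF _ K, of "\<Inter>F"] by (simp add: Int_commute)
  then show ?thesis unfolding weak_star_def by (simp add: compact_space_subtopology)
qed

lemma eval_continuous: "a \<in> V \<Longrightarrow> continuous_map (weak_star A) euclideanreal (\<lambda>\<mu>. \<mu> a)"
  unfolding weak_star_def
  by (intro continuous_map_from_subtopology continuous_map_product_projection)

lemma openin_weak_star_finite:
  assumes U: "openin (weak_star A) U" and \<mu>: "\<mu> \<in> U"
  obtains I d where "finite I" "I \<subseteq> V" "d > 0"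
    "\<And>\<nu>. \<nu> \<in> states A \<Longrightarrow> (\<And>a. a \<in> I \<Longrightarrow> \<bar>\<mu> a - \<nu> a\<bar> < d) \<Longrightarrow> \<nu> \<in> U"
proof -
  obtain W where W: "openin (product_topology (\<lambda>_. euclideanreal) V) W" "U = W \<inter> states A"
    using U by (auto simp: weak_star_def openin_subtopology)
  obtain Z where Z: "finite {i \<in> V. Z i \<noteq> UNIV}" "\<And>i. i \<in> V \<Longrightarrow> open (Z i)"
    "\<mu> \<in> PiE V Z" "PiE V Z \<subseteq> W"
    using W \<mu> unfolding openin_product_topology_alt by fastforce
  define I where "I = {i \<in> V. Z i \<noteq> UNIV}"
  have "\<exists>d>0. \<forall>x. \<bar>\<mu> i - x\<bar> < d \<longrightarrow> x \<in> Z i" if "i \<in> I" for i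
  proof -
    have "open (Z i)" "\<mu> i \<in> Z i" using that Z by (auto simp: I_def)
    then obtain d where "d > 0" "\<And>y. dist y (\<mu> i) < d \<Longrightarrow> y \<in> Z i" unfolding open_dist by blast
    then show ?thesis by (auto simp: dist_real_def abs_minus_commute)
  qed
  then obtain d where d: "\<And>i. i \<in> I \<Longrightarrow> d i > 0 \<and> (\<forall>x. \<bar>\<mu> i - x\<bar> < d i \<longrightarrow> x \<in> Z i)" by metis
  define m where "m = Min (insert (1::real) (d ` I))"
  have fin: "finite I" using Z by (simp add: I_def)
  have "m > 0" unfolding m_def using fin d by (subst Min_gr_iff) auto
  moreover have m_le: "m \<le> d i" if "i \<in> I" for i unfolding m_def using fin that by simp
  moreover have "\<nu> \<in> U" if \<nu>: "\<nu> \<in> states A" "\<And>a. a \<in> I \<Longrightarrow> \<bar>\<mu> a - \<nu> a\<bar> < m" for \<nu>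
  proof -
    have "\<nu> i \<in> Z i" if i: "i \<in> V" for i
    proof (cases "i \<in> I")
      case True then show ?thesis using \<nu>(2)[OF True] m_le[OF True] d[OF True] by force
    qed (use i in \<open>auto simp: I_def\<close>)
    then have "\<nu> \<in> PiE V Z" using \<nu> by (auto simp: states_iff PiE_iff)
    then show ?thesis using W Z \<nu> by blast
  qed
  ultimately show thesis using that[of I m] fin by (auto simp: I_def)
qed

lemma rho_le_iff:
  "rho A L \<mu> \<nu> \<le> ereal c \<longleftrightarrow> (\<forall>a\<in>V. L a \<le> 1 \<longrightarrow> \<bar>\<mu> a - \<nu> a\<bar> \<le> c)"
  unfolding rho_def by (auto simp: SUP_le_iff)

lemma rho_lessE:
  assumes "rho A L \<mu> \<nu> < ereal c" 
  obtains d where "d < c" "\<And>a. a \<in> V \<Longrightarrow> L a \<le> 1 \<Longrightarrow> \<bar>\<mu> a - \<nu> a\<bar> \<le> d"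
proof -
  obtain d where "rho A L \<mu> \<nu> < ereal d" "d < c"
    using ereal_dense2[OF assms] by auto
  then show thesis using that[of d] rho_le_iff[of L \<mu> \<nu> d] by auto
qed

lemma rho_lessI:
  assumes "d < c" "\<And>a. a \<in> V \<Longrightarrow> L a \<le> 1 \<Longrightarrow> \<bar>\<mu> a - \<nu> a\<bar> \<le> d"
  shows "rho A L \<mu> \<nu> < ereal c"
  using rho_le_iff[of L \<mu> \<nu> d] assms by (meson ereal_less_eq(3) less_ereal.simps(1) order.strict_trans1)

end

locale seminormed_order_unit_space = proper_order_unit_space +
  fixes L :: "'a \<Rightarrow> real"
  assumes seminorm: "is_seminorm A L"
    and L_zero_iff: "a \<in> V \<Longrightarrow> L a = 0 \<longleftrightarrow> (\<exists>r. a = r *\<^sub>R e)"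
begin

lemma L_nonneg: "a \<in> V \<Longrightarrow> 0 \<le> L a"
  and L_add: "a \<in> V \<Longrightarrow> b \<in> V \<Longrightarrow> L (a + b) \<le> L a + L b"
  and L_scaleR: "a \<in> V \<Longrightarrow> L (r *\<^sub>R a) = \<bar>r\<bar> * L a"
  using seminorm by (auto simp: is_seminorm_def)

lemma L_unit [simp]: "L (c *\<^sub>R e) = 0"
  using L_zero_iff[of "c *\<^sub>R e"] by auto

lemma L_0 [simp]: "L 0 = 0"
  using L_unit[of 0] by simp

lemma L_add_unit [simp]: assumes "a \<in> V" shows "L (a + c *\<^sub>R e) = L a"
  using L_add[of a "c *\<^sub>R e"] L_add[of "a + c *\<^sub>R e" "(- c) *\<^sub>R e"] L_unit[of c] L_unit[of "- c"] assms
  by (simp del: L_unit)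

lemma L_diff_unit [simp]: "a \<in> V \<Longrightarrow> L (a - c *\<^sub>R e) = L a"
  using L_add_unit[of a "- c"] by simp

lemma diff_le_of_scaled:
  assumes \<mu>: "\<mu> \<in> states A" "\<nu> \<in> states A" and d: "\<And>a. a \<in> V \<Longrightarrow> L a \<le> 1 \<Longrightarrow> \<bar>\<mu> a - \<nu> a\<bar> \<le> d"
    and a: "a \<in> V" "L a \<le> s" "s > 0"
  shows "\<bar>\<mu> a - \<nu> a\<bar> \<le> s * d"
proof -
  have "\<bar>\<mu> ((1 / s) *\<^sub>R a) - \<nu> ((1 / s) *\<^sub>R a)\<bar> \<le> d"
    using a by (intro d) (auto simp: L_scaleR field_simps)
  then have "\<bar>(\<mu> a - \<nu> a) / s\<bar> \<le> d" using \<mu> a by (simp add: state_scaleR diff_divide_distrib)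
  then show ?thesis using a by (simp add: field_simps)
qed

text \<open>Evaluation at \<open>a\<close> is Lipschitz for \<open>rho\<close> with constant \<open>L a\<close>, so weak-* open sets are open for \<open>rho\<close>.
Conversely, two states agree on multiples of \<open>e\<close>, so if finitely many elements approximate the unit
ball of \<open>L\<close> up to such multiples, states with nearly equal values on them are close for \<open>rho\<close>.\<close>

lemma is_Lip_norm_if_totally_bounded:
  assumes tb: "\<And>\<eta>. \<eta> > 0 \<Longrightarrow> \<exists>G. finite G \<and> G \<subseteq> V \<and>
      (\<forall>a\<in>V. L a \<le> 1 \<longrightarrow> (\<exists>g\<in>G. \<exists>c. N (a - g - c *\<^sub>R e) \<le> \<eta>))"
  shows "is_Lip_norm A L"
  unfolding is_Lip_norm_def
proof (intro conjI allI impI ballI iffI)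
  show "is_seminorm A L" by (rule seminorm)
  show "\<exists>r. a = r *\<^sub>R e" if "a \<in> V" "L a = 0" for a using that L_zero_iff by blast
  show "L a = 0" if "a \<in> V" "\<exists>r. a = r *\<^sub>R e" for a using that by auto
  fix U assume US: "U \<subseteq> states A"
  {
    fix \<mu> assume U: "openin (weak_star A) U" and \<mu>: "\<mu> \<in> U"
    obtain I d where I: "finite I" "I \<subseteq> V" "d > 0"
      "\<And>\<nu>. \<nu> \<in> states A \<Longrightarrow> (\<And>a. a \<in> I \<Longrightarrow> \<bar>\<mu> a - \<nu> a\<bar> < d) \<Longrightarrow> \<nu> \<in> U"
      by (rule openin_weak_star_finite[OF U \<mu>]) blast
    define s where "s = Max (insert 0 (L ` I)) + 1"
    have "0 \<le> Max (insert 0 (L ` I))" "\<And>a. a \<in> I \<Longrightarrow> L a \<le> Max (insert 0 (L ` I))"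
      using I(1) by simp_all
    then have s: "s > 0" "\<And>a. a \<in> I \<Longrightarrow> L a \<le> s" unfolding s_def by fastforce+
    have "\<nu> \<in> U" if \<nu>: "\<nu> \<in> states A" "rho A L \<mu> \<nu> < ereal (d / s)" for \<nu>
    proof (rule I(4)[OF \<nu>(1)])
      fix a assume a: "a \<in> I"
      obtain q where q: "q < d / s" "\<And>a. a \<in> V \<Longrightarrow> L a \<le> 1 \<Longrightarrow> \<bar>\<mu> a - \<nu> a\<bar> \<le> q"
        using rho_lessE[OF \<nu>(2)] by blast
      have "\<bar>\<mu> a - \<nu> a\<bar> \<le> s * q"
        using diff_le_of_scaled[of \<mu> \<nu> q a s] \<mu> US \<nu> q a I(2) s by blast
      then show "\<bar>\<mu> a - \<nu> a\<bar> < d" using q(1) s by (simp add: field_simps)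
    qed
    then show "\<exists>\<epsilon>>0. {\<nu> \<in> states A. rho A L \<mu> \<nu> < ereal \<epsilon>} \<subseteq> U"
      using I(3) s by (intro exI[of _ "d / s"]) auto
  }
  {
    assume ball: "\<forall>\<mu>\<in>U. \<exists>\<epsilon>>0. {\<nu> \<in> states A. rho A L \<mu> \<nu> < ereal \<epsilon>} \<subseteq> U"
    show "openin (weak_star A) U"
    proof (subst openin_subopen, intro ballI)
      fix \<mu> assume \<mu>: "\<mu> \<in> U"
      then obtain \<epsilon> where \<epsilon>: "\<epsilon> > 0" "{\<nu> \<in> states A. rho A L \<mu> \<nu> < ereal \<epsilon>} \<subseteq> U" using ball by blast
      obtain G where G: "finite G" "G \<subseteq> V"
        "\<And>a. a \<in> V \<Longrightarrow> L a \<le> 1 \<Longrightarrow> \<exists>g\<in>G. \<exists>c. N (a - g - c *\<^sub>R e) \<le> \<epsilon> / 4"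
        using tb[of "\<epsilon> / 4"] \<epsilon> by auto
      define T where "T = topspace (weak_star A) \<inter>
        \<Inter> ((\<lambda>g. {\<nu> \<in> topspace (weak_star A). \<nu> g \<in> {\<mu> g - \<epsilon> / 4 <..< \<mu> g + \<epsilon> / 4}}) ` G)"
      have "openin (weak_star A) T"
        unfolding T_def using G
        by (intro openin_Int_Inter openin_topspace)
          (auto intro!: openin_continuous_map_preimage[OF eval_continuous]
             simp del: greaterThanLessThan_iff topspace_weak_star)
      moreover have "\<mu> \<in> T" using \<mu> US \<epsilon> by (auto simp: T_def)
      moreover have "T \<subseteq> U"
      proof
        fix \<nu> assume \<nu>: "\<nu> \<in> T"
        then have \<nu>S: "\<nu> \<in> states A" by (simp add: T_def)
        have \<mu>S: "\<mu> \<in> states A" using \<mu> US by blast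
        have "\<bar>\<mu> a - \<nu> a\<bar> \<le> 3 * \<epsilon> / 4" if a: "a \<in> V" "L a \<le> 1" for a
        proof -
          obtain g c where g: "g \<in> G" "N (a - g - c *\<^sub>R e) \<le> \<epsilon> / 4" using G(3)[OF a] by blast
          have gV: "g \<in> V" using g G by blast
          have *: "\<bar>\<sigma> a - \<sigma> g - c\<bar> \<le> \<epsilon> / 4" if "\<sigma> \<in> states A" for \<sigma>
            using state_le_norm[OF that, of "a - g - c *\<^sub>R e"] g a gV that
            by (simp add: state_diff state_unit)
          have "\<nu> g \<in> {\<mu> g - \<epsilon> / 4 <..< \<mu> g + \<epsilon> / 4}" using \<nu> g(1) unfolding T_def by blast
          then have "\<bar>\<mu> g - \<nu> g\<bar> \<le> \<epsilon> / 4" unfolding greaterThanLessThan_iff by linarith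
          then show ?thesis using *[OF \<nu>S] *[OF \<mu>S] by linarith
        qed
        then have "rho A L \<mu> \<nu> < ereal \<epsilon>" using \<epsilon> by (intro rho_lessI[of "3 * \<epsilon> / 4"]) auto
        then show "\<nu> \<in> U" using \<epsilon> \<nu>S by blast
      qed
      ultimately show "\<exists>T. openin (weak_star A) T \<and> \<mu> \<in> T \<and> T \<subseteq> U" by blast
    qed
  }
qed

end

lemma finite_image_representatives:
  assumes "finite (f ` E)"
  obtains G where "finite G" "G \<subseteq> E" "card G \<le> card (f ` E)" "\<And>x. x \<in> E \<Longrightarrow> \<exists>g\<in>G. f g = f x"
proof -
  obtain G where "G \<subseteq> E" "f ` E = f ` G" "inj_on f G"
    by (meson subset_image_inj subset_refl)
  moreover from this have "finite G" "card G = card (f ` E)"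
    using assms by (auto simp: card_image finite_image_iff)
  moreover have "\<exists>g\<in>G. f g = f x" if "x \<in> E" for x
    using that calculation(2) by (metis imageE imageI)
  ultimately show thesis using that[of G] by simp
qed

lemma floor_eq_imp_close:
  fixes x y \<epsilon> :: real
  assumes "\<lfloor>x / \<epsilon>\<rfloor> = \<lfloor>y / \<epsilon>\<rfloor>" "\<epsilon> > 0" shows "\<bar>x - y\<bar> < \<epsilon>"
proof -
  have "\<bar>x / \<epsilon> - y / \<epsilon>\<bar> < 1" using assms(1) by linarith
  then show ?thesis using assms(2) by (simp add: field_simps abs_less_iff)
qed

lemma floor_divide_bound:
  fixes x \<epsilon> R :: real
  assumes "\<bar>x\<bar> \<le> R" "\<epsilon> > 0"
  shows "\<lfloor>x / \<epsilon>\<rfloor> \<in> {- \<lceil>R / \<epsilon>\<rceil> - 1..\<lceil>R / \<epsilon>\<rceil>}"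
proof -
  have "\<bar>x / \<epsilon>\<bar> \<le> R / \<epsilon>" using assms by (simp add: divide_right_mono)
  then have "x / \<epsilon> \<le> R / \<epsilon>" "- (R / \<epsilon>) \<le> x / \<epsilon>" by linarith+
  then show ?thesis unfolding atLeastAtMost_iff by linarith
qed

section \<open>Radius and total boundedness of Lipschitz sets\<close>

locale proper_qms = proper_order_unit_space +
  fixes L :: "'a \<Rightarrow> real"
  assumes Lip: "is_Lip_norm A L"
begin

sublocale seminormed_order_unit_space
  using Lip by unfold_locales (auto simp: is_Lip_norm_def)

lemma openin_rho_ball:
  assumes \<mu>: "\<mu> \<in> states A" shows "openin (weak_star A) {\<nu> \<in> states A. rho A L \<mu> \<nu> < ereal \<epsilon>}"
proof -
  have "\<exists>\<delta>>0. {\<nu>' \<in> states A. rho A L \<nu> \<nu>' < ereal \<delta>} \<subseteq> {\<nu> \<in> states A. rho A L \<mu> \<nu> < ereal \<epsilon>}"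
    if \<nu>: "\<nu> \<in> states A" "rho A L \<mu> \<nu> < ereal \<epsilon>" for \<nu>
  proof -
    obtain d where d: "d < \<epsilon>" "\<And>a. a \<in> V \<Longrightarrow> L a \<le> 1 \<Longrightarrow> \<bar>\<mu> a - \<nu> a\<bar> \<le> d"
      using rho_lessE[OF \<nu>(2)] by blast
    have "rho A L \<mu> \<nu>' < ereal \<epsilon>" if \<nu>': "rho A L \<nu> \<nu>' < ereal (\<epsilon> - d)" for \<nu>'
    proof -
      obtain d' where d': "d' < \<epsilon> - d" "\<And>a. a \<in> V \<Longrightarrow> L a \<le> 1 \<Longrightarrow> \<bar>\<nu> a - \<nu>' a\<bar> \<le> d'"
        using rho_lessE[OF \<nu>'] by blast
      have "\<bar>\<mu> a - \<nu>' a\<bar> \<le> d + d'" if "a \<in> V" "L a \<le> 1" for a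
        using d(2)[OF that] d'(2)[OF that] by linarith
      then show ?thesis using d' by (intro rho_lessI[of "d + d'"]) auto
    qed
    then show ?thesis using d by (intro exI[of _ "\<epsilon> - d"]) auto
  qed
  then show ?thesis using Lip unfolding is_Lip_norm_def by (auto simp: Collect_subset)
qed

lemma finite_rho_net:
  assumes "\<epsilon> > 0"
  obtains M where "finite M" "M \<subseteq> states A" "\<And>\<nu>. \<nu> \<in> states A \<Longrightarrow> \<exists>\<mu>\<in>M. rho A L \<mu> \<nu> < ereal \<epsilon>"
proof -
  let ?B = "\<lambda>\<mu>. {\<nu> \<in> states A. rho A L \<mu> \<nu> < ereal \<epsilon>}"
  have self: "\<mu> \<in> ?B \<mu>" if "\<mu> \<in> states A" for \<mu>
    using that rho_lessI[of 0 \<epsilon> L \<mu> \<mu>] assms by auto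
  have "compactin (weak_star A) (states A)"
    using compact_weak_star unfolding compact_space_def by simp
  moreover have "\<forall>U\<in>?B ` states A. openin (weak_star A) U" using openin_rho_ball by blast
  moreover have "states A \<subseteq> \<Union>(?B ` states A)" using self by blast
  ultimately obtain F where F: "finite F" "F \<subseteq> ?B ` states A" "states A \<subseteq> \<Union>F"
    unfolding compactin_def by meson
  then obtain M where "M \<subseteq> states A" "finite M" "F = ?B ` M"
    by (meson finite_subset_image)
  then show thesis using F by (intro that[of M]) auto
qed

text \<open>The value of \<open>rho\<close> could be infinite. It is not, by convexity: the states \<open>(1 - t) \<mu> + t \<nu>\<close> have distance
\<open>t\<close> times that of \<open>\<mu>\<close> and \<open>\<nu>\<close> from \<open>\<mu>\<close>, and for small \<open>t > 0\<close> they lie in the \<open>rho\<close>-ball of radius \<open>1\<close>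
around \<open>\<mu>\<close>, which is a weak-* neighbourhood.\<close>

lemma rho_pairwise_finite:
  assumes \<mu>: "\<mu> \<in> states A" and \<nu>: "\<nu> \<in> states A"
  shows "\<exists>D. \<forall>a\<in>V. L a \<le> 1 \<longrightarrow> \<bar>\<mu> a - \<nu> a\<bar> \<le> D"
proof -
  define \<sigma> where "\<sigma> t = restrict (\<lambda>a. (1 - t) * \<mu> a + t * \<nu> a) V" for t
  have \<sigma>: "\<sigma> t \<in> states A" if t: "0 \<le> t" "t \<le> 1" for t
  proof -
    have "\<bar>(1 - t) * \<mu> a + t * \<nu> a\<bar> \<le> N a" if a: "a \<in> V" for a
    proof -
      have "\<bar>(1 - t) * \<mu> a + t * \<nu> a\<bar> \<le> (1 - t) * \<bar>\<mu> a\<bar> + t * \<bar>\<nu> a\<bar>"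
        using t by (intro order_trans[OF abs_triangle_ineq]) (simp add: abs_mult)
      also have "\<dots> \<le> (1 - t) * N a + t * N a"
        using t a \<mu> \<nu> by (intro add_mono mult_left_mono state_le_norm) auto
      finally show ?thesis by (simp add: algebra_simps)
    qed
    then show ?thesis
      using \<mu> \<nu> unfolding states_iff \<sigma>_def by (auto simp: algebra_simps)
  qed
  let ?B = "{\<nu> \<in> states A. rho A L \<mu> \<nu> < ereal 1}"
  have self: "\<mu> \<in> ?B" using \<mu> rho_lessI[of 0 1 L \<mu> \<mu>] by auto
  obtain I d where I: "finite I" "I \<subseteq> V" "d > 0"
      "\<And>\<nu>. \<nu> \<in> states A \<Longrightarrow> (\<And>a. a \<in> I \<Longrightarrow> \<bar>\<mu> a - \<nu> a\<bar> < d) \<Longrightarrow> \<nu> \<in> ?B"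
    by (rule openin_weak_star_finite[OF openin_rho_ball[OF \<mu>, of 1] self]) blast
  define s where "s = (\<Sum>a\<in>I. \<bar>\<mu> a - \<nu> a\<bar>) + 1"
  have s: "s \<ge> 1" "\<And>a. a \<in> I \<Longrightarrow> \<bar>\<mu> a - \<nu> a\<bar> < s"
    unfolding s_def using member_le_sum[OF _ _ I(1), of _ "\<lambda>a. \<bar>\<mu> a - \<nu> a\<bar>"]
    by (auto simp: sum_nonneg intro: le_less_trans[OF _ less_add_one])
  define t where "t = min 1 (d / s)"
  have t: "0 < t" "t \<le> 1" "t * s \<le> d" using I s by (auto simp: t_def min_def field_simps)
  have diff: "\<mu> a - \<sigma> t a = t * (\<mu> a - \<nu> a)" if "a \<in> V" for a
    using that by (simp add: \<sigma>_def algebra_simps)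
  have "\<sigma> t \<in> ?B"
  proof (rule I(4))
    show "\<sigma> t \<in> states A" using t by (intro \<sigma>) auto
    fix a assume a: "a \<in> I"
    have "\<bar>\<mu> a - \<sigma> t a\<bar> = t * \<bar>\<mu> a - \<nu> a\<bar>" using diff[of a] a I t by (auto simp: abs_mult)
    also have "\<dots> < t * s" using s(2)[OF a] t by simp
    finally show "\<bar>\<mu> a - \<sigma> t a\<bar> < d" using t by simp
  qed
  then obtain q where q: "q < 1" "\<And>a. a \<in> V \<Longrightarrow> L a \<le> 1 \<Longrightarrow> \<bar>\<mu> a - \<sigma> t a\<bar> \<le> q"
    using rho_lessE[of L \<mu> "\<sigma> t" 1] by auto
  have "\<bar>\<mu> a - \<nu> a\<bar> \<le> 1 / t" if a: "a \<in> V" "L a \<le> 1" for a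
  proof -
    have "\<bar>t * (\<mu> a - \<nu> a)\<bar> \<le> q" using q(2)[OF a] by (simp only: diff[OF a(1)])
    then have "t * \<bar>\<mu> a - \<nu> a\<bar> \<le> 1" using t q(1) by (simp add: abs_mult)
    then show ?thesis using t by (simp add: field_simps)
  qed
  then show ?thesis by blast
qed

lemma rho_bounded: "\<exists>D. \<forall>\<mu>\<in>states A. \<forall>\<nu>\<in>states A. \<forall>a\<in>V. L a \<le> 1 \<longrightarrow> \<bar>\<mu> a - \<nu> a\<bar> \<le> D"
proof -
  obtain M where M: "finite M" "M \<subseteq> states A" "\<And>\<nu>. \<nu> \<in> states A \<Longrightarrow> \<exists>\<mu>\<in>M. rho A L \<mu> \<nu> < ereal 1"
    using finite_rho_net[of 1] by auto
  obtain \<mu>0 where \<mu>0: "\<mu>0 \<in> states A" using states_nonempty by blast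
  have "\<forall>\<mu>\<in>M. \<exists>D. \<forall>a\<in>V. L a \<le> 1 \<longrightarrow> \<bar>\<mu>0 a - \<mu> a\<bar> \<le> D"
    using rho_pairwise_finite[OF \<mu>0] M(2) by blast
  then obtain D where D: "\<And>\<mu> a. \<mu> \<in> M \<Longrightarrow> a \<in> V \<Longrightarrow> L a \<le> 1 \<Longrightarrow> \<bar>\<mu>0 a - \<mu> a\<bar> \<le> D \<mu>"
    by metis
  define C where "C = Max (insert 0 (D ` M)) + 1"
  have "\<bar>\<mu>0 a - \<nu> a\<bar> \<le> C" if \<nu>: "\<nu> \<in> states A" and a: "a \<in> V" "L a \<le> 1" for \<nu> a
  proof -
    obtain \<mu> where \<mu>: "\<mu> \<in> M" "rho A L \<mu> \<nu> < ereal 1" using M(3)[OF \<nu>] by blast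
    obtain d where "d < 1" "\<And>a. a \<in> V \<Longrightarrow> L a \<le> 1 \<Longrightarrow> \<bar>\<mu> a - \<nu> a\<bar> \<le> d"
      using rho_lessE[OF \<mu>(2)] by blast
    then have "\<bar>\<mu> a - \<nu> a\<bar> \<le> 1" using a by fastforce
    moreover have "D \<mu> + 1 \<le> C" unfolding C_def using M(1) \<mu>(1) by simp
    ultimately show ?thesis using D[OF \<mu>(1) a] by linarith
  qed
  note C = this
  have "\<bar>\<mu> a - \<nu> a\<bar> \<le> 2 * C" if "\<mu> \<in> states A" "\<nu> \<in> states A" "a \<in> V" "L a \<le> 1" for \<mu> \<nu> a
    using C[OF that(1,3,4)] C[OF that(2,3,4)] by linarith
  then show ?thesis by blast
qed

text \<open>As the diameter is finite, the conversion to a real number in the definition of the radius loses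
nothing.\<close>

lemma metric_diam_eq: "metric_diam (rho A L) (states A) = ereal (2 * radius A L)"
proof -
  obtain D where D: "\<forall>\<mu>\<in>states A. \<forall>\<nu>\<in>states A. \<forall>a\<in>V. L a \<le> 1 \<longrightarrow> \<bar>\<mu> a - \<nu> a\<bar> \<le> D"
    using rho_bounded by blast
  obtain \<mu> where \<mu>: "\<mu> \<in> states A" using states_nonempty by blast
  have "metric_diam (rho A L) (states A) \<le> ereal D"
    unfolding metric_diam_def using D by (auto simp: SUP_le_iff rho_le_iff)
  moreover have "ereal 0 \<le> rho A L \<mu> \<mu>"
    unfolding rho_def by (intro SUP_upper2[of 0]) auto
  then have "ereal 0 \<le> metric_diam (rho A L) (states A)"
    unfolding metric_diam_def using \<mu> by (meson SUP_upper2)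
  ultimately have "\<bar>metric_diam (rho A L) (states A)\<bar> \<noteq> \<infinity>" by auto
  then show ?thesis unfolding radius_def by (simp add: ereal_real)
qed

lemma radius_le_iff:
  "2 * radius A L \<le> c \<longleftrightarrow> (\<forall>\<mu>\<in>states A. \<forall>\<nu>\<in>states A. \<forall>a\<in>V. L a \<le> 1 \<longrightarrow> \<bar>\<mu> a - \<nu> a\<bar> \<le> c)"
proof -
  have "2 * radius A L \<le> c \<longleftrightarrow> metric_diam (rho A L) (states A) \<le> ereal c"
    by (simp add: metric_diam_eq)
  also have "\<dots> \<longleftrightarrow> (\<forall>\<mu>\<in>states A. \<forall>\<nu>\<in>states A. rho A L \<mu> \<nu> \<le> ereal c)"
    unfolding metric_diam_def by (auto simp: SUP_le_iff)
  finally show ?thesis by (simp add: rho_le_iff)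
qed

lemma radius_nonneg: "0 \<le> radius A L"
proof -
  obtain \<mu> where \<mu>: "\<mu> \<in> states A" using states_nonempty by blast
  then have "\<bar>\<mu> 0 - \<mu> 0\<bar> \<le> 2 * radius A L"
    using radius_le_iff[of "2 * radius A L"] V_closed(1) L_0 by (metis order_refl zero_le_one)
  then show ?thesis by simp
qed

text \<open>The values of \<open>a\<close> on the states fill an interval of length at most twice the radius, and \<open>c\<close> is its
midpoint. Hence \<open>Lip_ball A L\<close> represents the whole unit ball of \<open>L\<close> modulo multiples of the unit.\<close>

lemma ex_centre:
  assumes a: "a \<in> V" "L a \<le> 1" shows "\<exists>c. N (a - c *\<^sub>R e) \<le> radius A L"
proof -
  obtain \<mu> where \<mu>: "\<mu> \<in> states A" "a \<preceq> \<mu> a *\<^sub>R e" using ex_state_attaining_upper[OF a(1)] .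
  obtain \<nu> where \<nu>: "\<nu> \<in> states A" "- a \<preceq> \<nu> (- a) *\<^sub>R e" using ex_state_attaining_upper[of "- a"] a by auto
  have "\<bar>\<mu> a - \<nu> a\<bar> \<le> 2 * radius A L"
    using radius_le_iff[of "2 * radius A L"] \<mu>(1) \<nu>(1) a by blast
  then have r: "\<mu> a - \<nu> a \<le> 2 * radius A L" by linarith
  define c where "c = (\<mu> a + \<nu> a) / 2"
  have "upper a \<le> \<mu> a" using \<mu>(2) le_unit_iff a by blast
  moreover have "upper (- a) \<le> \<nu> (- a)" using \<nu>(2) le_unit_iff a by blast
  then have "upper (- a) \<le> - \<nu> a" using state_minus[OF \<nu>(1) a(1)] by simp
  moreover have "upper (a - c *\<^sub>R e) = upper a - c" "upper (- (a - c *\<^sub>R e)) = upper (- a) + c"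
    using upper_add_unit[of a "- c"] upper_add_unit[of "- a" c] a by auto
  ultimately have "N (a - c *\<^sub>R e) \<le> radius A L"
    using a r by (simp add: norm_eq c_def field_simps)
  then show ?thesis by blast
qed

text \<open>The argument of Arzela and Ascoli: two elements of the set that have the same rounded values at a
finite \<open>\<delta>\<close>-net of states differ by at most \<open>3 \<delta>\<close> at every state.\<close>

lemma totally_bounded_Lip_set:
  assumes \<epsilon>: "\<epsilon> > 0"
  obtains G where "finite G" "G \<subseteq> V" "\<And>a. a \<in> V \<Longrightarrow> L a \<le> 1 \<Longrightarrow> N a \<le> R \<Longrightarrow> \<exists>g\<in>G. N (a - g) < \<epsilon>"
proof -
  define \<delta> where "\<delta> = \<epsilon> / 4"
  have \<delta>: "\<delta> > 0" using \<epsilon> by (simp add: \<delta>_def)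
  obtain M where M: "finite M" "M \<subseteq> states A" "\<And>\<nu>. \<nu> \<in> states A \<Longrightarrow> \<exists>\<mu>\<in>M. rho A L \<mu> \<nu> < ereal \<delta>"
    using finite_rho_net[OF \<delta>] by auto
  let ?E = "{a \<in> V. L a \<le> 1 \<and> N a \<le> R}"
  define f where "f a = restrict (\<lambda>\<mu>. \<lfloor>\<mu> a / \<delta>\<rfloor>) M" for a
  have "f ` ?E \<subseteq> PiE M (\<lambda>_. {- \<lceil>R / \<delta>\<rceil> - 1..\<lceil>R / \<delta>\<rceil>})"
  proof (intro image_subsetI)
    fix a assume a: "a \<in> ?E"
    have "\<bar>\<mu> a\<bar> \<le> R" if "\<mu> \<in> M" for \<mu>
    proof -
      have "\<bar>\<mu> a\<bar> \<le> N a" using that a M(2) by (intro state_le_norm) auto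
      then show ?thesis using a by simp
    qed
    then show "f a \<in> PiE M (\<lambda>_. {- \<lceil>R / \<delta>\<rceil> - 1..\<lceil>R / \<delta>\<rceil>})"
      unfolding f_def restrict_PiE_iff using floor_divide_bound[OF _ \<delta>] by blast
  qed
  then have fin: "finite (f ` ?E)" by (rule finite_subset) (intro finite_PiE M finite_atLeastAtMost_int)
  obtain G where G: "finite G" "G \<subseteq> ?E" "\<And>a. a \<in> ?E \<Longrightarrow> \<exists>g\<in>G. f g = f a"
    by (rule finite_image_representatives[OF fin]) blast
  have "\<exists>g\<in>G. N (a - g) < \<epsilon>" if a: "a \<in> V" "L a \<le> 1" "N a \<le> R" for a
  proof -
    obtain g where g: "g \<in> G" "f g = f a" using G a by blast
    then have gE: "g \<in> V" "L g \<le> 1" using G by auto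
    have "N (a - g) \<le> 3 * \<delta>"
    proof (rule norm_le_if_states_le)
      fix \<nu> assume \<nu>: "\<nu> \<in> states A"
      obtain \<mu> where \<mu>: "\<mu> \<in> M" "rho A L \<mu> \<nu> < ereal \<delta>" using M(3)[OF \<nu>] by blast
      obtain d where d: "d < \<delta>" "\<And>a. a \<in> V \<Longrightarrow> L a \<le> 1 \<Longrightarrow> \<bar>\<mu> a - \<nu> a\<bar> \<le> d"
        using rho_lessE[OF \<mu>(2)] by blast
      have "\<lfloor>\<mu> g / \<delta>\<rfloor> = \<lfloor>\<mu> a / \<delta>\<rfloor>" using fun_cong[OF g(2), of \<mu>] \<mu>(1) by (simp add: f_def)
      then have "\<bar>\<mu> g - \<mu> a\<bar> < \<delta>" using \<delta> by (rule floor_eq_imp_close)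
      then show "\<bar>\<nu> (a - g)\<bar> \<le> 3 * \<delta>"
        using d(1) d(2)[OF a(1,2)] d(2)[OF gE] \<nu> a gE by (simp add: state_diff)
    qed (use a gE in auto)
    then show ?thesis using g \<epsilon> by (intro bexI[of _ g]) (auto simp: \<delta>_def)
  qed
  then show thesis using that[of G] G by auto
qed

end

section \<open>Upper bounds for the distance\<close>

lemma direct_sum_simps [simp]:
  "carr (direct_sum A B) = carr A \<times> carr B"
  "ounit (direct_sum A B) = (ounit A, ounit B)"
  "leq (direct_sum A B) p q \<longleftrightarrow> leq A (fst p) (fst q) \<and> leq B (snd p) (snd q)"
  by (simp_all add: direct_sum_def)

lemma proper_direct_sum:
  assumes "proper_order_unit_space A" "proper_order_unit_space B"
  shows "proper_order_unit_space (direct_sum A B)"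
proof -
  interpret A: proper_order_unit_space A by fact
  interpret B: proper_order_unit_space B by fact
  have "subspace (A.V \<times> B.V)"
    using A.subspace_V B.subspace_V by (auto simp: subspace_def zero_prod_def)
  then have "partially_ordered_vector_space (direct_sum A B)"
    unfolding partially_ordered_vector_space_def
    by (auto intro: A.le_antisym B.le_antisym A.le_trans B.le_trans A.le_add_right B.le_add_right
        A.le_scaleR B.le_scaleR)
  moreover have "\<exists>r. leq A a (r *\<^sub>R A.e) \<and> leq B b (r *\<^sub>R B.e)" if "a \<in> A.V" "b \<in> B.V" for a b
    using that A.le_unit_iff B.le_unit_iff by (intro exI[of _ "max (A.upper a) (B.upper b)"]) auto
  moreover have "leq A a 0" if "a \<in> A.V" "\<forall>r>0. leq A a (r *\<^sub>R A.e)" for a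
    using A.archimedean[of a 0] that by simp
  moreover have "leq B b 0" if "b \<in> B.V" "\<forall>r>0. leq B b (r *\<^sub>R B.e)" for b
    using B.archimedean[of b 0] that by simp
  ultimately have "is_order_unit_space (direct_sum A B)"
    unfolding is_order_unit_space_def using A.e_nz by (auto simp: zero_prod_def)
  then show ?thesis
    using A.unit_pos B.unit_pos by unfold_locales simp_all
qed

definition sup_seminorm :: "('a \<Rightarrow> real) \<Rightarrow> ('b \<Rightarrow> real) \<Rightarrow> ('a \<times> 'b \<Rightarrow> real) \<Rightarrow> 'a \<times> 'b \<Rightarrow> real"
  where "sup_seminorm LA LB \<beta> p = max (max (LA (fst p)) (LB (snd p))) (\<beta> p)"

text \<open>The two lifting conditions say that the infima defining the quotient seminorms of the maximum are
attained with the values \<open>LA a\<close> and \<open>LB b\<close>.\<close>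

lemma sup_seminorm:
  fixes A :: "'a::real_vector order_unit_space" and B :: "'b::real_vector order_unit_space"
  assumes e: "ounit A \<in> carr A" "ounit B \<in> carr B"
    and LA: "is_seminorm A LA" "\<forall>a\<in>carr A. LA a = 0 \<longleftrightarrow> (\<exists>r. a = r *\<^sub>R ounit A)"
    and LB: "is_seminorm B LB" "\<forall>b\<in>carr B. LB b = 0 \<longleftrightarrow> (\<exists>r. b = r *\<^sub>R ounit B)"
    and \<beta>: "is_seminorm (direct_sum A B) \<beta>"
    and \<beta>_unit: "\<And>r s. \<beta> (r *\<^sub>R ounit A, s *\<^sub>R ounit B) = 0 \<longleftrightarrow> r = s"
    and liftA: "\<And>a. a \<in> carr A \<Longrightarrow> \<exists>b\<in>carr B. LB b \<le> LA a \<and> \<beta> (a, b) \<le> LA a"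
    and liftB: "\<And>b. b \<in> carr B \<Longrightarrow> \<exists>a\<in>carr A. LA a \<le> LB b \<and> \<beta> (a, b) \<le> LB b"
  defines "L \<equiv> sup_seminorm LA LB \<beta>"
  shows "is_seminorm (direct_sum A B) L"
    and "\<forall>p\<in>carr (direct_sum A B). L p = 0 \<longleftrightarrow> (\<exists>r. p = r *\<^sub>R ounit (direct_sum A B))"
    and "is_Lip_norm (direct_sum A B) L \<Longrightarrow> admissible A LA B LB L"
proof -
  note L = L_def sup_seminorm_def
  have \<beta>0: "0 \<le> \<beta> p" if "p \<in> carr A \<times> carr B" for p using \<beta> that by (auto simp: is_seminorm_def)
  have A0: "0 \<le> LA a" if "a \<in> carr A" for a using LA that by (auto simp: is_seminorm_def)
  have B0: "0 \<le> LB b" if "b \<in> carr B" for b using LB that by (auto simp: is_seminorm_def)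
  have add: "L (p + q) \<le> L p + L q" if "p \<in> carr A \<times> carr B" "q \<in> carr A \<times> carr B" for p q
  proof -
    have "LA (fst p + fst q) \<le> LA (fst p) + LA (fst q)"
      "LB (snd p + snd q) \<le> LB (snd p) + LB (snd q)" "\<beta> (p + q) \<le> \<beta> p + \<beta> q"
      using LA(1) LB(1) \<beta> that unfolding is_seminorm_def by auto
    then show ?thesis by (simp add: L max_def)
  qed
  have mul: "L (r *\<^sub>R p) = \<bar>r\<bar> * L p" if "p \<in> carr A \<times> carr B" for p r
    using LA(1) LB(1) \<beta> that by (auto simp: L is_seminorm_def max_mult_distrib_left)
  show "is_seminorm (direct_sum A B) L"
    using add mul A0 by (auto simp: is_seminorm_def L le_max_iff_disj)
  show "\<forall>p\<in>carr (direct_sum A B). L p = 0 \<longleftrightarrow> (\<exists>r. p = r *\<^sub>R ounit (direct_sum A B))"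
  proof clarsimp
    fix a b assume ab: "a \<in> carr A" "b \<in> carr B"
    have "L (a, b) = 0 \<longleftrightarrow> LA a = 0 \<and> LB b = 0 \<and> \<beta> (a, b) = 0"
      using A0[OF ab(1)] B0[OF ab(2)] \<beta>0[of "(a, b)"] ab by (auto simp: L max_def)
    then show "L (a, b) = 0 \<longleftrightarrow> (\<exists>r. a = r *\<^sub>R ounit A \<and> b = r *\<^sub>R ounit B)"
      using LA(2) LB(2) ab \<beta>_unit by auto
  qed
  assume Lip: "is_Lip_norm (direct_sum A B) L"
  have "(INF b\<in>carr B. L (a, b)) = LA a" if a: "a \<in> carr A" for a
  proof (rule cInf_eq_minimum)
    obtain b where "b \<in> carr B" "LB b \<le> LA a" "\<beta> (a, b) \<le> LA a" using liftA[OF a] by blast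
    then show "LA a \<in> (\<lambda>b. L (a, b)) ` carr B" by (intro image_eqI[of _ _ b]) (auto simp: L)
  qed (auto simp: L)
  moreover have "(INF a\<in>carr A. L (a, b)) = LB b" if b: "b \<in> carr B" for b
  proof (rule cInf_eq_minimum)
    obtain a where "a \<in> carr A" "LA a \<le> LB b" "\<beta> (a, b) \<le> LB b" using liftB[OF b] by blast
    then show "LB b \<in> (\<lambda>a. L (a, b)) ` carr A" by (intro image_eqI[of _ _ a]) (auto simp: L)
  qed (auto simp: L)
  ultimately show "admissible A LA B LB L" using Lip by (simp add: admissible_def)
qed

text \<open>The comparison functional \<open>\<gamma>\<close> is homogeneous, so lifting elements of the unit ball suffices. Elements with
\<open>LA a = 0\<close> cannot be scaled to the unit sphere, but they are multiples of the unit.\<close>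

lemma lift_by_scaling:
  fixes \<gamma> :: "'a::real_vector \<Rightarrow> 'b::real_vector \<Rightarrow> real"
  assumes A: "seminormed_order_unit_space A LA" and B: "seminormed_order_unit_space B LB"
    and lift: "\<And>a. a \<in> carr A \<Longrightarrow> LA a \<le> 1 \<Longrightarrow> \<exists>b\<in>carr B. LB b \<le> 1 \<and> \<gamma> a b \<le> 1"
    and scale: "\<And>r a b. a \<in> carr A \<Longrightarrow> b \<in> carr B \<Longrightarrow> \<gamma> (r *\<^sub>R a) (r *\<^sub>R b) \<le> \<bar>r\<bar> * \<gamma> a b"
    and unit: "\<And>r. \<gamma> (r *\<^sub>R ounit A) (r *\<^sub>R ounit B) \<le> 0"
    and a: "a \<in> carr A"
  shows "\<exists>b\<in>carr B. LB b \<le> LA a \<and> \<gamma> a b \<le> LA a"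
proof -
  interpret A: seminormed_order_unit_space A LA by fact
  interpret B: seminormed_order_unit_space B LB by fact
  show ?thesis
  proof (cases "LA a = 0")
    case True
    then obtain r where "a = r *\<^sub>R A.e" using A.L_zero_iff[OF a] by blast
    then show ?thesis using unit[of r] by (intro bexI[of _ "r *\<^sub>R B.e"]) auto
  next
    case False
    define s where "s = LA a"
    have s: "s > 0" using False A.L_nonneg[OF a] by (simp add: s_def)
    obtain b where b: "b \<in> B.V" "LB b \<le> 1" "\<gamma> ((1 / s) *\<^sub>R a) b \<le> 1"
      using lift[of "(1 / s) *\<^sub>R a"] a s by (auto simp: A.L_scaleR s_def)
    have "\<gamma> (s *\<^sub>R ((1 / s) *\<^sub>R a)) (s *\<^sub>R b) \<le> \<bar>s\<bar> * \<gamma> ((1 / s) *\<^sub>R a) b"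
      using a b(1) by (intro scale) auto
    also have "\<dots> \<le> s" using b(3) s by simp
    finally show ?thesis
      using b s by (intro bexI[of _ "s *\<^sub>R b"]) (auto simp: B.L_scaleR s_def[symmetric])
  qed
qed

lemma hausdorff_dist_leI:
  assumes "\<And>x. x \<in> X \<Longrightarrow> \<exists>y\<in>Y. d x y \<le> c" "\<And>y. y \<in> Y \<Longrightarrow> \<exists>x\<in>X. d x y \<le> c"
  shows "hausdorff_dist d X Y \<le> c"
proof -
  have "(INF y\<in>Y. d x y) \<le> c" if "x \<in> X" for x using assms(1)[OF that] by (auto intro: INF_lower2)
  moreover have "(INF x\<in>X. d x y) \<le> c" if "y \<in> Y" for y using assms(2)[OF that] by (auto intro: INF_lower2)
  ultimately show ?thesis by (simp add: hausdorff_dist_def SUP_least)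
qed

lemma hausdorff_dist_lessD:
  assumes "hausdorff_dist d X Y < c"
  shows "x \<in> X \<Longrightarrow> \<exists>y\<in>Y. d x y < c" and "y \<in> Y \<Longrightarrow> \<exists>x\<in>X. d x y < c"
proof -
  have *: "(SUP x\<in>X. INF y\<in>Y. d x y) < c" "(SUP y\<in>Y. INF x\<in>X. d x y) < c"
    using assms by (simp_all add: hausdorff_dist_def)
  show "\<exists>y\<in>Y. d x y < c" if "x \<in> X"
    using le_less_trans[OF SUP_upper[OF that] *(1)] by (simp add: INF_less_iff)
  show "\<exists>x\<in>X. d x y < c" if "y \<in> Y"
    using le_less_trans[OF SUP_upper[OF that] *(2)] by (simp add: INF_less_iff)
qed

locale proper_qms_pair =
  A: proper_qms A LA + B: proper_qms B LB
  for A :: "'a::real_vector order_unit_space" and LA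
    and B :: "'b::real_vector order_unit_space" and LB
begin

sublocale S: proper_order_unit_space "direct_sum A B"
  using proper_direct_sum A.proper_order_unit_space_axioms B.proper_order_unit_space_axioms .

lemma norm_direct_sum_le:
  assumes "a \<in> A.V" "b \<in> B.V" "A.N a \<le> c" "B.N b \<le> c" shows "S.N (a, b) \<le> c"
  using assms S.norm_le_iff[of "(a, b)" c] A.norm_le_iff B.norm_le_iff by auto

text \<open>Given a pair in the unit ball, subtract the multiple \<open>\<mu> a\<close> of the unit. The first component then has
norm at most the diameter of \<open>S(A)\<close>, and by the assumption on \<open>\<beta>\<close> the second one is bounded too, so both
components range over totally bounded sets.\<close>

lemma is_Lip_norm_sup_seminorm:
  assumes sn: "is_seminorm (direct_sum A B) (sup_seminorm LA LB \<beta>)"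
    and ker: "\<forall>p\<in>carr (direct_sum A B). sup_seminorm LA LB \<beta> p = 0 \<longleftrightarrow>
        (\<exists>r. p = r *\<^sub>R ounit (direct_sum A B))"
    and \<mu>: "\<mu> \<in> states A" and \<nu>: "\<nu> \<in> states B"
    and D: "\<And>a b. a \<in> A.V \<Longrightarrow> b \<in> B.V \<Longrightarrow> \<beta> (a, b) \<le> 1 \<Longrightarrow> \<bar>\<mu> a - \<nu> b\<bar> \<le> D"
  shows "is_Lip_norm (direct_sum A B) (sup_seminorm LA LB \<beta>)"
proof -
  interpret L: seminormed_order_unit_space "direct_sum A B" "sup_seminorm LA LB \<beta>"
    using sn ker by unfold_locales auto
  show ?thesis
  proof (rule L.is_Lip_norm_if_totally_bounded)
    fix \<eta> :: real assume \<eta>: "\<eta> > 0"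
    define RA where "RA = 2 * radius A LA"
    define RB where "RB = 2 * radius B LB + D"
    obtain GA where GA: "finite GA" "GA \<subseteq> A.V"
      "\<And>a. a \<in> A.V \<Longrightarrow> LA a \<le> 1 \<Longrightarrow> A.N a \<le> RA \<Longrightarrow> \<exists>g\<in>GA. A.N (a - g) < \<eta>"
      using A.totally_bounded_Lip_set[OF \<eta>, of RA] by blast
    obtain GB where GB: "finite GB" "GB \<subseteq> B.V"
      "\<And>b. b \<in> B.V \<Longrightarrow> LB b \<le> 1 \<Longrightarrow> B.N b \<le> RB \<Longrightarrow> \<exists>g\<in>GB. B.N (b - g) < \<eta>"
      using B.totally_bounded_Lip_set[OF \<eta>, of RB] by blast
    have "\<exists>g\<in>GA \<times> GB. \<exists>c. S.N ((a, b) - g - c *\<^sub>R S.e) \<le> \<eta>"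
      if ab: "a \<in> A.V" "b \<in> B.V" and L: "sup_seminorm LA LB \<beta> (a, b) \<le> 1" for a b
    proof -
      define c where "c = \<mu> a"
      have L1: "LA a \<le> 1" "LB b \<le> 1" "\<beta> (a, b) \<le> 1" using L by (auto simp: sup_seminorm_def)
      have "A.N (a - c *\<^sub>R A.e) \<le> RA"
      proof (rule A.norm_le_if_states_le)
        fix \<sigma> assume \<sigma>: "\<sigma> \<in> states A"
        then have "\<bar>\<sigma> a - \<mu> a\<bar> \<le> RA"
          using A.radius_le_iff[of RA] \<mu> ab L1 unfolding RA_def by blast
        then show "\<bar>\<sigma> (a - c *\<^sub>R A.e)\<bar> \<le> RA"
          using \<sigma> ab by (simp add: A.state_diff A.state_unit c_def)
      qed (use ab in auto)
      then obtain gA where gA: "gA \<in> GA" "A.N (a - c *\<^sub>R A.e - gA) < \<eta>"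
        using GA(3)[of "a - c *\<^sub>R A.e"] ab L1 by auto
      have "B.N (b - c *\<^sub>R B.e) \<le> RB"
      proof (rule B.norm_le_if_states_le)
        fix \<sigma> assume \<sigma>: "\<sigma> \<in> states B"
        then have "\<bar>\<sigma> b - \<nu> b\<bar> \<le> 2 * radius B LB"
          using B.radius_le_iff[of "2 * radius B LB"] \<nu> ab L1 by blast
        then show "\<bar>\<sigma> (b - c *\<^sub>R B.e)\<bar> \<le> RB"
          using D[OF ab L1(3)] \<sigma> ab by (simp add: B.state_diff B.state_unit c_def RB_def)
      qed (use ab in auto)
      then obtain gB where gB: "gB \<in> GB" "B.N (b - c *\<^sub>R B.e - gB) < \<eta>"
        using GB(3)[of "b - c *\<^sub>R B.e"] ab L1 by auto
      have g: "gA \<in> A.V" "gB \<in> B.V" using gA gB GA GB by auto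
      have "S.N (a - c *\<^sub>R A.e - gA, b - c *\<^sub>R B.e - gB) \<le> \<eta>"
        using gA gB g ab by (intro norm_direct_sum_le) auto
      moreover have "(a - c *\<^sub>R A.e - gA, b - c *\<^sub>R B.e - gB) = (a, b) - (gA, gB) - c *\<^sub>R S.e"
        by (simp add: algebra_simps)
      ultimately show ?thesis using gA gB by (intro bexI[of _ "(gA, gB)"] exI[of _ c]) auto
    qed
    moreover have "finite (GA \<times> GB)" "GA \<times> GB \<subseteq> S.V" using GA GB by auto
    ultimately show "\<exists>G. finite G \<and> G \<subseteq> S.V \<and> (\<forall>a\<in>S.V. sup_seminorm LA LB \<beta> a \<le> 1 \<longrightarrow>
        (\<exists>g\<in>G. \<exists>c. S.N (a - g - c *\<^sub>R S.e) \<le> \<eta>))"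
      by (intro exI[of _ "GA \<times> GB"]) auto
  qed
qed

text \<open>The seminorm \<open>\<beta>\<close> measures the disagreement of \<open>a\<close> and \<open>b\<close> along \<open>R\<close> in units of \<open>\<epsilon>\<close>. States that
correspond to each other then have distance at most \<open>\<epsilon>\<close> for \<open>sup_seminorm LA LB \<beta>\<close>, and the lifting
conditions make this seminorm admissible.\<close>

lemma dist_q_le_if_correspondence:
  assumes R: "R \<subseteq> states A \<times> states B" and \<epsilon>: "\<epsilon> > 0"
    and totalA: "\<And>\<mu>. \<mu> \<in> states A \<Longrightarrow> \<exists>\<nu>. (\<mu>, \<nu>) \<in> R"
    and totalB: "\<And>\<nu>. \<nu> \<in> states B \<Longrightarrow> \<exists>\<mu>. (\<mu>, \<nu>) \<in> R"
    and liftA: "\<And>a. a \<in> A.V \<Longrightarrow> LA a \<le> 1 \<Longrightarrow>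
        \<exists>b\<in>B.V. LB b \<le> 1 \<and> (\<forall>(\<mu>, \<nu>)\<in>R. \<bar>\<mu> a - \<nu> b\<bar> \<le> \<epsilon>)"
    and liftB: "\<And>b. b \<in> B.V \<Longrightarrow> LB b \<le> 1 \<Longrightarrow>
        \<exists>a\<in>A.V. LA a \<le> 1 \<and> (\<forall>(\<mu>, \<nu>)\<in>R. \<bar>\<mu> a - \<nu> b\<bar> \<le> \<epsilon>)"
  shows "dist_q (A, LA) (B, LB) \<le> ereal \<epsilon>"
proof -
  define \<beta> where "\<beta> p = (SUP (\<mu>, \<nu>)\<in>R. \<bar>\<mu> (fst p) - \<nu> (snd p)\<bar>) / \<epsilon>" for p
  have ne: "R \<noteq> {}" using A.states_nonempty totalA by blast
  have st: "\<mu> \<in> states A" "\<nu> \<in> states B" if "(\<mu>, \<nu>) \<in> R" for \<mu> \<nu> using R that by auto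
  have bdd: "bdd_above ((\<lambda>(\<mu>, \<nu>). \<bar>\<mu> (fst p) - \<nu> (snd p)\<bar>) ` R)" if p: "p \<in> S.V" for p
    unfolding bdd_above_def
  proof (intro exI[of _ "A.N (fst p) + B.N (snd p)"] ballI, clarsimp)
    fix \<mu> \<nu> assume "(\<mu>, \<nu>) \<in> R"
    then show "\<bar>\<mu> (fst p) - \<nu> (snd p)\<bar> \<le> A.N (fst p) + B.N (snd p)"
      using A.state_le_norm[of \<mu> "fst p"] B.state_le_norm[of \<nu> "snd p"] st p by fastforce
  qed
  have \<beta>_ge: "\<bar>\<mu> a - \<nu> b\<bar> \<le> \<epsilon> * \<beta> (a, b)" if "a \<in> A.V" "b \<in> B.V" "(\<mu>, \<nu>) \<in> R" for a b \<mu> \<nu>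
    using cSUP_upper[OF that(3) bdd[of "(a, b)"]] that \<epsilon> by (simp add: \<beta>_def)
  have \<beta>_le: "\<beta> p \<le> c" if "\<And>\<mu> \<nu>. (\<mu>, \<nu>) \<in> R \<Longrightarrow> \<bar>\<mu> (fst p) - \<nu> (snd p)\<bar> \<le> \<epsilon> * c" for p c
  proof -
    have "(SUP (\<mu>, \<nu>)\<in>R. \<bar>\<mu> (fst p) - \<nu> (snd p)\<bar>) \<le> \<epsilon> * c"
      using that by (intro cSUP_least[OF ne]) auto
    then show ?thesis using \<epsilon> by (simp add: \<beta>_def field_simps)
  qed
  have \<beta>0: "0 \<le> \<beta> p" if p: "p \<in> S.V" for p
  proof -
    obtain \<mu> \<nu> where "(\<mu>, \<nu>) \<in> R" using ne by auto
    then have "0 \<le> \<epsilon> * \<beta> p" using \<beta>_ge[of "fst p" "snd p" \<mu> \<nu>] p by force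
    then show ?thesis using \<epsilon> by (simp add: zero_le_mult_iff)
  qed
  have \<beta>mul: "\<beta> (r *\<^sub>R p) \<le> \<bar>r\<bar> * \<beta> p" if p: "p \<in> S.V" for r p
  proof (rule \<beta>_le)
    fix \<mu> \<nu> assume R: "(\<mu>, \<nu>) \<in> R"
    have "\<bar>r\<bar> * \<bar>\<mu> (fst p) - \<nu> (snd p)\<bar> \<le> \<bar>r\<bar> * (\<epsilon> * \<beta> p)"
      using \<beta>_ge[of "fst p" "snd p" \<mu> \<nu>] p R by (intro mult_left_mono) auto
    moreover have "\<bar>r\<bar> * \<bar>\<mu> (fst p) - \<nu> (snd p)\<bar> = \<bar>\<mu> (fst (r *\<^sub>R p)) - \<nu> (snd (r *\<^sub>R p))\<bar>"
      using st[OF R] p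
      by (auto simp: A.state_scaleR B.state_scaleR abs_mult[symmetric] right_diff_distrib)
    ultimately show "\<bar>\<mu> (fst (r *\<^sub>R p)) - \<nu> (snd (r *\<^sub>R p))\<bar> \<le> \<epsilon> * (\<bar>r\<bar> * \<beta> p)"
      by (simp add: algebra_simps)
  qed
  have "is_seminorm (direct_sum A B) \<beta>"
    unfolding is_seminorm_def
  proof (intro conjI ballI allI)
    show "0 \<le> \<beta> p" if "p \<in> S.V" for p using \<beta>0 that .
    show "\<beta> (p + q) \<le> \<beta> p + \<beta> q" if pq: "p \<in> S.V" "q \<in> S.V" for p q
    proof (rule \<beta>_le)
      fix \<mu> \<nu> assume R: "(\<mu>, \<nu>) \<in> R"
      have "\<mu> (fst (p + q)) - \<nu> (snd (p + q)) = (\<mu> (fst p) - \<nu> (snd p)) + (\<mu> (fst q) - \<nu> (snd q))"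
        using st[OF R] pq by (auto simp: A.state_add B.state_add)
      then show "\<bar>\<mu> (fst (p + q)) - \<nu> (snd (p + q))\<bar> \<le> \<epsilon> * (\<beta> p + \<beta> q)"
        using \<beta>_ge[of "fst p" "snd p" \<mu> \<nu>] \<beta>_ge[of "fst q" "snd q" \<mu> \<nu>] pq R
        by (auto simp: distrib_left)
    qed
    show "\<beta> (r *\<^sub>R p) = \<bar>r\<bar> * \<beta> p" if p: "p \<in> S.V" for p r
    proof (cases "r = 0")
      case True
      then show ?thesis using \<beta>mul[OF p, of 0] \<beta>0[of 0] S.V_closed(1) by simp
    next
      case False
      then have "\<bar>r\<bar> * \<beta> ((1 / r) *\<^sub>R (r *\<^sub>R p)) \<le> \<bar>r\<bar> * (\<bar>1 / r\<bar> * \<beta> (r *\<^sub>R p))"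
        using p by (intro mult_left_mono \<beta>mul S.V_closed) auto
      then show ?thesis using \<beta>mul[OF p, of r] False by simp
    qed
  qed
  moreover have \<beta>_unit: "\<beta> (r *\<^sub>R A.e, s *\<^sub>R B.e) = 0 \<longleftrightarrow> r = s" for r s
  proof
    obtain \<mu> \<nu> where R: "(\<mu>, \<nu>) \<in> R" using ne by auto
    assume "\<beta> (r *\<^sub>R A.e, s *\<^sub>R B.e) = 0"
    then show "r = s" using \<beta>_ge[OF _ _ R, of "r *\<^sub>R A.e" "s *\<^sub>R B.e"] st[OF R]
      by (simp add: A.state_unit B.state_unit)
  next
    assume "r = s"
    then have "\<beta> (r *\<^sub>R A.e, s *\<^sub>R B.e) \<le> 0"
      using st by (intro \<beta>_le) (simp add: A.state_unit B.state_unit)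
    then show "\<beta> (r *\<^sub>R A.e, s *\<^sub>R B.e) = 0" using \<beta>0[of "(r *\<^sub>R A.e, s *\<^sub>R B.e)"] by simp
  qed
  moreover have "\<exists>b\<in>B.V. LB b \<le> LA a \<and> \<beta> (a, b) \<le> LA a" if a: "a \<in> A.V" for a
  proof (rule lift_by_scaling[OF A.seminormed_order_unit_space_axioms B.seminormed_order_unit_space_axioms _ _ _ a])
    show "\<exists>b\<in>B.V. LB b \<le> 1 \<and> \<beta> (a, b) \<le> 1" if a: "a \<in> A.V" "LA a \<le> 1" for a
    proof -
      obtain b where "b \<in> B.V" "LB b \<le> 1" "\<forall>(\<mu>, \<nu>)\<in>R. \<bar>\<mu> a - \<nu> b\<bar> \<le> \<epsilon>" using liftA[OF a] by blast
      then show ?thesis by (intro bexI[of _ b] conjI \<beta>_le) auto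
    qed
    show "\<beta> (r *\<^sub>R a, r *\<^sub>R b) \<le> \<bar>r\<bar> * \<beta> (a, b)" if "a \<in> A.V" "b \<in> B.V" for r a b
      using \<beta>mul[of "(a, b)" r] that by simp
    show "\<beta> (r *\<^sub>R A.e, r *\<^sub>R B.e) \<le> 0" for r using \<beta>_unit[of r r] by simp
  qed
  moreover have "\<exists>a\<in>A.V. LA a \<le> LB b \<and> \<beta> (a, b) \<le> LB b" if b: "b \<in> B.V" for b
  proof (rule lift_by_scaling[OF B.seminormed_order_unit_space_axioms A.seminormed_order_unit_space_axioms _ _ _ b, of "\<lambda>b a. \<beta> (a, b)"])
    show "\<exists>a\<in>A.V. LA a \<le> 1 \<and> \<beta> (a, b) \<le> 1" if b: "b \<in> B.V" "LB b \<le> 1" for b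
    proof -
      obtain a where "a \<in> A.V" "LA a \<le> 1" "\<forall>(\<mu>, \<nu>)\<in>R. \<bar>\<mu> a - \<nu> b\<bar> \<le> \<epsilon>" using liftB[OF b] by blast
      then show ?thesis by (intro bexI[of _ a] conjI \<beta>_le) auto
    qed
    show "\<beta> (r *\<^sub>R a, r *\<^sub>R b) \<le> \<bar>r\<bar> * \<beta> (a, b)" if "b \<in> B.V" "a \<in> A.V" for r a b
      using \<beta>mul[of "(a, b)" r] that by simp
    show "\<beta> (r *\<^sub>R A.e, r *\<^sub>R B.e) \<le> 0" for r using \<beta>_unit[of r r] by simp
  qed
  ultimately have hyps: "ounit A \<in> carr A" "ounit B \<in> carr B" "is_seminorm A LA"
    "\<forall>a\<in>carr A. LA a = 0 \<longleftrightarrow> (\<exists>r. a = r *\<^sub>R ounit A)" "is_seminorm B LB"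
    "\<forall>b\<in>carr B. LB b = 0 \<longleftrightarrow> (\<exists>r. b = r *\<^sub>R ounit B)" "is_seminorm (direct_sum A B) \<beta>"
    "\<And>r s. \<beta> (r *\<^sub>R ounit A, s *\<^sub>R ounit B) = 0 \<longleftrightarrow> r = s"
    "\<And>a. a \<in> carr A \<Longrightarrow> \<exists>b\<in>carr B. LB b \<le> LA a \<and> \<beta> (a, b) \<le> LA a"
    "\<And>b. b \<in> carr B \<Longrightarrow> \<exists>a\<in>carr A. LA a \<le> LB b \<and> \<beta> (a, b) \<le> LB b"
    using A.L_zero_iff B.L_zero_iff A.seminorm B.seminorm by auto
  obtain \<mu>0 \<nu>0 where R0: "(\<mu>0, \<nu>0) \<in> R" using ne by auto
  have "\<bar>\<mu>0 a - \<nu>0 b\<bar> \<le> \<epsilon>" if "a \<in> A.V" "b \<in> B.V" "\<beta> (a, b) \<le> 1" for a b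
  proof -
    have "\<epsilon> * \<beta> (a, b) \<le> \<epsilon> * 1" using that \<epsilon> by (intro mult_left_mono) auto
    then show ?thesis using \<beta>_ge[OF that(1,2) R0] by simp
  qed
  then have "is_Lip_norm (direct_sum A B) (sup_seminorm LA LB \<beta>)"
    using is_Lip_norm_sup_seminorm[OF sup_seminorm(1,2)[OF hyps] st[OF R0]] by blast
  then have adm: "admissible A LA B LB (sup_seminorm LA LB \<beta>)"
    using sup_seminorm(3)[OF hyps] by blast
  let ?l = "\<lambda>\<mu>. restrict (\<lambda>p. \<mu> (fst p)) (A.V \<times> B.V)"
  let ?r = "\<lambda>\<nu>. restrict (\<lambda>p. \<nu> (snd p)) (A.V \<times> B.V)"
  let ?\<rho> = "rho (direct_sum A B) (sup_seminorm LA LB \<beta>)"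
  have close: "?\<rho> (?l \<mu>) (?r \<nu>) \<le> ereal \<epsilon>" if "(\<mu>, \<nu>) \<in> R" for \<mu> \<nu>
    unfolding S.rho_le_iff
  proof (intro ballI impI, clarsimp)
    fix a b assume ab: "a \<in> A.V" "b \<in> B.V" and L: "sup_seminorm LA LB \<beta> (a, b) \<le> 1"
    have "\<epsilon> * \<beta> (a, b) \<le> \<epsilon> * 1" using L \<epsilon> by (intro mult_left_mono) (auto simp: sup_seminorm_def)
    then show "\<bar>\<mu> a - \<nu> b\<bar> \<le> \<epsilon>" using \<beta>_ge[OF ab that] by simp
  qed
  have "hausdorff_dist ?\<rho> (states_left A B) (states_right A B) \<le> ereal \<epsilon>"
  proof (rule hausdorff_dist_leI)
    fix x assume "x \<in> states_left A B"
    then obtain \<mu> where \<mu>: "\<mu> \<in> states A" "x = ?l \<mu>" unfolding states_left_def by (rule imageE)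
    then obtain \<nu> where \<nu>: "(\<mu>, \<nu>) \<in> R" using totalA by blast
    have "?r \<nu> \<in> states_right A B" unfolding states_right_def using st(2)[OF \<nu>] by (rule imageI)
    then show "\<exists>y\<in>states_right A B. ?\<rho> x y \<le> ereal \<epsilon>" using close[OF \<nu>] \<mu>(2) by blast
  next
    fix y assume "y \<in> states_right A B"
    then obtain \<nu> where \<nu>: "\<nu> \<in> states B" "y = ?r \<nu>" unfolding states_right_def by (rule imageE)
    then obtain \<mu> where \<mu>: "(\<mu>, \<nu>) \<in> R" using totalB by blast
    have "?l \<mu> \<in> states_left A B" unfolding states_left_def using st(1)[OF \<mu>] by (rule imageI)
    then show "\<exists>x\<in>states_left A B. ?\<rho> x y \<le> ereal \<epsilon>" using close[OF \<mu>] \<nu>(2) by blast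
  qed
  then show ?thesis unfolding dist_q_def prod.case using adm by (intro INF_lower2) auto
qed

text \<open>A multiple of the unit moves \<open>a\<close> into the Lipschitz ball; there it is replaced by a nearby net element
\<open>x i\<close> and then by \<open>y i\<close>. This costs one \<open>\<epsilon>\<close> for the net and one for the correspondence.\<close>

lemma lift_along_nets:
  fixes x :: "nat \<Rightarrow> 'a" and y :: "nat \<Rightarrow> 'b"
  assumes x: "\<And>i. i < n \<Longrightarrow> x i \<in> A.V" and y: "\<And>i. i < n \<Longrightarrow> y i \<in> B.V \<and> LB (y i) \<le> 1"
    and net: "\<And>a. a \<in> Lip_ball A LA \<Longrightarrow> \<exists>i<n. A.N (x i - a) \<le> \<epsilon>"
    and a: "a \<in> A.V" "LA a \<le> 1"
  shows "\<exists>b\<in>B.V. LB b \<le> 1 \<and> (\<forall>\<mu>\<in>states A. \<forall>\<nu>\<in>states B.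
    (\<forall>i<n. \<bar>\<mu> (x i) - \<nu> (y i)\<bar> \<le> \<epsilon>) \<longrightarrow> \<bar>\<mu> a - \<nu> b\<bar> \<le> 2 * \<epsilon>)"
proof -
  obtain c where "A.N (a - c *\<^sub>R A.e) \<le> radius A LA" using A.ex_centre[OF a] by blast
  then obtain i where i: "i < n" "A.N (x i - (a - c *\<^sub>R A.e)) \<le> \<epsilon>"
    using net[of "a - c *\<^sub>R A.e"] a by (auto simp: Lip_ball_def)
  have "\<bar>\<mu> a - \<nu> (y i + c *\<^sub>R B.e)\<bar> \<le> 2 * \<epsilon>"
    if st: "\<mu> \<in> states A" "\<nu> \<in> states B" and "\<forall>i<n. \<bar>\<mu> (x i) - \<nu> (y i)\<bar> \<le> \<epsilon>" for \<mu> \<nu>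
  proof -
    have "\<bar>\<mu> (x i) - \<nu> (y i)\<bar> \<le> \<epsilon>" using that i(1) by blast
    moreover have "\<bar>\<mu> (x i - (a - c *\<^sub>R A.e))\<bar> \<le> \<epsilon>"
      using A.state_le_norm[OF st(1), of "x i - (a - c *\<^sub>R A.e)"] i a x by fastforce
    ultimately show ?thesis
      using st a x[OF i(1)] y[OF i(1)]
      by (simp add: A.state_diff A.state_unit B.state_add B.state_unit)
  qed
  then show ?thesis using y[OF i(1)] by (intro bexI[of _ "y i + c *\<^sub>R B.e"]) auto
qed

lemma dist_q_le_if_matching_nets:
  fixes x :: "nat \<Rightarrow> 'a" and y :: "nat \<Rightarrow> 'b"
  assumes \<epsilon>: "\<epsilon> > 0"
    and x: "\<And>i. i < n \<Longrightarrow> x i \<in> A.V \<and> LA (x i) \<le> 1"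
    and y: "\<And>i. i < n \<Longrightarrow> y i \<in> B.V \<and> LB (y i) \<le> 1"
    and netA: "\<And>a. a \<in> Lip_ball A LA \<Longrightarrow> \<exists>i<n. A.N (x i - a) \<le> \<epsilon>"
    and netB: "\<And>b. b \<in> Lip_ball B LB \<Longrightarrow> \<exists>i<n. B.N (y i - b) \<le> \<epsilon>"
    and totalA: "\<And>\<mu>. \<mu> \<in> states A \<Longrightarrow> \<exists>\<nu>\<in>states B. \<forall>i<n. \<bar>\<mu> (x i) - \<nu> (y i)\<bar> \<le> \<epsilon>"
    and totalB: "\<And>\<nu>. \<nu> \<in> states B \<Longrightarrow> \<exists>\<mu>\<in>states A. \<forall>i<n. \<bar>\<mu> (x i) - \<nu> (y i)\<bar> \<le> \<epsilon>"
  shows "dist_q (A, LA) (B, LB) \<le> ereal (2 * \<epsilon>)"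
proof -
  define R where "R = {(\<mu>, \<nu>) \<in> states A \<times> states B. \<forall>i<n. \<bar>\<mu> (x i) - \<nu> (y i)\<bar> \<le> \<epsilon>}"
  show ?thesis
  proof (rule dist_q_le_if_correspondence[of R])
    show "R \<subseteq> states A \<times> states B" by (auto simp: R_def)
    show "0 < 2 * \<epsilon>" using \<epsilon> by simp
    show "\<exists>\<nu>. (\<mu>, \<nu>) \<in> R" if "\<mu> \<in> states A" for \<mu> using totalA[OF that] that by (auto simp: R_def)
    show "\<exists>\<mu>. (\<mu>, \<nu>) \<in> R" if "\<nu> \<in> states B" for \<nu> using totalB[OF that] that by (auto simp: R_def)
    show "\<exists>b\<in>B.V. LB b \<le> 1 \<and> (\<forall>(\<mu>, \<nu>)\<in>R. \<bar>\<mu> a - \<nu> b\<bar> \<le> 2 * \<epsilon>)" if a: "a \<in> A.V" "LA a \<le> 1" for a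
      using lift_along_nets[of n x y \<epsilon> a] x y netA a unfolding R_def by fast
    interpret converse: proper_qms_pair B LB A LA ..
    show "\<exists>a\<in>A.V. LA a \<le> 1 \<and> (\<forall>(\<mu>, \<nu>)\<in>R. \<bar>\<mu> a - \<nu> b\<bar> \<le> 2 * \<epsilon>)" if b: "b \<in> B.V" "LB b \<le> 1" for b
      using converse.lift_along_nets[of n y x \<epsilon> b] x y netB b
      unfolding R_def abs_minus_commute[of "_ (y _)"] abs_minus_commute[of "_ b"] by fast
  qed
qed

end

section \<open>The norm completion\<close>

context proper_order_unit_space
begin

lemma cauchy_V: "x \<in> cauchy_seqs A \<Longrightarrow> x n \<in> V"
  by (simp add: cauchy_seqs_def)

lemma cauchyD:
  "x \<in> cauchy_seqs A \<Longrightarrow> \<epsilon> > 0 \<Longrightarrow> \<exists>M. \<forall>m\<ge>M. \<forall>n\<ge>M. N (x m - x n) < \<epsilon>"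
  by (simp add: cauchy_seqs_def)

lemma cauchy_const [simp]: "a \<in> V \<Longrightarrow> (\<lambda>_. a) \<in> cauchy_seqs A"
  by (simp add: cauchy_seqs_def)

lemma cauchy_add:
  assumes x: "x \<in> cauchy_seqs A" and y: "y \<in> cauchy_seqs A"
  shows "(\<lambda>n. x n + y n) \<in> cauchy_seqs A"
  unfolding cauchy_seqs_def
proof (intro CollectI conjI allI impI)
  show "x n + y n \<in> V" for n using cauchy_V[OF x] cauchy_V[OF y] by auto
  fix \<epsilon> :: real assume "\<epsilon> > 0"
  then obtain M K where M: "\<forall>m\<ge>M. \<forall>n\<ge>M. N (x m - x n) < \<epsilon> / 2"
    and K: "\<forall>m\<ge>K. \<forall>n\<ge>K. N (y m - y n) < \<epsilon> / 2"
    using cauchyD[OF x, of "\<epsilon> / 2"] cauchyD[OF y, of "\<epsilon> / 2"] by auto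
  show "\<exists>M. \<forall>m\<ge>M. \<forall>n\<ge>M. N (x m + y m - (x n + y n)) < \<epsilon>"
  proof (intro exI[of _ "max M K"] allI impI)
    fix m n assume mn: "max M K \<le> m" "max M K \<le> n"
    have "N ((x m - x n) + (y m - y n)) \<le> N (x m - x n) + N (y m - y n)"
      using cauchy_V[OF x] cauchy_V[OF y] by (intro norm_add) auto
    moreover have "N (x m - x n) < \<epsilon> / 2" "N (y m - y n) < \<epsilon> / 2" using M K mn by auto
    ultimately have "N ((x m - x n) + (y m - y n)) < \<epsilon>" by linarith
    then show "N (x m + y m - (x n + y n)) < \<epsilon>" by (simp add: algebra_simps)
  qed
qed

lemma null_rel_iff:
  "(x, y) \<in> null_rel A \<longleftrightarrow>
     x \<in> cauchy_seqs A \<and> y \<in> cauchy_seqs A \<and> (\<lambda>n. N (x n - y n)) \<longlonglongrightarrow> 0"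
  by (simp add: null_rel_def)

lemma null_relI:
  assumes x: "x \<in> cauchy_seqs A" and y: "\<And>n. y n \<in> V" and lim: "(\<lambda>n. N (x n - y n)) \<longlonglongrightarrow> 0"
  shows "(x, y) \<in> null_rel A"
proof -
  note V = cauchy_V[OF x] y
  have "y \<in> cauchy_seqs A"
    unfolding cauchy_seqs_def
  proof (intro CollectI conjI allI impI y)
    fix \<epsilon> :: real assume \<epsilon>: "\<epsilon> > 0"
    obtain M where M: "\<forall>m\<ge>M. \<forall>n\<ge>M. N (x m - x n) < \<epsilon> / 3" using cauchyD[OF x, of "\<epsilon> / 3"] \<epsilon> by auto
    obtain K where K: "\<forall>n\<ge>K. N (x n - y n) < \<epsilon> / 3"
      using order_tendstoD(2)[OF lim, of "\<epsilon> / 3"] \<epsilon> by (auto simp: eventually_sequentially)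
    have "N (y m - y n) < \<epsilon>" if mn: "m \<ge> max M K" "n \<ge> max M K" for m n
    proof -
      have "N (y m - y n) \<le> N (y m - x m) + N (x m - y n)" "N (x m - y n) \<le> N (x m - x n) + N (x n - y n)"
        using V by (auto intro: norm_triangle)
      moreover have "N (y m - x m) = N (x m - y m)" using V by (intro norm_minus_commute)
      moreover have "N (x m - x n) < \<epsilon> / 3" "N (x m - y m) < \<epsilon> / 3" "N (x n - y n) < \<epsilon> / 3" using M K mn by auto
      ultimately show ?thesis by linarith
    qed
    then show "\<exists>M. \<forall>m\<ge>M. \<forall>n\<ge>M. N (y m - y n) < \<epsilon>" by blast
  qed
  then show ?thesis using x lim by (simp add: null_rel_iff)
qed

lemma equiv_null_rel: "equiv (cauchy_seqs A) (null_rel A)"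
proof (rule equivI)
  show "null_rel A \<subseteq> cauchy_seqs A \<times> cauchy_seqs A" by (auto simp: null_rel_iff)
  show "refl_on (cauchy_seqs A) (null_rel A)" by (auto simp: refl_on_def null_rel_iff)
  show "sym (null_rel A)"
    unfolding sym_def
  proof (intro allI impI)
    fix x y assume xy: "(x, y) \<in> null_rel A"
    then have "(\<lambda>n. N (y n - x n)) = (\<lambda>n. N (x n - y n))"
      by (auto simp: null_rel_iff intro!: norm_minus_commute dest: cauchy_V)
    then show "(y, x) \<in> null_rel A" using xy by (simp add: null_rel_iff)
  qed
  show "trans (null_rel A)"
  proof (rule transI)
    fix x y z assume xyz: "(x, y) \<in> null_rel A" "(y, z) \<in> null_rel A"
    then have V: "x n \<in> V" "y n \<in> V" "z n \<in> V" for n by (auto simp: null_rel_iff dest: cauchy_V)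
    have "(\<lambda>n. N (x n - y n) + N (y n - z n)) \<longlonglongrightarrow> 0 + 0"
      using xyz by (intro tendsto_add) (auto simp: null_rel_iff)
    then have "(\<lambda>n. N (x n - z n)) \<longlonglongrightarrow> 0"
      using V norm_triangle norm_nonneg
      by (intro tendsto_sandwich[of "\<lambda>_. 0" "\<lambda>n. N (x n - z n)" _ "\<lambda>n. N (x n - y n) + N (y n - z n)"]) auto
    then show "(x, z) \<in> null_rel A" using xyz by (simp add: null_rel_iff)
  qed
qed

lemma class_in_completion: "x \<in> cauchy_seqs A \<Longrightarrow> null_rel A `` {x} \<in> completion A"
  by (simp add: completion_def quotientI)

lemma mem_class: "x \<in> cauchy_seqs A \<Longrightarrow> x \<in> null_rel A `` {x}"
  using equiv_null_rel by (rule equiv_class_self)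

lemma completion_mem:
  assumes "X \<in> completion A" "x \<in> X" shows "x \<in> cauchy_seqs A" and "X = null_rel A `` {x}"
proof -
  obtain z where z: "z \<in> cauchy_seqs A" "X = null_rel A `` {z}"
    using assms(1) by (auto simp: completion_def quotient_def)
  then have "(z, x) \<in> null_rel A" using assms(2) by simp
  then show "x \<in> cauchy_seqs A" "X = null_rel A `` {x}"
    using equiv_class_eq[OF equiv_null_rel, of z x] z by (auto simp: null_rel_iff)
qed

lemma completion_mem_tendsto:
  "X \<in> completion A \<Longrightarrow> x \<in> X \<Longrightarrow> x' \<in> X \<Longrightarrow> (\<lambda>n. N (x n - x' n)) \<longlonglongrightarrow> 0"
  using completion_mem(2)[of X x] by (auto simp: null_rel_iff)

lemma compl_add_eq:
  assumes X: "X \<in> completion A" "x \<in> X" and Y: "Y \<in> completion A" "y \<in> Y"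
  shows "compl_add A X Y = null_rel A `` {\<lambda>n. x n + y n}"
proof -
  have "null_rel A `` {\<lambda>n. x' n + y' n} = null_rel A `` {\<lambda>n. x n + y n}" if x': "x' \<in> X" and y': "y' \<in> Y" for x' y'
  proof (rule equiv_class_eq[OF equiv_null_rel])
    note c = completion_mem(1)[OF X] completion_mem(1)[OF Y]
      completion_mem(1)[OF X(1) x'] completion_mem(1)[OF Y(1) y']
    note V = c[THEN cauchy_V]
    have "(\<lambda>n. N (x' n - x n) + N (y' n - y n)) \<longlonglongrightarrow> 0 + 0"
      using completion_mem_tendsto X Y x' y' by (intro tendsto_add) auto
    moreover have "N (x' n + y' n - (x n + y n)) \<le> N (x' n - x n) + N (y' n - y n)" for n
      using norm_add[of "x' n - x n" "y' n - y n"] V by (simp add: algebra_simps)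
    ultimately have "(\<lambda>n. N (x' n + y' n - (x n + y n))) \<longlonglongrightarrow> 0"
      using V norm_nonneg
      by (intro tendsto_sandwich[of "\<lambda>_. 0" "\<lambda>n. N (x' n + y' n - (x n + y n))" _
            "\<lambda>n. N (x' n - x n) + N (y' n - y n)"]) auto
    then show "(\<lambda>n. x' n + y' n, \<lambda>n. x n + y n) \<in> null_rel A"
      using c by (simp add: null_rel_iff cauchy_add)
  qed
  then have "compl_add A X Y = (\<Union>x'\<in>X. \<Union>y'\<in>Y. null_rel A `` {\<lambda>n. x n + y n})"
    unfolding compl_add_def by (intro SUP_cong refl)
  moreover have "X \<noteq> {}" "Y \<noteq> {}" using X Y by blast+
  ultimately show ?thesis by simp
qed

definition unit_class :: "real \<Rightarrow> (nat \<Rightarrow> 'a) set" where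
  "unit_class r = compl_scale A r (compl_unit A)"

text \<open>An isometry preserves the order, addition and the unit, but the norm of the completion is not part of
its definition. Translation by multiples of the unit expresses distances through the order: \<open>X\<close> and
\<open>Y\<close> are within distance \<open>r\<close> if and only if \<open>X \<le> shift Y r\<close> and \<open>Y \<le> shift X r\<close>.\<close>

definition shift :: "(nat \<Rightarrow> 'a) set \<Rightarrow> real \<Rightarrow> (nat \<Rightarrow> 'a) set" where
  "shift X r = compl_add A X (unit_class r)"

lemma unit_class_eq: "unit_class r = null_rel A `` {\<lambda>_. r *\<^sub>R e}"
proof -
  have u: "compl_unit A \<in> completion A" "(\<lambda>_. e) \<in> compl_unit A"
    unfolding compl_unit_def by (intro class_in_completion mem_class cauchy_const V_closed)+
  have "null_rel A `` {\<lambda>n. r *\<^sub>R x n} = null_rel A `` {\<lambda>_. r *\<^sub>R e}" if x: "x \<in> compl_unit A" for x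
  proof (rule equiv_class_eq[OF equiv_null_rel, symmetric], rule null_relI)
    have V: "x n \<in> V" for n using completion_mem(1)[OF u(1) x] cauchy_V by simp
    then show "r *\<^sub>R x n \<in> V" for n by auto
    have "(\<lambda>n. \<bar>r\<bar> * N (e - x n)) \<longlonglongrightarrow> 0"
      by (rule tendsto_mult_right_zero, rule completion_mem_tendsto[OF u x])
    then show "(\<lambda>n. N (r *\<^sub>R e - r *\<^sub>R x n)) \<longlonglongrightarrow> 0"
      using norm_scaleR[of "e - x _" r] V by (simp add: scaleR_right_diff_distrib)
  qed simp
  then have "unit_class r = (\<Union>x\<in>compl_unit A. null_rel A `` {\<lambda>_. r *\<^sub>R e})"
    unfolding unit_class_def compl_scale_def by (intro SUP_cong refl)
  moreover have "compl_unit A \<noteq> {}" using u by blast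
  ultimately show ?thesis by simp
qed

lemma unit_class: "unit_class r \<in> completion A" "(\<lambda>_. r *\<^sub>R e) \<in> unit_class r"
  unfolding unit_class_eq by (intro class_in_completion mem_class cauchy_const V_closed)+

lemma shift:
  assumes X: "X \<in> completion A" "x \<in> X"
  shows "shift X r \<in> completion A" "(\<lambda>n. x n + r *\<^sub>R e) \<in> shift X r"
proof -
  have "(\<lambda>n. x n + r *\<^sub>R e) \<in> cauchy_seqs A"
    using completion_mem(1)[OF X] by (intro cauchy_add) auto
  moreover have "shift X r = null_rel A `` {\<lambda>n. x n + r *\<^sub>R e}"
    unfolding shift_def by (rule compl_add_eq[OF X unit_class])
  ultimately show "shift X r \<in> completion A" "(\<lambda>n. x n + r *\<^sub>R e) \<in> shift X r"
    by (simp_all only: class_in_completion mem_class)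
qed

lemma compl_leq_eventually:
  assumes X: "X \<in> completion A" "x \<in> X" and Y: "Y \<in> completion A" "y \<in> Y" and s: "s > 0"
    and le: "compl_leq A X Y"
  shows "\<forall>\<^sub>F n in sequentially. x n \<preceq> y n + s *\<^sub>R e"
proof -
  obtain x' y' where xy': "x' \<in> X" "y' \<in> Y" "\<And>n. x' n \<preceq> y' n" using le by (auto simp: compl_leq_def)
  have "(\<lambda>n. N (x n - x' n)) \<longlonglongrightarrow> 0" "(\<lambda>n. N (y' n - y n)) \<longlonglongrightarrow> 0"
    using completion_mem_tendsto X Y xy' by auto
  then have "\<forall>\<^sub>F n in sequentially. N (x n - x' n) < s / 2" "\<forall>\<^sub>F n in sequentially. N (y' n - y n) < s / 2"
    using order_tendstoD(2)[of _ 0 sequentially "s / 2"] s by simp_all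
  then show ?thesis
  proof eventually_elim
    case (elim n)
    have V: "x n \<in> V" "x' n \<in> V" "y n \<in> V" "y' n \<in> V"
      using completion_mem(1) X Y xy' cauchy_V by blast+
    have 1: "x n - x' n \<preceq> (s / 2) *\<^sub>R e" using norm_le_iff[of "x n - x' n" "s / 2"] V elim by simp
    have 2: "y' n - y n \<preceq> (s / 2) *\<^sub>R e" using norm_le_iff[of "y' n - y n" "s / 2"] V elim by simp
    have "(x n - x' n) + (y' n - y n) \<preceq> (s / 2) *\<^sub>R e + (s / 2) *\<^sub>R e"
      using le_add[OF _ _ _ _ 1 2] V by simp
    then have "(x n - x' n) + (y' n - y n) + x' n \<preceq> (s / 2) *\<^sub>R e + (s / 2) *\<^sub>R e + y' n"
      using le_add[OF _ _ _ _ \<open>_ \<preceq> (s / 2) *\<^sub>R e + (s / 2) *\<^sub>R e\<close> xy'(3)[of n]] V by simp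
    then have "x n + (y' n - y n) \<preceq> s *\<^sub>R e + y' n"
      by (simp add: algebra_simps flip: scaleR_left_distrib)
    then have "x n + (y' n - y n) - (y' n - y n) \<preceq> s *\<^sub>R e + y' n - (y' n - y n)"
      using le_add_right[of "x n + (y' n - y n)" "s *\<^sub>R e + y' n" "- (y' n - y n)"] V by simp
    then show "x n \<preceq> y n + s *\<^sub>R e" by (simp add: algebra_simps)
  qed
qed

text \<open>Changing finitely many terms of a representative does not change its class.\<close>

lemma compl_leqI:
  assumes X: "X \<in> completion A" "x \<in> X" and Y: "Y \<in> completion A" "y \<in> Y"
    and ev: "\<forall>\<^sub>F n in sequentially. x n \<preceq> y n"
  shows "compl_leq A X Y"
proof -
  define x' where "x' n = (if x n \<preceq> y n then x n else y n)" for n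
  note c = completion_mem(1)[OF X] completion_mem(1)[OF Y]
  note V = c[THEN cauchy_V]
  have "\<forall>\<^sub>F n in sequentially. N (x n - x' n) = 0" using ev by eventually_elim (simp add: x'_def)
  then have "(x, x') \<in> null_rel A" using c V by (intro null_relI tendsto_eventually) (auto simp: x'_def)
  then have "x' \<in> X" using completion_mem(2)[OF X] by simp
  then show ?thesis unfolding compl_leq_def using Y(2) V by (intro bexI[of _ x'] bexI[of _ y]) (auto simp: x'_def)
qed

lemma compl_leq_shift_if_norm_le:
  assumes X: "X \<in> completion A" "x \<in> X" and Y: "Y \<in> completion A" "y \<in> Y"
    and ev: "\<forall>\<^sub>F n in sequentially. N (x n - y n) \<le> r"
  shows "compl_leq A X (shift Y r)"
proof (rule compl_leqI[OF X shift[OF Y]])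
  show "\<forall>\<^sub>F n in sequentially. x n \<preceq> y n + r *\<^sub>R e"
    using ev
  proof eventually_elim
    case (elim n)
    have V: "x n \<in> V" "y n \<in> V" using completion_mem(1) X Y cauchy_V by blast+
    then have "x n - y n \<preceq> r *\<^sub>R e" using norm_le_iff[of "x n - y n" r] elim by auto
    then show "x n \<preceq> y n + r *\<^sub>R e" using le_add_right[of "x n - y n" "r *\<^sub>R e" "y n"] V
      by (simp add: add.commute)
  qed
qed

lemma norm_le_if_compl_leq_shift:
  assumes X: "X \<in> completion A" "x \<in> X" and Y: "Y \<in> completion A" "y \<in> Y" and s: "s > 0"
    and le: "compl_leq A X (shift Y r)" "compl_leq A Y (shift X r)"
  shows "\<forall>\<^sub>F n in sequentially. N (x n - y n) \<le> r + s"
  using compl_leq_eventually[OF X shift[OF Y] s le(1)]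
    compl_leq_eventually[OF Y shift[OF X] s le(2)]
proof eventually_elim
  case (elim n)
  have V: "x n \<in> V" "y n \<in> V" using completion_mem(1) X Y cauchy_V by blast+
  have "x n - y n \<preceq> (r + s) *\<^sub>R e" "- (x n - y n) \<preceq> (r + s) *\<^sub>R e"
    using le_add_right[OF _ _ _ elim(1), of "- y n"] le_add_right[OF _ _ _ elim(2), of "- x n"] V
    by (auto simp: algebra_simps)
  then show "N (x n - y n) \<le> r + s" using norm_le_iff V by simp
qed

end

context proper_qms
begin

lemma compl_Lip_le: "x \<in> X \<Longrightarrow> (\<And>n. L (x n) \<le> c) \<Longrightarrow> compl_Lip L X \<le> ereal c"
  unfolding compl_Lip_def
  by (rule INF_lower2[of x]) (auto intro!: Liminf_le)

lemma compl_Lip_lessE: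
  assumes "compl_Lip L X < ereal c"
  obtains x where "x \<in> X" "\<exists>\<^sub>F n in sequentially. L (x n) < c"
proof -
  obtain x where x: "x \<in> X" "liminf (\<lambda>n. ereal (L (x n))) < ereal c"
    using assms unfolding compl_Lip_def INF_less_iff by blast
  have "\<exists>\<^sub>F n in sequentially. L (x n) < c"
  proof (rule ccontr)
    assume "\<not> ?thesis"
    then have "\<forall>\<^sub>F n in sequentially. ereal c \<le> ereal (L (x n))" by (simp add: frequently_def not_less)
    then have "ereal c \<le> liminf (\<lambda>n. ereal (L (x n)))" by (rule Liminf_bounded)
    then show False using x(2) by simp
  qed
  then show thesis using that x(1) by blast
qed

lemma const_class_in_closure:
  assumes a: "a \<in> V"
  shows "null_rel A `` {\<lambda>_. a} \<in> closure_carr A L" "compl_Lip L (null_rel A `` {\<lambda>_. a}) \<le> ereal (L a)"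
proof -
  show "compl_Lip L (null_rel A `` {\<lambda>_. a}) \<le> ereal (L a)"
    using mem_class[OF cauchy_const[OF a]] by (rule compl_Lip_le) simp
  then show "null_rel A `` {\<lambda>_. a} \<in> closure_carr A L"
    using class_in_completion[OF cauchy_const[OF a]] by (auto simp: closure_carr_def)
qed

lemma closure_unit_class: "unit_class r \<in> closure_carr A L"
  unfolding unit_class_eq by (rule const_class_in_closure) simp

lemma closure_completion: "X \<in> closure_carr A L \<Longrightarrow> X \<in> completion A"
  by (simp add: closure_carr_def)

lemma closure_shift: assumes X: "X \<in> closure_carr A L" shows "shift X r \<in> closure_carr A L"
proof -
  have XC: "X \<in> completion A" using X by (rule closure_completion)
  obtain x where x: "x \<in> X" "liminf (\<lambda>n. ereal (L (x n))) < \<infinity>"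
    using X unfolding closure_carr_def compl_Lip_def mem_Collect_eq INF_less_iff by blast
  have "L (x n + r *\<^sub>R e) = L (x n)" for n using completion_mem(1)[OF XC x(1)] cauchy_V by simp
  then have "compl_Lip L (shift X r) \<le> liminf (\<lambda>n. ereal (L (x n)))"
    unfolding compl_Lip_def using shift(2)[OF XC x(1), of r] by (intro INF_lower2) auto
  then show ?thesis using x(2) shift(1)[OF XC x(1), of r] by (auto simp: closure_carr_def)
qed

text \<open>The classes of \<open>0\<close> and \<open>e\<close> witness that the order is not discrete. This property is invariant under
isometry and separates proper from improper spaces.\<close>

lemma ex_distinct_compl_leq:
  "\<exists>X\<in>closure_carr A L. \<exists>Y\<in>closure_carr A L. compl_leq A X Y \<and> X \<noteq> Y"
proof (intro bexI conjI)
  show "compl_leq A (unit_class 0) (unit_class 1)"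
    using unit_pos by (intro compl_leqI[OF unit_class unit_class]) simp
  show "unit_class 0 \<noteq> unit_class 1"
  proof
    assume "unit_class 0 = unit_class 1"
    then have "(\<lambda>n. N (0 *\<^sub>R e - 1 *\<^sub>R e)) \<longlonglongrightarrow> 0"
      using unit_class(2)[of 0] by (intro completion_mem_tendsto[OF unit_class(1)[of 1] _ unit_class(2)[of 1]]) simp
    then show False using LIMSEQ_unique[OF tendsto_const[of "1::real"]] by force
  qed
qed (rule closure_unit_class)+

end

section \<open>Nearly isometric maps between Lipschitz sets\<close>

definition Lip_set :: "'a::real_vector order_unit_space \<Rightarrow> ('a \<Rightarrow> real) \<Rightarrow> real \<Rightarrow> 'a set" where
  "Lip_set A L R = {a \<in> carr A. L a \<le> 1 \<and> ou_norm A a \<le> R}"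

text \<open>The conditions are exactly what is needed to pull bounds back from \<open>Q\<close> to \<open>P\<close>: the last one for
covers, the middle one, which compares distances to multiples of the units, for the radius, and the
first one for composing maps and for landing in a totally bounded set.\<close>

definition near_isometry_on :: "real \<Rightarrow> real \<Rightarrow> 'a::real_vector qms \<Rightarrow> 'b::real_vector qms \<Rightarrow> ('a \<Rightarrow> 'b) \<Rightarrow> bool"
  where
  "near_isometry_on R \<epsilon> P Q f \<longleftrightarrow> (case (P, Q) of ((A, LA), (B, LB)) \<Rightarrow> \<forall>a\<in>Lip_set A LA R.
     f a \<in> Lip_set B LB (R + \<epsilon>) \<and>
     (\<forall>c. ou_norm A (a - c *\<^sub>R ounit A) \<le> ou_norm B (f a - c *\<^sub>R ounit B) + \<epsilon>) \<and>
     (\<forall>a'\<in>Lip_set A LA R. ou_norm A (a - a') \<le> ou_norm B (f a - f a') + \<epsilon>))"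

definition Lip_close :: "real \<Rightarrow> 'a::real_vector qms \<Rightarrow> 'b::real_vector qms \<Rightarrow> bool" where
  "Lip_close \<epsilon> P Q \<longleftrightarrow> (\<forall>R. \<exists>f. near_isometry_on R \<epsilon> P Q f)"

lemma near_isometry_onD:
  assumes "near_isometry_on R \<epsilon> (A, LA) (B, LB) f" "a \<in> Lip_set A LA R"
  shows "f a \<in> Lip_set B LB (R + \<epsilon>)"
    and "ou_norm A (a - c *\<^sub>R ounit A) \<le> ou_norm B (f a - c *\<^sub>R ounit B) + \<epsilon>"
    and "a' \<in> Lip_set A LA R \<Longrightarrow> ou_norm A (a - a') \<le> ou_norm B (f a - f a') + \<epsilon>"
  using assms by (simp_all add: near_isometry_on_def)

lemma near_isometry_on_compose:
  assumes f: "near_isometry_on R \<epsilon> (A, LA) (B, LB) f"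
    and g: "near_isometry_on (R + \<epsilon>) \<delta> (B, LB) (C, LC) g"
  shows "near_isometry_on R (\<epsilon> + \<delta>) (A, LA) (C, LC) (g \<circ> f)"
  unfolding near_isometry_on_def prod.case
proof (intro ballI conjI allI)
  note fD = near_isometry_onD[OF f] and gD = near_isometry_onD[OF g]
  fix a assume a: "a \<in> Lip_set A LA R"
  show "(g \<circ> f) a \<in> Lip_set C LC (R + (\<epsilon> + \<delta>))" using gD(1)[OF fD(1)[OF a]] by (simp add: add.assoc)
  show "ou_norm A (a - c *\<^sub>R ounit A) \<le> ou_norm C ((g \<circ> f) a - c *\<^sub>R ounit C) + (\<epsilon> + \<delta>)" for c
    using fD(2)[OF a, of c] gD(2)[OF fD(1)[OF a], of c] by simp
  show "ou_norm A (a - a') \<le> ou_norm C ((g \<circ> f) a - (g \<circ> f) a') + (\<epsilon> + \<delta>)" if "a' \<in> Lip_set A LA R" for a'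
    using fD(3)[OF a that] gD(3)[OF fD(1)[OF a] fD(1)[OF that]] by simp
qed

lemma Lip_close_trans:
  assumes PQ: "Lip_close \<epsilon> P Q" and QT: "Lip_close \<delta> Q T" shows "Lip_close (\<epsilon> + \<delta>) P T"
  unfolding Lip_close_def
proof
  fix R
  obtain f g where "near_isometry_on R \<epsilon> P Q f" "near_isometry_on (R + \<epsilon>) \<delta> Q T g"
    using PQ QT unfolding Lip_close_def by blast
  then have "near_isometry_on R (\<epsilon> + \<delta>) P T (g \<circ> f)"
    using near_isometry_on_compose by (metis surj_pair)
  then show "\<exists>h. near_isometry_on R (\<epsilon> + \<delta>) P T h" by blast
qed

text \<open>The graph of an isometry of closures. In this relational form the converse satisfies the same
conditions, so every estimate holds in both directions.\<close>

locale closure_correspondence = proper_qms_pair +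
  fixes \<psi> :: "((nat \<Rightarrow> 'a) set \<times> (nat \<Rightarrow> 'b) set) set"
  assumes \<psi>_sub: "\<psi> \<subseteq> closure_carr A LA \<times> closure_carr B LB"
    and \<psi>_total: "X \<in> closure_carr A LA \<Longrightarrow> \<exists>Y. (X, Y) \<in> \<psi>"
    and \<psi>_onto: "Y \<in> closure_carr B LB \<Longrightarrow> \<exists>X. (X, Y) \<in> \<psi>"
    and \<psi>_leq: "(X, Y) \<in> \<psi> \<Longrightarrow> (X', Y') \<in> \<psi> \<Longrightarrow>
        compl_leq A X (A.shift X' r) \<longleftrightarrow> compl_leq B Y (B.shift Y' r)"
    and \<psi>_Lip: "(X, Y) \<in> \<psi> \<Longrightarrow> compl_Lip LA X = compl_Lip LB Y"
    and \<psi>_unit: "(A.unit_class c, B.unit_class c) \<in> \<psi>"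
begin

lemma converse: "closure_correspondence B LB A LA (\<psi>\<inverse>)"
proof unfold_locales
  show "\<psi>\<inverse> \<subseteq> closure_carr B LB \<times> closure_carr A LA" using \<psi>_sub by blast
  show "\<exists>X. (Y, X) \<in> \<psi>\<inverse>" if "Y \<in> closure_carr B LB" for Y using \<psi>_onto[OF that] by simp
  show "\<exists>Y. (Y, X) \<in> \<psi>\<inverse>" if "X \<in> closure_carr A LA" for X using \<psi>_total[OF that] by simp
qed (use \<psi>_leq \<psi>_Lip \<psi>_unit in simp_all)

lemma norm_le_transfer:
  assumes XY: "(X, Y) \<in> \<psi>" "(X', Y') \<in> \<psi>" and x: "x \<in> X" "x' \<in> X'" and y: "y \<in> Y" "y' \<in> Y'"
    and s: "s > 0" and ev: "\<forall>\<^sub>F n in sequentially. A.N (x n - x' n) \<le> r"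
  shows "\<forall>\<^sub>F n in sequentially. B.N (y n - y' n) \<le> r + s"
proof -
  have C: "X \<in> completion A" "X' \<in> completion A" "Y \<in> completion B" "Y' \<in> completion B"
    using XY \<psi>_sub A.closure_completion B.closure_completion by auto
  have V: "x n \<in> A.V" "x' n \<in> A.V" for n
    using A.completion_mem(1)[OF C(1) x(1)] A.completion_mem(1)[OF C(2) x(2)] A.cauchy_V by auto
  have ev': "\<forall>\<^sub>F n in sequentially. A.N (x' n - x n) \<le> r"
    using ev V by (simp add: A.norm_minus_commute)
  have "compl_leq B Y (B.shift Y' r)" "compl_leq B Y' (B.shift Y r)"
    using A.compl_leq_shift_if_norm_le[OF C(1) x(1) C(2) x(2) ev]
      A.compl_leq_shift_if_norm_le[OF C(2) x(2) C(1) x(1) ev'] \<psi>_leq XY by auto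
  then show ?thesis by (rule B.norm_le_if_compl_leq_shift[OF C(3) y(1) C(4) y(2) s])
qed

text \<open>The element \<open>b\<close> lies within distance \<open>\<delta>\<close> of the point of the completion of \<open>B\<close> that corresponds to \<open>a\<close>.\<close>

definition approx :: "real \<Rightarrow> 'a \<Rightarrow> 'b \<Rightarrow> bool" where
  "approx \<delta> a b \<longleftrightarrow> b \<in> B.V \<and> (\<exists>X Y y. (X, Y) \<in> \<psi> \<and> (\<lambda>_. a) \<in> X \<and> y \<in> Y \<and>
     (\<forall>\<^sub>F n in sequentially. B.N (y n - b) \<le> \<delta>))"

lemma approx_norm_diff:
  assumes ab: "approx \<delta> a b" and ab': "approx \<delta> a' b'" and \<delta>: "\<delta> > 0"
  shows "A.N (a - a') \<le> B.N (b - b') + 3 * \<delta>" "B.N (b - b') \<le> A.N (a - a') + 3 * \<delta>"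
proof -
  obtain X Y y where y: "(X, Y) \<in> \<psi>" "(\<lambda>_. a) \<in> X" "y \<in> Y" "\<forall>\<^sub>F n in sequentially. B.N (y n - b) \<le> \<delta>"
    using ab by (auto simp: approx_def)
  obtain X' Y' y' where y': "(X', Y') \<in> \<psi>" "(\<lambda>_. a') \<in> X'" "y' \<in> Y'" "\<forall>\<^sub>F n in sequentially. B.N (y' n - b') \<le> \<delta>"
    using ab' by (auto simp: approx_def)
  have b: "b \<in> B.V" "b' \<in> B.V" using ab ab' by (auto simp: approx_def)
  have "Y \<in> completion B" "Y' \<in> completion B" using y y' \<psi>_sub B.closure_completion by auto
  then have V: "y n \<in> B.V" "y' n \<in> B.V" for n
    using B.completion_mem(1) y(3) y'(3) B.cauchy_V by blast+
  have "\<forall>\<^sub>F n in sequentially. B.N (y n - y' n) \<le> B.N (b - b') + 2 * \<delta>"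
    using y(4) y'(4)
  proof eventually_elim
    case (elim n)
    have "B.N (y n - y' n) \<le> B.N (y n - b) + B.N (b - y' n)" using V b by (intro B.norm_triangle) auto
    moreover have "B.N (b - y' n) \<le> B.N (b - b') + B.N (b' - y' n)" using V b by (intro B.norm_triangle) auto
    moreover have "B.N (b' - y' n) = B.N (y' n - b')" using V b by (intro B.norm_minus_commute) auto
    ultimately show ?case using elim by linarith
  qed
  from closure_correspondence.norm_le_transfer[OF converse _ _ y(3) y'(3) y(2) y'(2) \<delta> this] y(1) y'(1)
  show "A.N (a - a') \<le> B.N (b - b') + 3 * \<delta>" by simp
  have "\<forall>\<^sub>F n in sequentially. B.N (y n - y' n) \<le> A.N (a - a') + \<delta>"
    using norm_le_transfer[OF y(1) y'(1) y(2) y'(2) y(3) y'(3) \<delta>, of "A.N (a - a')"] by simp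
  then have "\<forall>\<^sub>F n in sequentially. B.N (b - b') \<le> A.N (a - a') + 3 * \<delta>"
    using y(4) y'(4)
  proof eventually_elim
    case (elim n)
    have "B.N (b - b') \<le> B.N (b - y n) + B.N (y n - b')" using V b by (intro B.norm_triangle) auto
    moreover have "B.N (y n - b') \<le> B.N (y n - y' n) + B.N (y' n - b')" using V b by (intro B.norm_triangle) auto
    moreover have "B.N (b - y n) = B.N (y n - b)" using V b by (intro B.norm_minus_commute) auto
    ultimately show ?case using elim by linarith
  qed
  then show "B.N (b - b') \<le> A.N (a - a') + 3 * \<delta>" by simp
qed

lemma approx_unit: "\<delta> > 0 \<Longrightarrow> approx \<delta> (c *\<^sub>R A.e) (c *\<^sub>R B.e)"
  unfolding approx_def using \<psi>_unit[of c] A.unit_class(2)[of c] B.unit_class(2)[of c]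
  by (intro conjI exI[of _ "A.unit_class c"] exI[of _ "B.unit_class c"] exI[of _ "\<lambda>_. c *\<^sub>R B.e"]) auto

text \<open>The definition of the closed seminorm only yields approximants \<open>y n\<close> with \<open>LB (y n) < 1 + \<eta>\<close>. Dividing
by \<open>1 + \<eta>\<close> brings them into the unit ball and moves them by at most \<open>\<eta>\<close> times their norm, which is
bounded by \<open>M\<close> independently of \<open>\<eta>\<close>.\<close>

lemma ex_approx:
  assumes a: "a \<in> A.V" "LA a \<le> 1" and \<delta>: "\<delta> > 0"
  shows "\<exists>b. approx \<delta> a b \<and> LB b \<le> 1"
proof -
  define X where "X = null_rel A `` {\<lambda>_. a}"
  have X: "X \<in> closure_carr A LA" "compl_Lip LA X \<le> ereal (LA a)" "(\<lambda>_. a) \<in> X"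
    using A.const_class_in_closure[OF a(1)] A.mem_class[OF A.cauchy_const[OF a(1)]] by (auto simp: X_def)
  obtain Y where Y: "(X, Y) \<in> \<psi>" using \<psi>_total[OF X(1)] by blast
  have YC: "Y \<in> completion B" using Y \<psi>_sub B.closure_completion by auto
  define M where "M = A.N a + 1"
  have M: "M > 0" using A.norm_nonneg[OF a(1)] by (simp add: M_def)
  define \<eta> where "\<eta> = \<delta> / (2 * M)"
  have \<eta>: "\<eta> > 0" using \<delta> M by (simp add: \<eta>_def)
  have "compl_Lip LB Y \<le> ereal 1" using \<psi>_Lip[OF Y] X(2) a(2) order_trans[of _ "ereal (LA a)" "ereal 1"] by simp
  then have "compl_Lip LB Y < ereal (1 + \<eta>)" using \<eta> by (meson ereal_less(2) less_add_same_cancel1 less_ereal.simps(1) order_le_less_trans)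
  then obtain y where y: "y \<in> Y" "\<exists>\<^sub>F n in sequentially. LB (y n) < 1 + \<eta>"
    by (rule B.compl_Lip_lessE)
  have cy: "y \<in> cauchy_seqs B" using B.completion_mem(1)[OF YC y(1)] .
  have V: "y n \<in> B.V" for n using B.cauchy_V[OF cy] .
  have "\<forall>\<^sub>F n in sequentially. B.N (y n - 0 *\<^sub>R B.e) \<le> A.N a + 1"
    using norm_le_transfer[OF Y \<psi>_unit X(3) A.unit_class(2) y(1) B.unit_class(2), of 1 0 "A.N a"] by simp
  moreover obtain K where K: "\<And>m n. m \<ge> K \<Longrightarrow> n \<ge> K \<Longrightarrow> B.N (y m - y n) < \<delta> / 2"
    using B.cauchyD[OF cy, of "\<delta> / 2"] \<delta> by auto
  ultimately have "\<forall>\<^sub>F n in sequentially. B.N (y n) \<le> M \<and> n \<ge> K"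
    using eventually_ge_at_top[of K] by (auto simp: M_def intro: eventually_conj)
  then obtain n where n: "LB (y n) < 1 + \<eta>" "B.N (y n) \<le> M" "n \<ge> K"
    using frequently_eventually_frequently[OF y(2)] frequently_ex by (metis (mono_tags, lifting))
  define b where "b = (1 / (1 + \<eta>)) *\<^sub>R y n"
  have b: "b \<in> B.V" "LB b \<le> 1" using n(1) \<eta> V by (auto simp: b_def B.L_scaleR field_simps)
  have "y n - b = (\<eta> / (1 + \<eta>)) *\<^sub>R y n"
  proof -
    have "1 - 1 / (1 + \<eta>) = \<eta> / (1 + \<eta>)" using \<eta> by (simp add: field_simps)
    then show ?thesis unfolding b_def by (metis scaleR_left_diff_distrib scaleR_one)
  qed
  then have "B.N (y n - b) = \<eta> / (1 + \<eta>) * B.N (y n)" using V \<eta> by (simp add: B.norm_scaleR)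
  also have "\<dots> \<le> \<eta> * M"
    using \<eta> n(2) B.norm_nonneg[OF V, of n] by (intro mult_mono) (auto simp: field_simps)
  also have "\<dots> = \<delta> / 2" using M by (simp add: \<eta>_def)
  finally have close: "B.N (y n - b) \<le> \<delta> / 2" .
  have "\<forall>\<^sub>F m in sequentially. B.N (y m - b) \<le> \<delta>"
    using eventually_ge_at_top[of K]
  proof eventually_elim
    case (elim m)
    have "B.N (y m - b) \<le> B.N (y m - y n) + B.N (y n - b)" using V b by (intro B.norm_triangle) auto
    then show ?case using K[OF elim n(3)] close by linarith
  qed
  then have "approx \<delta> a b" unfolding approx_def using b(1) Y X(3) y(1) by blast
  then show ?thesis using b by blast
qed

lemma Lip_close_if_closure_correspondence:
  assumes \<epsilon>: "\<epsilon> > 0" shows "Lip_close \<epsilon> (A, LA) (B, LB)"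
  unfolding Lip_close_def
proof
  fix R
  define \<delta> where "\<delta> = \<epsilon> / 3"
  have \<delta>: "\<delta> > 0" "\<epsilon> = 3 * \<delta>" using \<epsilon> by (auto simp: \<delta>_def)
  obtain f where f: "\<And>a. a \<in> A.V \<Longrightarrow> LA a \<le> 1 \<Longrightarrow> approx \<delta> a (f a) \<and> LB (f a) \<le> 1"
    using ex_approx[OF _ _ \<delta>(1)] by metis
  have "near_isometry_on R \<epsilon> (A, LA) (B, LB) f"
    unfolding near_isometry_on_def prod.case
  proof (intro ballI conjI allI)
    fix a assume a: "a \<in> Lip_set A LA R"
    then have fa: "approx \<delta> a (f a)" "LB (f a) \<le> 1" "A.N a \<le> R" using f by (auto simp: Lip_set_def)
    have "B.N (f a) \<le> A.N a + \<epsilon>"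
      using approx_norm_diff(2)[OF fa(1) approx_unit[OF \<delta>(1), of 0] \<delta>(1)] \<delta>(2) by simp
    then show "f a \<in> Lip_set B LB (R + \<epsilon>)" using fa by (auto simp: Lip_set_def approx_def)
    show "A.N (a - c *\<^sub>R A.e) \<le> B.N (f a - c *\<^sub>R B.e) + \<epsilon>" for c
      using approx_norm_diff(1)[OF fa(1) approx_unit[OF \<delta>(1)] \<delta>(1)] \<delta>(2) by simp
    show "A.N (a - a') \<le> B.N (f a - f a') + \<epsilon>" if "a' \<in> Lip_set A LA R" for a'
      using approx_norm_diff(1)[OF fa(1) _ \<delta>(1), of a' "f a'"] f[of a'] that \<delta>(2) by (simp add: Lip_set_def)
  qed
  then show "\<exists>f. near_isometry_on R \<epsilon> (A, LA) (B, LB) f" by blast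
qed

end

lemma Lip_close_if_isometric:
  assumes P: "proper_qms A LA" and Q: "proper_qms B LB"
    and iso: "isometric (A, LA) (B, LB)" and \<epsilon>: "\<epsilon> > 0"
  shows "Lip_close \<epsilon> (A, LA) (B, LB)" "Lip_close \<epsilon> (B, LB) (A, LA)"
proof -
  interpret A: proper_qms A LA by fact
  interpret B: proper_qms B LB by fact
  obtain \<phi> where bij: "bij_betw \<phi> (closure_carr A LA) (closure_carr B LB)"
    and add: "\<forall>X\<in>closure_carr A LA. \<forall>Y\<in>closure_carr A LA.
        \<phi> (compl_add A X Y) = compl_add B (\<phi> X) (\<phi> Y)"
    and scale: "\<forall>X\<in>closure_carr A LA. \<forall>r. \<phi> (compl_scale A r X) = compl_scale B r (\<phi> X)"
    and leq: "\<forall>X\<in>closure_carr A LA. \<forall>Y\<in>closure_carr A LA.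
        compl_leq A X Y \<longleftrightarrow> compl_leq B (\<phi> X) (\<phi> Y)"
    and unit: "\<phi> (compl_unit A) = compl_unit B"
    and Lip: "\<forall>X\<in>closure_carr A LA. compl_Lip LA X = compl_Lip LB (\<phi> X)"
    using iso unfolding isometric_def prod.case by (elim exE conjE) (rule that)
  have "compl_unit A \<in> closure_carr A LA"
    unfolding compl_unit_def by (rule A.const_class_in_closure) simp
  then have "\<phi> (A.unit_class c) = B.unit_class c" for c
    unfolding A.unit_class_def B.unit_class_def using scale unit by simp
  note unit_class = this
  have shift: "\<phi> (A.shift X r) = B.shift (\<phi> X) r" if "X \<in> closure_carr A LA" for X r
    unfolding A.shift_def B.shift_def using add that A.closure_unit_class unit_class by simp
  have leq_shift: "compl_leq A X (A.shift X' r) \<longleftrightarrow> compl_leq B (\<phi> X) (B.shift (\<phi> X') r)"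
    if "X \<in> closure_carr A LA" "X' \<in> closure_carr A LA" for X X' r
    using leq that(1) A.closure_shift[OF that(2)] shift[OF that(2)] by simp
  have image: "closure_carr B LB = \<phi> ` closure_carr A LA" using bij_betw_imp_surj_on[OF bij] by (rule sym)
  have onto: "\<exists>X\<in>closure_carr A LA. \<phi> X = Y" if "Y \<in> closure_carr B LB" for Y
    using that unfolding image by (elim imageE) (rule bexI, rule sym)
  have into: "\<phi> X \<in> closure_carr B LB" if "X \<in> closure_carr A LA" for X
    using that unfolding image by (rule imageI)
  define \<psi> where "\<psi> = (\<lambda>X. (X, \<phi> X)) ` closure_carr A LA"
  have \<psi>: "(X, Y) \<in> \<psi> \<longleftrightarrow> X \<in> closure_carr A LA \<and> Y = \<phi> X" for X Y by (auto simp: \<psi>_def)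
  have sub: "\<psi> \<subseteq> closure_carr A LA \<times> closure_carr B LB" using into by (auto simp: \<psi>_def)
  have unit_\<psi>: "(A.unit_class c, B.unit_class c) \<in> \<psi>" for c
    by (simp add: \<psi> unit_class A.closure_unit_class)
  have leq_\<psi>: "compl_leq A X (A.shift X' r) \<longleftrightarrow> compl_leq B Y (B.shift Y' r)"
    if "(X, Y) \<in> \<psi>" "(X', Y') \<in> \<psi>" for X Y X' Y' r
    using that leq_shift by (simp add: \<psi>)
  have Lip_\<psi>: "compl_Lip LA X = compl_Lip LB Y" if "(X, Y) \<in> \<psi>" for X Y
    using that Lip by (simp add: \<psi>)
  interpret F: closure_correspondence A LA B LB \<psi>
  proof unfold_locales
    show "\<exists>Y. (X, Y) \<in> \<psi>" if "X \<in> closure_carr A LA" for X using that \<psi> by blast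
    show "\<exists>X. (X, Y) \<in> \<psi>" if "Y \<in> closure_carr B LB" for Y using onto[OF that] \<psi> by blast
  qed (fact sub leq_\<psi> Lip_\<psi> unit_\<psi>)+
  show "Lip_close \<epsilon> (A, LA) (B, LB)" "Lip_close \<epsilon> (B, LB) (A, LA)"
    using F.Lip_close_if_closure_correspondence[OF \<epsilon>] 
      closure_correspondence.Lip_close_if_closure_correspondence[OF F.converse \<epsilon>] .
qed

section \<open>Consequences of a small distance\<close>

context proper_qms_pair
begin

definition agree :: "('a \<times> 'b \<Rightarrow> real) \<Rightarrow> real \<Rightarrow> ('a \<Rightarrow> real) \<Rightarrow> ('b \<Rightarrow> real) \<Rightarrow> bool" where
  "agree L \<epsilon> \<mu> \<nu> \<longleftrightarrow> (\<forall>a\<in>A.V. \<forall>b\<in>B.V. L (a, b) \<le> 1 \<longrightarrow> \<bar>\<mu> a - \<nu> b\<bar> \<le> \<epsilon>)"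

lemma dist_q_lessE:
  assumes "dist_q (A, LA) (B, LB) < ereal \<epsilon>"
  obtains L where "admissible A LA B LB L"
    "\<forall>\<mu>\<in>states A. \<exists>\<nu>\<in>states B. agree L \<epsilon> \<mu> \<nu>" "\<forall>\<nu>\<in>states B. \<exists>\<mu>\<in>states A. agree L \<epsilon> \<mu> \<nu>"
proof -
  obtain L where L: "admissible A LA B LB L"
    and H: "hausdorff_dist (rho (direct_sum A B) L) (states_left A B) (states_right A B) < ereal \<epsilon>"
    using assms unfolding dist_q_def prod.case INF_less_iff by blast
  let ?l = "\<lambda>\<mu>. restrict (\<lambda>p. \<mu> (fst p)) (A.V \<times> B.V)"
  let ?r = "\<lambda>\<nu>. restrict (\<lambda>p. \<nu> (snd p)) (A.V \<times> B.V)"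
  have close: "agree L \<epsilon> \<mu> \<nu>" if "rho (direct_sum A B) L (?l \<mu>) (?r \<nu>) < ereal \<epsilon>" for \<mu> \<nu>
    using S.rho_le_iff[of L "?l \<mu>" "?r \<nu>" \<epsilon>] that by (auto simp: agree_def)
  show thesis
  proof (rule that[OF L]; intro ballI)
    fix \<mu> assume "\<mu> \<in> states A"
    then have "?l \<mu> \<in> states_left A B" unfolding states_left_def by (rule imageI)
    then obtain z where z: "z \<in> states_right A B" "rho (direct_sum A B) L (?l \<mu>) z < ereal \<epsilon>"
      using hausdorff_dist_lessD(1)[OF H] by blast
    obtain \<nu> where "z = ?r \<nu>" "\<nu> \<in> states B" using z(1) unfolding states_right_def by (rule imageE)
    then show "\<exists>\<nu>\<in>states B. agree L \<epsilon> \<mu> \<nu>" using close z(2) by blast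
  next
    fix \<nu> assume "\<nu> \<in> states B"
    then have "?r \<nu> \<in> states_right A B" unfolding states_right_def by (rule imageI)
    then obtain z where z: "z \<in> states_left A B" "rho (direct_sum A B) L z (?r \<nu>) < ereal \<epsilon>"
      using hausdorff_dist_lessD(2)[OF H] by blast
    obtain \<mu> where "z = ?l \<mu>" "\<mu> \<in> states A" using z(1) unfolding states_left_def by (rule imageE)
    then show "\<exists>\<mu>\<in>states A. agree L \<epsilon> \<mu> \<nu>" using close z(2) by blast
  qed
qed

text \<open>The quotient condition lifts \<open>b\<close> with \<open>LB b \<le> 1\<close> to a pair \<open>(a, b)\<close> with \<open>L (a, b) < 1 + \<delta>\<close>; scaling the
pair into the unit ball displaces \<open>b\<close> by at most \<open>\<delta>\<close> times \<open>R\<close>, which the choice of \<open>\<delta>\<close> keeps below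
\<open>\<epsilon>\<close>. Norm comparisons follow because every state of one space is close to a state of the other.\<close>

lemma Lip_close_if_dist_q_less:
  assumes d: "dist_q (A, LA) (B, LB) < ereal \<epsilon>" and \<epsilon>: "\<epsilon> > 0"
  shows "Lip_close (4 * \<epsilon>) (B, LB) (A, LA)"
  unfolding Lip_close_def
proof
  fix R
  obtain L where L: "admissible A LA B LB L"
    and toB: "\<forall>\<mu>\<in>states A. \<exists>\<nu>\<in>states B. agree L \<epsilon> \<mu> \<nu>"
    and toA: "\<forall>\<nu>\<in>states B. \<exists>\<mu>\<in>states A. agree L \<epsilon> \<mu> \<nu>"
    by (rule dist_q_lessE[OF d])
  interpret L: proper_qms "direct_sum A B" L
    using L by unfold_locales (simp add: admissible_def)
  define \<delta> where "\<delta> = \<epsilon> / (\<bar>R\<bar> + 1)"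
  have \<delta>: "\<delta> > 0" using \<epsilon> by (simp add: \<delta>_def)
  have "\<exists>a\<in>A.V. LA a \<le> 1 \<and> L (a, (1 / (1 + \<delta>)) *\<^sub>R b) \<le> 1" if b: "b \<in> B.V" "LB b \<le> 1" for b
  proof -
    have "(INF a\<in>A.V. L (a, b)) < 1 + \<delta>" using L b \<delta> by (simp add: admissible_def)
    moreover have "(\<lambda>a. L (a, b)) ` A.V \<noteq> {}" by auto
    ultimately obtain z where "z \<in> (\<lambda>a. L (a, b)) ` A.V" "z < 1 + \<delta>" by (metis cInf_lessD)
    then obtain a where a: "a \<in> A.V" "L (a, b) < 1 + \<delta>" by blast
    define t where "t = 1 / (1 + \<delta>)"
    have "L (t *\<^sub>R (a, b)) = \<bar>t\<bar> * L (a, b)" using a b by (intro L.L_scaleR) auto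
    also have "\<dots> \<le> 1" using a(2) \<delta> by (simp add: t_def)
    finally have t: "L (t *\<^sub>R a, t *\<^sub>R b) \<le> 1" by simp
    have "LA (t *\<^sub>R a) = (INF b\<in>B.V. L (t *\<^sub>R a, b))" using L a by (simp add: admissible_def)
    also have "\<dots> \<le> L (t *\<^sub>R a, t *\<^sub>R b)"
    proof (rule cINF_lower)
      show "bdd_below ((\<lambda>b. L (t *\<^sub>R a, b)) ` B.V)"
        using L.L_nonneg a by (auto simp: bdd_below_def intro!: exI[of _ 0])
    qed (use b in auto)
    finally show ?thesis using t a by (intro bexI[of _ "t *\<^sub>R a"]) (auto simp: t_def)
  qed
  then obtain f where f: "\<And>b. b \<in> B.V \<Longrightarrow> LB b \<le> 1 \<Longrightarrow>
      f b \<in> A.V \<and> LA (f b) \<le> 1 \<and> L (f b, (1 / (1 + \<delta>)) *\<^sub>R b) \<le> 1"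
    by metis
  have est: "\<bar>\<mu> (f b) - \<nu> b\<bar> \<le> 2 * \<epsilon>"
    if b: "b \<in> Lip_set B LB R" and \<nu>: "\<nu> \<in> states B"
      and c: "agree L \<epsilon> \<mu> \<nu>" for b \<mu> \<nu>
  proof -
    have bV: "b \<in> B.V" "LB b \<le> 1" "B.N b \<le> R" using b by (auto simp: Lip_set_def)
    define s where "s = 1 / (1 + \<delta>)"
    have "\<bar>\<mu> (f b) - \<nu> (s *\<^sub>R b)\<bar> \<le> \<epsilon>"
      unfolding s_def using c f[OF bV(1,2)] B.V_closed(6)[OF bV(1)] unfolding agree_def by blast
    then have 1: "\<bar>\<mu> (f b) - s * \<nu> b\<bar> \<le> \<epsilon>" using \<nu> bV by (simp add: B.state_scaleR)
    have s: "0 \<le> 1 - s" "1 - s \<le> \<delta>" using \<delta> by (auto simp: s_def field_simps)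
    have "\<nu> b - s * \<nu> b = (1 - s) * \<nu> b" by (simp add: left_diff_distrib)
    then have "\<bar>\<nu> b - s * \<nu> b\<bar> = (1 - s) * \<bar>\<nu> b\<bar>" using s by (simp add: abs_mult)
    also have "\<dots> \<le> \<delta> * (\<bar>R\<bar> + 1)"
      using s \<delta> B.state_le_norm[OF \<nu> bV(1)] bV(3) by (intro mult_mono) auto
    also have "\<dots> = \<epsilon>" by (simp add: \<delta>_def)
    finally show ?thesis using 1 by linarith
  qed
  have "near_isometry_on R (4 * \<epsilon>) (B, LB) (A, LA) f"
    unfolding near_isometry_on_def prod.case
  proof (intro ballI conjI allI)
    fix b assume b: "b \<in> Lip_set B LB R"
    then have bV: "b \<in> B.V" "LB b \<le> 1" "B.N b \<le> R" by (auto simp: Lip_set_def)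
    note fb = f[OF bV(1,2)]
    have "A.N (f b) \<le> R + 4 * \<epsilon>"
    proof (rule A.norm_le_if_states_le)
      fix \<mu> assume "\<mu> \<in> states A"
      then obtain \<nu> where \<nu>: "\<nu> \<in> states B" "agree L \<epsilon> \<mu> \<nu>"
        using toB by blast
      show "\<bar>\<mu> (f b)\<bar> \<le> R + 4 * \<epsilon>"
        using est[OF b \<nu>] B.state_le_norm[OF \<nu>(1) bV(1)] bV(3) \<epsilon> by linarith
    qed (use fb in blast)
    then show "f b \<in> Lip_set A LA (R + 4 * \<epsilon>)" using fb by (simp add: Lip_set_def)
    show "B.N (b - c *\<^sub>R B.e) \<le> A.N (f b - c *\<^sub>R A.e) + 4 * \<epsilon>" for c
    proof (rule B.norm_le_if_states_le)
      fix \<nu> assume \<nu>: "\<nu> \<in> states B"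
      then obtain \<mu> where \<mu>: "\<mu> \<in> states A" "agree L \<epsilon> \<mu> \<nu>"
        using toA by blast
      have "\<mu> (f b - c *\<^sub>R A.e) = \<mu> (f b) - c" "\<nu> (b - c *\<^sub>R B.e) = \<nu> b - c"
        using fb bV \<mu> \<nu> by (simp_all add: A.state_diff A.state_unit B.state_diff B.state_unit)
      moreover have "\<bar>\<mu> (f b - c *\<^sub>R A.e)\<bar> \<le> A.N (f b - c *\<^sub>R A.e)"
        using fb by (intro A.state_le_norm[OF \<mu>(1)]) auto
      ultimately show "\<bar>\<nu> (b - c *\<^sub>R B.e)\<bar> \<le> A.N (f b - c *\<^sub>R A.e) + 4 * \<epsilon>"
        using est[OF b \<nu> \<mu>(2)] \<epsilon> by linarith
    qed (use bV in auto)
    show "B.N (b - b') \<le> A.N (f b - f b') + 4 * \<epsilon>" if b': "b' \<in> Lip_set B LB R" for b'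
    proof (rule B.norm_le_if_states_le)
      have b'V: "b' \<in> B.V" "LB b' \<le> 1" using b' by (auto simp: Lip_set_def)
      note fb' = f[OF b'V]
      show "b - b' \<in> B.V" using bV b'V by auto
      fix \<nu> assume \<nu>: "\<nu> \<in> states B"
      then obtain \<mu> where \<mu>: "\<mu> \<in> states A" "agree L \<epsilon> \<mu> \<nu>"
        using toA by blast
      have "\<mu> (f b - f b') = \<mu> (f b) - \<mu> (f b')" "\<nu> (b - b') = \<nu> b - \<nu> b'"
        using fb fb' bV b'V \<mu> \<nu> by (simp_all add: A.state_diff B.state_diff)
      moreover have "\<bar>\<mu> (f b - f b')\<bar> \<le> A.N (f b - f b')"
        using fb fb' by (intro A.state_le_norm[OF \<mu>(1)]) auto
      ultimately show "\<bar>\<nu> (b - b')\<bar> \<le> A.N (f b - f b') + 4 * \<epsilon>"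
        using est[OF b \<nu> \<mu>(2)] est[OF b' \<nu> \<mu>(2)] by linarith
    qed
  qed
  then show "\<exists>f. near_isometry_on R (4 * \<epsilon>) (B, LB) (A, LA) f" by blast
qed

text \<open>The image of \<open>a\<close> is within the radius of \<open>B\<close> of a multiple \<open>c\<close> of the unit, hence so is \<open>a\<close> up to \<open>\<epsilon>\<close>,
and all values of \<open>a\<close> on states lie that close to \<open>c\<close>.\<close>

lemma radius_le_if_Lip_close:
  assumes "Lip_close \<epsilon> (A, LA) (B, LB)" shows "radius A LA \<le> radius B LB + \<epsilon>"
proof -
  have "2 * radius A LA \<le> 2 * (radius B LB + \<epsilon>)"
    unfolding A.radius_le_iff
  proof (intro ballI impI)
    fix \<mu> \<nu> a assume \<mu>: "\<mu> \<in> states A" "\<nu> \<in> states A" and a: "a \<in> A.V" "LA a \<le> 1"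
    obtain f where f: "near_isometry_on (A.N a) \<epsilon> (A, LA) (B, LB) f"
      using assms unfolding Lip_close_def by blast
    have aL: "a \<in> Lip_set A LA (A.N a)" using a by (simp add: Lip_set_def)
    have fa: "f a \<in> B.V" "LB (f a) \<le> 1" using near_isometry_onD(1)[OF f aL] by (auto simp: Lip_set_def)
    obtain c where "B.N (f a - c *\<^sub>R B.e) \<le> radius B LB" using B.ex_centre[OF fa] by blast
    then have "A.N (a - c *\<^sub>R A.e) \<le> radius B LB + \<epsilon>" using near_isometry_onD(2)[OF f aL, of c] by linarith
    moreover have "\<bar>\<sigma> (a - c *\<^sub>R A.e)\<bar> \<le> A.N (a - c *\<^sub>R A.e)" if "\<sigma> \<in> states A" for \<sigma>
      using A.state_le_norm[OF that, of "a - c *\<^sub>R A.e"] a by simp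
    ultimately have "\<bar>\<sigma> a - c\<bar> \<le> radius B LB + \<epsilon>" if "\<sigma> \<in> states A" for \<sigma>
      using that a by (fastforce simp: A.state_diff A.state_unit)
    from this[OF \<mu>(1)] this[OF \<mu>(2)]
    show "\<bar>\<mu> a - \<nu> a\<bar> \<le> 2 * (radius B LB + \<epsilon>)" by (simp add: abs_le_iff)
  qed
  then show ?thesis by simp
qed

text \<open>Two elements whose images are assigned to the same point of \<open>G\<close> differ by less than \<open>3 \<epsilon>\<close>. Since the
centres of a cover have to belong to the ball, one element is chosen from each nonempty fibre.\<close>

lemma Cov_Lip_ball_le_if_Lip_close:
  assumes close: "Lip_close \<epsilon> (A, LA) (B, LB)"
    and G: "finite G" "G \<subseteq> B.V" "\<And>b. b \<in> B.V \<Longrightarrow> LB b \<le> 1 \<Longrightarrow> B.N b \<le> radius B LB + 2 * \<epsilon> \<Longrightarrow> \<exists>g\<in>G. B.N (b - g) < \<epsilon>"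
  shows "Cov (ou_dist A) (Lip_ball A LA) (3 * \<epsilon>) \<le> enat (card G)"
proof -
  obtain f where f: "near_isometry_on (radius A LA) \<epsilon> (A, LA) (B, LB) f"
    using close unfolding Lip_close_def by blast
  have ball: "Lip_ball A LA = Lip_set A LA (radius A LA)" by (simp add: Lip_ball_def Lip_set_def)
  have fV: "f a \<in> B.V" "LB (f a) \<le> 1" "B.N (f a) \<le> radius B LB + 2 * \<epsilon>" if "a \<in> Lip_ball A LA" for a
    using near_isometry_onD(1)[OF f, of a] that radius_le_if_Lip_close[OF close] unfolding ball
    by (auto simp: Lip_set_def)
  then have "\<exists>g\<in>G. B.N (f a - g) < \<epsilon>" if "a \<in> Lip_ball A LA" for a using G(3) that by blast
  then obtain h where h: "\<And>a. a \<in> Lip_ball A LA \<Longrightarrow> h a \<in> G \<and> B.N (f a - h a) < \<epsilon>" by metis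
  have hG: "h ` Lip_ball A LA \<subseteq> G" using h by blast
  obtain F where F: "finite F" "F \<subseteq> Lip_ball A LA" "card F \<le> card (h ` Lip_ball A LA)"
    "\<forall>a\<in>Lip_ball A LA. \<exists>g\<in>F. h g = h a"
    by (rule finite_image_representatives[OF finite_subset[OF hG G(1)]]) blast
  have "A.N (g - a) < 3 * \<epsilon>" if g: "g \<in> Lip_ball A LA" and a: "a \<in> Lip_ball A LA" and eq: "h g = h a" for g a
  proof -
    have hV: "h a \<in> B.V" using h[OF a] G(2) by blast
    have "B.N (f g - f a) \<le> B.N (f g - h a) + B.N (h a - f a)"
      using fV(1)[OF g] fV(1)[OF a] hV by (intro B.norm_triangle)
    moreover have "B.N (h a - f a) = B.N (f a - h a)" using fV(1)[OF a] hV by (intro B.norm_minus_commute)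
    moreover have "A.N (g - a) \<le> B.N (f g - f a) + \<epsilon>" using near_isometry_onD(3)[OF f] g a unfolding ball by blast
    ultimately show ?thesis using h[OF g] h[OF a] eq by simp
  qed
  note near = this
  have "Lip_ball A LA \<subseteq> (\<Union>x\<in>F. {y \<in> Lip_ball A LA. ou_dist A x y < ereal (3 * \<epsilon>)})"
  proof
    fix a assume a: "a \<in> Lip_ball A LA"
    obtain g where g: "g \<in> F" "h g = h a" using F(4) a by blast
    then have "A.N (g - a) < 3 * \<epsilon>" using near[OF _ a] F(2) by blast
    then show "a \<in> (\<Union>x\<in>F. {y \<in> Lip_ball A LA. ou_dist A x y < ereal (3 * \<epsilon>)})"
      using g a by (auto simp: ou_dist_def)
  qed
  then have "Cov (ou_dist A) (Lip_ball A LA) (3 * \<epsilon>) \<le> enat (card F)"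
    unfolding Cov_def using F(1,2) by (intro Inf_lower) blast
  also have "\<dots> \<le> enat (card G)" using F(3) card_mono[OF G(1) hG] by simp
  finally show ?thesis .
qed

end

context proper_qms
begin

lemma diam_Lip_ball: "metric_diam (ou_dist A) (Lip_ball A L) = ereal (2 * radius A L)"
proof (rule antisym)
  show "metric_diam (ou_dist A) (Lip_ball A L) \<le> ereal (2 * radius A L)"
    unfolding metric_diam_def ou_dist_def
  proof (intro SUP_least)
    fix a b assume "a \<in> Lip_ball A L" "b \<in> Lip_ball A L"
    then show "ereal (N (a - b)) \<le> ereal (2 * radius A L)"
      using norm_diff[of a b] by (auto simp: Lip_ball_def)
  qed
  let ?r = "radius A L"
  have "?r *\<^sub>R e \<in> Lip_ball A L" "(- ?r) *\<^sub>R e \<in> Lip_ball A L"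
    using radius_nonneg by (auto simp: Lip_ball_def simp del: scaleR_minus_left)
  moreover have "ou_dist A (?r *\<^sub>R e) ((- ?r) *\<^sub>R e) = ereal (2 * ?r)"
    using norm_unit[of "2 * ?r"] radius_nonneg by (simp add: ou_dist_def flip: scaleR_2 scaleR_scaleR)
  ultimately show "ereal (2 * ?r) \<le> metric_diam (ou_dist A) (Lip_ball A L)"
    unfolding metric_diam_def by (intro SUP_upper2[of "?r *\<^sub>R e"] SUP_upper2[of "(- ?r) *\<^sub>R e"]) auto
qed

end

section \<open>Spaces whose unit is not positive\<close>

text \<open>For an improper space the set of bounds whose infimum is the norm may be empty or unbounded below.
The infimum of a set of reals is defined through a least upper bound, a description that no real
number satisfies in either of these cases, so both have the same value.\<close>

lemma Inf_real_ray:
  assumes m: "{..m} \<subseteq> (X :: real set)" shows "Inf X = Inf {}"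
proof -
  have no_bound: "\<not> (\<forall>x\<in>uminus ` X. x \<le> z)" for z
  proof
    assume "\<forall>x\<in>uminus ` X. x \<le> z"
    moreover have "min m (- z - 1) \<in> X" using m by auto
    ultimately have "- min m (- z - 1) \<le> z" by blast
    then show False by linarith
  qed
  have no_least: "\<not> ((\<forall>x\<in>uminus ` ({} :: real set). x \<le> z) \<and> (\<forall>y. (\<forall>x\<in>uminus ` ({} :: real set). x \<le> y) \<longrightarrow> z \<le> y))"
    for z by (auto intro!: exI[of _ "z - 1"])
  have "(LEAST z. \<forall>x\<in>uminus ` X. x \<le> z) = (LEAST z. \<forall>x\<in>uminus ` ({} :: real set). x \<le> z)"
    unfolding Least_def using no_bound no_least by (intro arg_cong[of _ _ The] ext) blast
  then show ?thesis unfolding Inf_real_def Sup_real_def by simp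
qed

definition norm_bounds :: "'a::real_vector order_unit_space \<Rightarrow> 'a \<Rightarrow> real set" where
  "norm_bounds A a = {r. leq A (- (r *\<^sub>R ounit A)) a \<and> leq A a (r *\<^sub>R ounit A)}"

text \<open>The possible sets of norm bounds in an improper space, in a form that is stable under the
intersections that describe norm bounds in a direct sum.\<close>

definition ray_or_zero :: "real set \<Rightarrow> bool" where
  "ray_or_zero S \<longleftrightarrow> (\<exists>m. {..m} \<subseteq> S) \<or> S \<subseteq> {0}"

lemma Inf_ray_or_zero: assumes "ray_or_zero S" shows "Inf S = 0 \<or> Inf S = Inf {}"
proof -
  consider m where "{..m} \<subseteq> S" | "S = {}" | "S = {0}"
    using assms unfolding ray_or_zero_def by blast
  then show ?thesis using Inf_real_ray by cases auto
qed

lemma ray_or_zero_Int: "ray_or_zero S \<Longrightarrow> ray_or_zero T \<Longrightarrow> ray_or_zero (S \<inter> T)"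
  unfolding ray_or_zero_def
proof (elim disjE exE)
  fix m n assume "{..m} \<subseteq> S" "{..n} \<subseteq> T"
  then have "{..min m n} \<subseteq> S \<inter> T" by auto
  then show "(\<exists>m. {..m} \<subseteq> S \<inter> T) \<or> S \<inter> T \<subseteq> {0}" by blast
qed auto

text \<open>Here the norm takes at most two values on multiples of the unit, which leaves no room for a functional
that is bounded by the norm and maps \<open>r e\<close> to \<open>r\<close>.\<close>

lemma states_empty_if_ray_or_zero:
  assumes e: "\<And>r. r *\<^sub>R ounit A \<in> carr A" and ray_or_zero: "\<And>r. ray_or_zero (norm_bounds A (r *\<^sub>R ounit A))"
  shows "states A = {}"
proof (rule equals0I)
  fix \<mu> assume \<mu>: "\<mu> \<in> states A"
  then obtain K where K: "\<forall>a\<in>carr A. \<bar>\<mu> a\<bar> \<le> K * ou_norm A a"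
    unfolding states_def dual_space_def by blast
  define k :: real where "k = Inf {}"
  define r where "r = \<bar>K\<bar> * \<bar>k\<bar> + 1"
  have eV: "ounit A \<in> carr A" using e[of 1] by simp
  have hom: "\<forall>a\<in>carr A. \<forall>r. \<mu> (r *\<^sub>R a) = r * \<mu> a" and one: "\<mu> (ounit A) = 1"
    using \<mu> unfolding states_def dual_space_def by blast+
  have "\<mu> (r *\<^sub>R ounit A) = r" using hom eV one by simp
  moreover have "ou_norm A (r *\<^sub>R ounit A) = 0 \<or> ou_norm A (r *\<^sub>R ounit A) = k"
    using Inf_ray_or_zero[OF ray_or_zero[of r]] by (simp add: ou_norm_def norm_bounds_def k_def)
  then have "K * ou_norm A (r *\<^sub>R ounit A) \<le> \<bar>K\<bar> * \<bar>k\<bar>"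
    by (auto simp flip: abs_mult)
  ultimately have "r \<le> \<bar>K\<bar> * \<bar>k\<bar>" using K e[of r] by fastforce
  then show False by (simp add: r_def)
qed

locale improper_qms = order_unit_space +
  fixes L :: "'a \<Rightarrow> real"
  assumes unit_not_pos: "\<not> 0 \<preceq> e"
    and Lip: "is_Lip_norm A L"
begin

text \<open>Either \<open>- e\<close> is positive, and then each element is bounded by all sufficiently negative multiples of
\<open>e\<close>; or neither \<open>e\<close> nor \<open>- e\<close> is positive, and then (i) for \<open>a\<close> and \<open>- a\<close> forces \<open>a\<close> to be a multiple of
\<open>e\<close> and the order to be equality.\<close>

lemma improper_cases:
  "(\<forall>a\<in>V. \<exists>m. {..m} \<subseteq> norm_bounds A a) \<or>
   ((\<forall>a\<in>V. \<forall>b\<in>V. a \<preceq> b \<longrightarrow> a = b) \<and> (\<forall>a\<in>V. norm_bounds A a \<subseteq> {0}))"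
proof (cases "0 \<preceq> - e")
  case True
  have mono: "s *\<^sub>R e \<preceq> r *\<^sub>R e" if "r \<le> s" for r s
    using le_add_right[OF _ _ _ le_scaleR[OF _ _ _ True, of "s - r"], of "s *\<^sub>R e"] that
    by (simp add: algebra_simps)
  have "\<exists>m. {..m} \<subseteq> norm_bounds A a" if a: "a \<in> V" for a
  proof -
    obtain s t where st: "a \<preceq> s *\<^sub>R e" "- a \<preceq> t *\<^sub>R e" using unit_bound a by (meson V_closed(5))
    have "a \<preceq> r *\<^sub>R e \<and> - (r *\<^sub>R e) \<preceq> a" if "r \<le> min s t" for r
    proof -
      have "a \<preceq> r *\<^sub>R e" using le_trans[OF _ _ _ st(1) mono[of r s]] a that by simp
      moreover have "- a \<preceq> r *\<^sub>R e" using le_trans[OF _ _ _ st(2) mono[of r t]] a that by simp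
      then have "- (r *\<^sub>R e) \<preceq> a"
        using le_add_cancel[of "- (r *\<^sub>R e)" a "r *\<^sub>R e - a"] a by (simp add: algebra_simps)
      ultimately show ?thesis by blast
    qed
    then have "{..min s t} \<subseteq> norm_bounds A a" by (auto simp: norm_bounds_def)
    then show ?thesis by blast
  qed
  then show ?thesis by blast
next
  case False
  have zero: "r = 0" if r: "0 \<preceq> r *\<^sub>R e" for r
  proof (rule ccontr)
    assume "r \<noteq> 0"
    then consider "r > 0" | "r < 0" by linarith
    then show False
    proof cases
      case 1
      then show ?thesis using le_scaleR[OF _ _ _ r, of "1 / r"] unit_not_pos by simp
    next
      case 2
      then show ?thesis using le_scaleR[OF _ _ _ r, of "- (1 / r)"] False by simp
    qed
  qed
  have line: "\<exists>r. a = r *\<^sub>R e" if a: "a \<in> V" for a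
  proof -
    obtain s t where st: "a \<preceq> s *\<^sub>R e" "- a \<preceq> t *\<^sub>R e" using unit_bound a by (meson V_closed(5))
    have "a + - a \<preceq> s *\<^sub>R e + t *\<^sub>R e" using st a by (intro le_add) auto
    then have "s + t = 0" by (intro zero) (simp add: scaleR_add_left)
    then have t: "t = - s" by simp
    have "s *\<^sub>R e \<preceq> a"
      using le_add_right[OF _ _ _ st(2), of "a + s *\<^sub>R e"] a t by simp
    then have "a = s *\<^sub>R e" using st(1) le_antisym a by blast
    then show ?thesis by blast
  qed
  have eq: "a = b" if ab: "a \<in> V" "b \<in> V" "a \<preceq> b" for a b
  proof -
    obtain r s where rs: "a = r *\<^sub>R e" "b = s *\<^sub>R e" using line ab by blast
    have "0 \<preceq> (s - r) *\<^sub>R e" using le_add_right[OF ab(1,2) _ ab(3), of "- a"] ab rs by (simp add: scaleR_left_diff_distrib)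
    then show ?thesis using zero rs by fastforce
  qed
  have "norm_bounds A a \<subseteq> {0}" if a: "a \<in> V" for a
  proof
    fix r assume "r \<in> norm_bounds A a"
    then have "- (r *\<^sub>R e) = a" "a = r *\<^sub>R e" using eq a by (auto simp: norm_bounds_def)
    then have "(r + r) *\<^sub>R e = 0" by (metis add.right_inverse scaleR_left_distrib)
    then show "r \<in> {0}" using e_nz by simp
  qed
  then show ?thesis using eq by blast
qed

lemma norm_eq_Inf: "N a = Inf (norm_bounds A a)"
  by (simp add: ou_norm_def norm_bounds_def)

lemma norm_bounds_ray_or_zero: "a \<in> V \<Longrightarrow> ray_or_zero (norm_bounds A a)"
  using improper_cases by (auto simp: ray_or_zero_def)

lemma norm_cases:
  "(\<forall>a\<in>V. N a = Inf {}) \<or>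
   ((\<forall>a\<in>V. \<forall>b\<in>V. a \<preceq> b \<longrightarrow> a = b) \<and> (\<forall>a\<in>V. N a = (if a = 0 then 0 else Inf {})))"
  using improper_cases
proof
  assume "\<forall>a\<in>V. \<exists>m. {..m} \<subseteq> norm_bounds A a"
  then show ?thesis
    using Inf_real_ray unfolding norm_eq_Inf by blast
next
  assume *: "(\<forall>a\<in>V. \<forall>b\<in>V. a \<preceq> b \<longrightarrow> a = b) \<and> (\<forall>a\<in>V. norm_bounds A a \<subseteq> {0})"
  have "N a = (if a = 0 then 0 else Inf {})" if a: "a \<in> V" for a
  proof (cases "a = 0")
    case True
    then have "norm_bounds A a = {0}" using * a by (auto simp: norm_bounds_def)
    then show ?thesis using True by (simp add: norm_eq_Inf)
  next
    case False
    then have "0 \<notin> norm_bounds A a" using * a by (auto simp: norm_bounds_def)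
    moreover have "norm_bounds A a \<subseteq> {0}" using * a by blast
    ultimately have "norm_bounds A a = {}" by auto
    then show ?thesis using False by (simp add: norm_eq_Inf)
  qed
  then show ?thesis using * by blast
qed

lemma states_empty: "states A = {}"
  by (rule states_empty_if_ray_or_zero) (auto intro: norm_bounds_ray_or_zero)

lemma radius_zero: "radius A L = 0"
  by (simp add: radius_def metric_diam_def states_empty bot_ereal_def)

lemma dist_Lip_ball_nonpos:
  assumes "a \<in> Lip_ball A L" "b \<in> Lip_ball A L" shows "ou_dist A a b \<le> 0"
proof -
  have V: "a \<in> V" "b \<in> V" "a - b \<in> V" "N a \<le> 0" "N b \<le> 0"
    using assms by (auto simp: Lip_ball_def radius_zero)
  have "N (a - b) \<le> 0"
    using norm_cases
  proof
    assume "\<forall>a\<in>V. N a = Inf {}"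
    then show ?thesis using V by simp
  next
    assume "(\<forall>a\<in>V. \<forall>b\<in>V. a \<preceq> b \<longrightarrow> a = b) \<and> (\<forall>a\<in>V. N a = (if a = 0 then 0 else Inf {}))"
    then show ?thesis using V by (auto split: if_splits)
  qed
  then show ?thesis by (simp add: ou_dist_def zero_ereal_def)
qed

lemma diam_Lip_ball_nonpos: "metric_diam (ou_dist A) (Lip_ball A L) \<le> 0"
  unfolding metric_diam_def using dist_Lip_ball_nonpos by (auto simp: SUP_le_iff)

lemma Cov_Lip_ball_le_1:
  assumes "\<epsilon> > 0" shows "Cov (ou_dist A) (Lip_ball A L) \<epsilon> \<le> 1"
proof -
  obtain F where F: "finite F" "F \<subseteq> Lip_ball A L" "card F \<le> 1"
    "Lip_ball A L \<subseteq> (\<Union>x\<in>F. {y \<in> Lip_ball A L. ou_dist A x y < ereal \<epsilon>})"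
  proof (cases "Lip_ball A L = {}")
    case False
    then obtain a where a: "a \<in> Lip_ball A L" by blast
    have "ou_dist A a b < ereal \<epsilon>" if "b \<in> Lip_ball A L" for b
      using dist_Lip_ball_nonpos[OF a that] assms by (metis ereal_less(2) order_le_less_trans)
    then show thesis using a by (intro that[of "{a}"]) auto
  qed (use that[of "{}"] in auto)
  then have "Cov (ou_dist A) (Lip_ball A L) \<epsilon> \<le> enat (card F)"
    unfolding Cov_def by (intro Inf_lower) blast
  also have "\<dots> \<le> 1" using F(3) by (simp add: one_enat_def)
  finally show ?thesis .
qed

text \<open>The norm takes at most the values \<open>0\<close> and \<open>k = Inf {}\<close>. For \<open>k = 0\<close> the completion has a single point.
Otherwise a class has members only if null sequences exist; then the order is equality, null sequences
vanish eventually, and comparable classes share a representative.\<close>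

lemma compl_leq_imp_eq:
  assumes X: "X \<in> completion A" and Y: "Y \<in> completion A" and le: "compl_leq A X Y"
  shows "X = Y"
proof -
  define k :: real where "k = Inf {}"
  obtain x y where xy: "x \<in> X" "y \<in> Y" "\<And>n. x n \<preceq> y n" using le by (auto simp: compl_leq_def)
  obtain u v where uv: "u \<in> cauchy_seqs A" "X = null_rel A `` {u}" "v \<in> cauchy_seqs A" "Y = null_rel A `` {v}"
    using X Y by (auto simp: completion_def quotient_def)
  have ux: "(u, x) \<in> null_rel A" and vy: "(v, y) \<in> null_rel A" using xy uv by auto
  have cV: "z n \<in> V" if "z \<in> cauchy_seqs A" for z n using that by (simp add: cauchy_seqs_def)
  have V: "u n \<in> V" "v n \<in> V" "x n \<in> V" "y n \<in> V" for n
    using ux vy uv cV by (auto simp: null_rel_def)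
  have lim: "(\<lambda>n. N (u n - x n)) \<longlonglongrightarrow> 0" "(\<lambda>n. N (v n - y n)) \<longlonglongrightarrow> 0"
    using ux vy by (auto simp: null_rel_def)
  show ?thesis
  proof (cases "k = 0")
    case True
    then have "N a = 0" if "a \<in> V" for a using norm_cases that unfolding k_def by force
    then have "(z, w) \<in> null_rel A" if "z \<in> cauchy_seqs A" "w \<in> cauchy_seqs A" for z w
      using that cV by (simp add: null_rel_def)
    then have "null_rel A = cauchy_seqs A \<times> cauchy_seqs A" by (auto simp: null_rel_def)
    then show ?thesis using uv by (simp add: Image_singleton)
  next
    case k: False
    have "\<not> (\<forall>a\<in>V. N a = k)"
    proof
      assume "\<forall>a\<in>V. N a = k"
      then have "(\<lambda>n::nat. k) \<longlonglongrightarrow> 0" using lim(1) V by simp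
      then show False using k by (simp add: LIMSEQ_const_iff)
    qed
    then have eq: "\<And>a b. a \<in> V \<Longrightarrow> b \<in> V \<Longrightarrow> a \<preceq> b \<Longrightarrow> a = b"
      and Nk: "\<And>a. a \<in> V \<Longrightarrow> N a = (if a = 0 then 0 else k)"
      using norm_cases unfolding k_def by blast+
    have ev: "\<forall>\<^sub>F n in sequentially. z n = w n"
      if "\<And>n. z n \<in> V" "\<And>n. w n \<in> V" "(\<lambda>n. N (z n - w n)) \<longlonglongrightarrow> 0" for z w
    proof -
      have "\<forall>\<^sub>F n in sequentially. \<bar>N (z n - w n)\<bar> < \<bar>k\<bar>"
        using tendsto_rabs_zero[OF that(3)] k by (intro order_tendstoD(2)) auto
      then show ?thesis by eventually_elim (use Nk that(1,2) in \<open>auto split: if_splits\<close>)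
    qed
    have "x n = y n" for n by (rule eq[OF V(3,4) xy(3)])
    then have uv_eq: "\<forall>\<^sub>F n in sequentially. u n = v n"
      using ev[OF V(1,3) lim(1)] ev[OF V(2,4) lim(2)] by (auto elim: eventually_elim2)
    have "(\<lambda>n. N (u n - z n)) \<longlonglongrightarrow> 0 \<longleftrightarrow> (\<lambda>n. N (v n - z n)) \<longlonglongrightarrow> 0" for z
      using uv_eq by (intro tendsto_cong) (auto elim: eventually_mono)
    then show ?thesis using uv by (auto simp: null_rel_def)
  qed
qed

end

text \<open>Without states every seminorm that vanishes exactly on multiples of the unit is a Lip-norm, and the
Hausdorff distance of two empty sets is \<open>-\<infinity>\<close>. It remains to exhibit one admissible seminorm, which is
glued along linear functionals \<open>g\<close> and \<open>h\<close> that map the units to \<open>1\<close>.\<close>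

lemma dist_q_improper:
  assumes P: "improper_qms A LA" and Q: "improper_qms B LB"
  shows "dist_q (A, LA) (B, LB) = - \<infinity>"
proof -
  interpret A: improper_qms A LA by fact
  interpret B: improper_qms B LB by fact
  obtain g h where g: "linear g" "g A.e = (1::real)" and h: "linear h" "h B.e = (1::real)"
    using linear_independent_extend[of "{A.e}" "\<lambda>_. 1::real"]
      linear_independent_extend[of "{B.e}" "\<lambda>_. 1::real"] A.e_nz B.e_nz
    by (auto simp: dependent_single)
  define \<beta> where "\<beta> p = \<bar>g (fst p) - h (snd p)\<bar>" for p
  note lin = linear_add[OF g(1)] linear_add[OF h(1)] linear_scale[OF g(1)] linear_scale[OF h(1)]
  have \<beta>: "is_seminorm (direct_sum A B) \<beta>"
    unfolding is_seminorm_def \<beta>_def by (auto simp: lin right_diff_distrib simp flip: abs_mult)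
  have \<beta>_unit: "\<beta> (r *\<^sub>R A.e, s *\<^sub>R B.e) = 0 \<longleftrightarrow> r = s" for r s
    by (simp add: \<beta>_def lin g h)
  have LA: "is_seminorm A LA" "\<forall>a\<in>A.V. LA a = 0 \<longleftrightarrow> (\<exists>r. a = r *\<^sub>R A.e)"
    and LB: "is_seminorm B LB" "\<forall>b\<in>B.V. LB b = 0 \<longleftrightarrow> (\<exists>r. b = r *\<^sub>R B.e)"
    using A.Lip B.Lip by (auto simp: is_Lip_norm_def)
  have unit0: "LA (r *\<^sub>R A.e) = 0" "LB (r *\<^sub>R B.e) = 0" for r
    using LA(2)[rule_format, of "r *\<^sub>R A.e"] LB(2)[rule_format, of "r *\<^sub>R B.e"] by auto
  have liftA: "\<exists>b\<in>B.V. LB b \<le> LA a \<and> \<beta> (a, b) \<le> LA a" if a: "a \<in> A.V" for a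
  proof (intro bexI conjI)
    have "LB (g a *\<^sub>R B.e) = 0" "0 \<le> LA a" using unit0 LA(1) a by (simp_all add: is_seminorm_def)
    then show "LB (g a *\<^sub>R B.e) \<le> LA a" "\<beta> (a, g a *\<^sub>R B.e) \<le> LA a"
      by (auto simp: \<beta>_def lin h)
  qed auto
  have liftB: "\<exists>a\<in>A.V. LA a \<le> LB b \<and> \<beta> (a, b) \<le> LB b" if b: "b \<in> B.V" for b
  proof (intro bexI conjI)
    have "LA (h b *\<^sub>R A.e) = 0" "0 \<le> LB b" using unit0 LB(1) b by (simp_all add: is_seminorm_def)
    then show "LA (h b *\<^sub>R A.e) \<le> LB b" "\<beta> (h b *\<^sub>R A.e, b) \<le> LB b"
      by (auto simp: \<beta>_def lin g)
  qed auto
  note L = sup_seminorm[OF A.V_closed(2) B.V_closed(2) LA LB \<beta> \<beta>_unit liftA liftB]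
  have "norm_bounds (direct_sum A B) (r *\<^sub>R ounit (direct_sum A B)) =
      norm_bounds A (r *\<^sub>R A.e) \<inter> norm_bounds B (r *\<^sub>R B.e)" for r
    by (auto simp: norm_bounds_def)
  then have "states (direct_sum A B) = {}"
    by (intro states_empty_if_ray_or_zero) (auto intro: ray_or_zero_Int A.norm_bounds_ray_or_zero B.norm_bounds_ray_or_zero)
  then have "is_Lip_norm (direct_sum A B) (sup_seminorm LA LB \<beta>)"
    using L(1,2) by (auto simp: is_Lip_norm_def)
  then have adm: "admissible A LA B LB (sup_seminorm LA LB \<beta>)" using L(3) by blast
  have "hausdorff_dist \<rho> (states_left A B) (states_right A B) = - \<infinity>" for \<rho>
    by (simp add: hausdorff_dist_def states_left_def states_right_def A.states_empty B.states_empty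
        bot_ereal_def)
  then have "dist_q (A, LA) (B, LB) \<le> - \<infinity>"
    unfolding dist_q_def prod.case using adm by (intro INF_lower2[of "sup_seminorm LA LB \<beta>"]) auto
  then show ?thesis by simp
qed

lemma dist_q_improper_proper:
  assumes P: "improper_qms A LA" and Q: "proper_qms B LB"
  shows "dist_q (A, LA) (B, LB) = \<infinity>"
proof -
  interpret A: improper_qms A LA by fact
  interpret B: proper_qms B LB by fact
  have "states_left A B = {}" "states_right A B \<noteq> {}"
    using A.states_empty B.states_nonempty by (auto simp: states_left_def states_right_def)
  then have "hausdorff_dist \<rho> (states_left A B) (states_right A B) = \<infinity>" for \<rho>
    by (simp add: hausdorff_dist_def top_ereal_def)
  then have "\<infinity> \<le> dist_q (A, LA) (B, LB)"
    unfolding dist_q_def prod.case by (intro INF_greatest) simp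
  then show ?thesis by simp
qed

lemma quantum_metric_space_cases:
  assumes "(A, L) \<in> compact_quantum_metric_spaces"
  shows "proper_qms A L \<or> improper_qms A L"
proof -
  have "order_unit_space A" "is_Lip_norm A L"
    using assms by (auto simp: compact_quantum_metric_spaces_def order_unit_space_def)
  then show ?thesis
    unfolding proper_qms_def proper_qms_axioms_def
      proper_order_unit_space_def proper_order_unit_space_axioms_def
      improper_qms_def improper_qms_axioms_def by blast
qed

lemma not_isometric_proper_improper:
  assumes P: "proper_qms A LA" and Q: "improper_qms B LB"
  shows "\<not> isometric (A, LA) (B, LB)" "\<not> isometric (B, LB) (A, LA)"
proof -
  interpret A: proper_qms A LA by fact
  interpret B: improper_qms B LB by fact
  obtain X Y where XY: "X \<in> closure_carr A LA" "Y \<in> closure_carr A LA" "compl_leq A X Y" "X \<noteq> Y"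
    using A.ex_distinct_compl_leq by blast
  have B_eq: "X' = Y'" if "X' \<in> closure_carr B LB" "Y' \<in> closure_carr B LB" "compl_leq B X' Y'" for X' Y'
    using that by (intro B.compl_leq_imp_eq) (simp_all add: closure_carr_def)
  show "\<not> isometric (A, LA) (B, LB)"
  proof
    assume "isometric (A, LA) (B, LB)"
    then obtain \<phi> where bij: "bij_betw \<phi> (closure_carr A LA) (closure_carr B LB)"
      and leq: "\<forall>X\<in>closure_carr A LA. \<forall>Y\<in>closure_carr A LA. compl_leq A X Y \<longleftrightarrow> compl_leq B (\<phi> X) (\<phi> Y)"
      unfolding isometric_def prod.case by (elim exE conjE) (rule that)
    have "\<phi> X = \<phi> Y" using B_eq[OF bij_betwE[OF bij, rule_format, OF XY(1)] bij_betwE[OF bij, rule_format, OF XY(2)]]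
      leq XY by simp
    then show False using inj_onD[OF bij_betw_imp_inj_on[OF bij] _ XY(1,2)] XY(4) by simp
  qed
  show "\<not> isometric (B, LB) (A, LA)"
  proof
    assume "isometric (B, LB) (A, LA)"
    then obtain \<phi> where bij: "bij_betw \<phi> (closure_carr B LB) (closure_carr A LA)"
      and leq: "\<forall>X\<in>closure_carr B LB. \<forall>Y\<in>closure_carr B LB. compl_leq B X Y \<longleftrightarrow> compl_leq A (\<phi> X) (\<phi> Y)"
      unfolding isometric_def prod.case by (elim exE conjE) (rule that)
    have "X \<in> \<phi> ` closure_carr B LB" "Y \<in> \<phi> ` closure_carr B LB"
      using XY bij_betw_imp_surj_on[OF bij] by simp_all
    then obtain X' Y' where X': "X' \<in> closure_carr B LB" "X = \<phi> X'" and Y': "Y' \<in> closure_carr B LB" "Y = \<phi> Y'"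
      by (elim imageE) (rule that)
    then have "compl_leq B X' Y'" using leq XY(3) by simp
    then have "X' = Y'" using B_eq X' Y' by blast
    then show False using X' Y' XY(4) by simp
  qed
qed

section \<open>Isometry classes\<close>

lemma CQM_isometric:
  fixes X :: "'a::real_vector qms set"
  assumes X: "X \<in> CQM"
  obtains P :: "'a qms" where "P \<in> compact_quantum_metric_spaces"
    "X = {Q \<in> compact_quantum_metric_spaces. isometric P Q}"
proof -
  obtain P :: "'a qms" where P: "X = {(P, Q). P \<in> compact_quantum_metric_spaces \<and>
       Q \<in> compact_quantum_metric_spaces \<and> isometric P Q} `` {P}"
    "P \<in> compact_quantum_metric_spaces"
    using X unfolding CQM_def by (rule quotientE) (rule that)
  have "X = {Q \<in> compact_quantum_metric_spaces. isometric P Q}"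
    unfolding P(1) using P(2) by (simp add: Image_singleton)
  then show thesis by (rule that[OF P(2)])
qed

lemma isometric_refl: "isometric P P"
  unfolding isometric_def by (auto simp: split_beta intro!: exI[of _ id])

lemma CQM_nonempty: fixes X :: "'a::real_vector qms set" assumes X: "X \<in> CQM" shows "X \<noteq> {}"
proof -
  obtain P :: "'a qms" where P: "P \<in> compact_quantum_metric_spaces"
    "X = {Q \<in> compact_quantum_metric_spaces. isometric P Q}"
    using CQM_isometric[OF X] .
  then have "P \<in> X" using isometric_refl by simp
  then show ?thesis by auto
qed

lemma CQM_subset: assumes "X \<in> CQM" "P \<in> X" shows "P \<in> compact_quantum_metric_spaces"
  using CQM_isometric[OF assms(1)] assms(2) by (metis (lifting) mem_Collect_eq)

text \<open>Both spaces are compared with the space that generates the class, which avoids composing and inverting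
isometries.\<close>

lemma CQM_members_close:
  fixes X :: "'a::real_vector qms set"
  assumes X: "X \<in> CQM" and P: "(A, LA) \<in> X" and Q: "(B, LB) \<in> X"
    and A: "proper_qms A LA" and \<epsilon>: "\<epsilon> > 0"
  shows "proper_qms B LB" "Lip_close \<epsilon> (A, LA) (B, LB)"
proof -
  obtain R :: "'a qms" where R: "R \<in> compact_quantum_metric_spaces"
    "X = {Q \<in> compact_quantum_metric_spaces. isometric R Q}"
    using CQM_isometric[OF X] .
  obtain C :: "'a order_unit_space" and LC where CLC: "R = (C, LC)" by (metis surj_pair)
  then have C: "(C, LC) \<in> compact_quantum_metric_spaces" using R by simp
  have iso: "isometric (C, LC) Q" if "Q \<in> X" for Q using that R(2) CLC by simp
  have "\<not> improper_qms C LC"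
    using not_isometric_proper_improper(2)[OF A, of C LC] iso[OF P] by blast
  then have C': "proper_qms C LC" using quantum_metric_space_cases[OF C] by blast
  have "\<not> improper_qms B LB"
    using not_isometric_proper_improper(1)[OF C', of B LB] iso[OF Q] by blast
  then show B: "proper_qms B LB"
    using quantum_metric_space_cases CQM_subset[OF X Q] by blast
  have "Lip_close (\<epsilon> / 2) (A, LA) (C, LC)" "Lip_close (\<epsilon> / 2) (C, LC) (B, LB)"
    using Lip_close_if_isometric(2)[OF C' A iso[OF P], of "\<epsilon> / 2"]
      Lip_close_if_isometric(1)[OF C' B iso[OF Q], of "\<epsilon> / 2"] \<epsilon> by simp_all
  then show "Lip_close \<epsilon> (A, LA) (B, LB)" using Lip_close_trans by fastforce
qed

definition proper :: "'a::real_vector qms \<Rightarrow> bool" where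
  "proper P \<longleftrightarrow> proper_qms (fst P) (snd P)"

definition rep :: "'a::real_vector qms set \<Rightarrow> 'a qms" where
  "rep X = (SOME P. P \<in> X)"

lemma rep_in: "X \<in> CQM \<Longrightarrow> rep X \<in> X"
  unfolding rep_def using CQM_nonempty some_in_eq by blast

section \<open>Total boundedness of families of isometry classes\<close>

lemma totally_bounded_imp_finite_Lip_net:
  fixes S :: "'a::real_vector qms set set"
  assumes S: "S \<subseteq> CQM" and tb: "totally_bounded_wrt CQM_dist S" and \<epsilon>: "\<epsilon> > 0"
  obtains F :: "'a qms set" where "finite F" "\<forall>Q\<in>F. proper Q"
    "\<forall>X\<in>S. \<forall>P\<in>X. proper P \<longrightarrow> (\<exists>Q\<in>F. Lip_close \<epsilon> P Q)"
proof -
  \<comment> \<open>One half of \<open>\<epsilon>\<close> is spent on the passage to the chosen representative of \<open>X\<close>, and the other half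
     on the distance, where the distortion is four times \<open>\<delta>\<close>.\<close>
  define \<delta> where "\<delta> = \<epsilon> / 8"
  have \<delta>: "\<delta> > 0" "\<epsilon> = 4 * \<delta> + 4 * \<delta>" using \<epsilon> by (auto simp: \<delta>_def)
  obtain G where G: "finite G" "G \<subseteq> S" "S \<subseteq> (\<Union>X\<in>G. {Y. CQM_dist X Y < ereal \<delta>})"
    using tb[unfolded totally_bounded_wrt_def, rule_format, OF \<delta>(1)] by (elim exE conjE) (rule that)
  define F where "F = {P \<in> rep ` G. proper P}"
  show thesis
  proof (rule that[of F])
    show "finite F" using G(1) by (simp add: F_def)
    show "\<forall>Q\<in>F. proper Q" by (simp add: F_def)
    show "\<forall>X\<in>S. \<forall>P\<in>X. proper P \<longrightarrow> (\<exists>Q\<in>F. Lip_close \<epsilon> P Q)"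
    proof (intro ballI impI)
      fix X P assume X: "X \<in> S" and P: "P \<in> X" "proper P"
      obtain A LA where AP: "P = (A, LA)" by (metis surj_pair)
      then have A: "(A, LA) \<in> X" "proper_qms A LA" using P by (simp_all add: proper_def)
      have XC: "X \<in> CQM" using S X by blast
      obtain Y where Y: "Y \<in> G" "CQM_dist Y X < ereal \<delta>" using G(3) X by blast
      then have YC: "Y \<in> CQM" using G(2) S by blast
      obtain B LB where B: "rep X = (B, LB)" by (metis surj_pair)
      obtain C LC where C: "rep Y = (C, LC)" by (metis surj_pair)
      have close: "Lip_close (4 * \<delta>) (A, LA) (B, LB)" and propB: "proper_qms B LB"
        using CQM_members_close[OF XC A(1) _ A(2), of B LB "4 * \<delta>"] rep_in[OF XC] B \<delta>(1) by simp_all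
      have d: "dist_q (C, LC) (B, LB) < ereal \<delta>"
        using Y(2) B C by (simp add: CQM_dist_def rep_def)
      then have "\<not> improper_qms C LC" using dist_q_improper_proper[OF _ propB] by force
      then have propC: "proper_qms C LC"
        using quantum_metric_space_cases CQM_subset[OF YC] rep_in[OF YC] C by metis
      interpret proper_qms_pair C LC B LB
        using propB propC by (rule proper_qms_pair.intro[rotated])
      have "Lip_close \<epsilon> (A, LA) (C, LC)"
        using Lip_close_trans[OF close Lip_close_if_dist_q_less[OF d \<delta>(1)]] \<delta>(2) by simp
      moreover have "(C, LC) \<in> F" unfolding F_def using Y(1) C propC by (force simp: proper_def)
      ultimately show "\<exists>Q\<in>F. Lip_close \<epsilon> P Q" unfolding AP by blast
    qed
  qed
qed

lemma diam_bounded_if_totally_bounded: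
  fixes S :: "'a::real_vector qms set set"
  assumes S: "S \<subseteq> CQM" and tb: "totally_bounded_wrt CQM_dist S"
  shows "\<exists>D'::real. \<forall>X\<in>S. \<forall>(A, L)\<in>X. metric_diam (ou_dist A) (Lip_ball A L) \<le> ereal D'"
proof -
  obtain F :: "'a qms set" where F: "finite F" "\<forall>Q\<in>F. proper Q"
    "\<forall>X\<in>S. \<forall>P\<in>X. proper P \<longrightarrow> (\<exists>Q\<in>F. Lip_close 1 P Q)"
    by (rule totally_bounded_imp_finite_Lip_net[OF S tb zero_less_one])
  define r where "r = Max (insert 0 ((\<lambda>P. radius (fst P) (snd P)) ` F))"
  have r: "0 \<le> r" "\<And>P. P \<in> F \<Longrightarrow> radius (fst P) (snd P) \<le> r"
    using F(1) by (simp_all add: r_def)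
  have "metric_diam (ou_dist A) (Lip_ball A L) \<le> ereal (2 * (r + 1))" if X: "X \<in> S" and A: "(A, L) \<in> X" for X A L
  proof (cases "proper_qms A L")
    case True
    obtain B LB where B: "(B, LB) \<in> F" "Lip_close 1 (A, L) (B, LB)"
      using F(3) X A True unfolding proper_def by (metis fst_conv snd_conv surj_pair)
    have propB: "proper_qms B LB" using F(2) B(1) by (auto simp: proper_def)
    interpret proper_qms_pair A L B LB
      using True propB by (rule proper_qms_pair.intro)
    show ?thesis using radius_le_if_Lip_close[OF B(2)] r(2)[OF B(1)] by (simp add: A.diam_Lip_ball)
  next
    case False
    then interpret improper_qms A L
      using quantum_metric_space_cases CQM_subset S X A by blast
    have "metric_diam (ou_dist A) (Lip_ball A L) \<le> 0" by (rule diam_Lip_ball_nonpos)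
    also have "0 \<le> ereal (2 * (r + 1))" using r(1) by simp
    finally show ?thesis .
  qed
  then show ?thesis by blast
qed

lemma Cov_bounded_if_totally_bounded:
  fixes S :: "'a::real_vector qms set set"
  assumes S: "S \<subseteq> CQM" and tb: "totally_bounded_wrt CQM_dist S" and \<epsilon>: "\<epsilon> > 0"
  shows "\<exists>K::real. K > 0 \<and>
    (\<forall>X\<in>S. \<forall>(A, L)\<in>X. ereal_of_enat (Cov (ou_dist A) (Lip_ball A L) \<epsilon>) \<le> ereal K)"
proof -
  define \<delta> where "\<delta> = \<epsilon> / 3"
  have \<delta>: "\<delta> > 0" "\<epsilon> = 3 * \<delta>" using \<epsilon> by (auto simp: \<delta>_def)
  obtain F :: "'a qms set" where F: "finite F" "\<forall>Q\<in>F. proper Q"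
    "\<forall>X\<in>S. \<forall>P\<in>X. proper P \<longrightarrow> (\<exists>Q\<in>F. Lip_close \<delta> P Q)"
    by (rule totally_bounded_imp_finite_Lip_net[OF S tb \<delta>(1)])
  define net where "net P G \<longleftrightarrow> finite G \<and> G \<subseteq> carr (fst P) \<and>
      (\<forall>b\<in>carr (fst P). snd P b \<le> 1 \<longrightarrow> ou_norm (fst P) b \<le> radius (fst P) (snd P) + 2 * \<delta> \<longrightarrow>
        (\<exists>g\<in>G. ou_norm (fst P) (b - g) < \<delta>))" for P :: "'a qms" and G
  have "\<exists>G. net P G" if P: "P \<in> F" for P
  proof -
    obtain B LB where B: "P = (B, LB)" by (metis surj_pair)
    interpret proper_qms B LB using F(2) P B by (auto simp: proper_def)
    obtain G where "finite G" "G \<subseteq> V" "\<forall>b\<in>V. LB b \<le> 1 \<longrightarrow> N b \<le> radius B LB + 2 * \<delta> \<longrightarrow> (\<exists>g\<in>G. N (b - g) < \<delta>)"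
      by (rule totally_bounded_Lip_set[OF \<delta>(1), of "radius B LB + 2 * \<delta>"]) blast
    then show ?thesis unfolding net_def B fst_conv snd_conv by blast
  qed
  then obtain G where G: "\<And>P. P \<in> F \<Longrightarrow> net P (G P)" by metis
  define K where "K = Max (insert 1 ((\<lambda>P. card (G P)) ` F))"
  have K: "1 \<le> K" "\<And>P. P \<in> F \<Longrightarrow> card (G P) \<le> K" using F(1) by (simp_all add: K_def)
  have "Cov (ou_dist A) (Lip_ball A L) \<epsilon> \<le> enat K" if X: "X \<in> S" and A: "(A, L) \<in> X" for X A L
  proof (cases "proper_qms A L")
    case True
    obtain B LB where B: "(B, LB) \<in> F" "Lip_close \<delta> (A, L) (B, LB)"
      using F(3) X A True unfolding proper_def by (metis fst_conv snd_conv surj_pair)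
    have propB: "proper_qms B LB" using F(2) B(1) by (auto simp: proper_def)
    interpret proper_qms_pair A L B LB
      using True propB by (rule proper_qms_pair.intro)
    have "Cov (ou_dist A) (Lip_ball A L) (3 * \<delta>) \<le> enat (card (G (B, LB)))"
      using G[OF B(1)] by (intro Cov_Lip_ball_le_if_Lip_close[OF B(2)]) (simp_all add: net_def)
    also have "\<dots> \<le> enat K" using K(2)[OF B(1)] by simp
    finally show ?thesis using \<delta>(2) by simp
  next
    case False
    then interpret improper_qms A L
      using quantum_metric_space_cases CQM_subset S X A by blast
    have "Cov (ou_dist A) (Lip_ball A L) \<epsilon> \<le> 1" by (rule Cov_Lip_ball_le_1[OF \<epsilon>])
    also have "1 \<le> enat K" using K(1) by (simp add: one_enat_def)
    finally show ?thesis .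
  qed
  then have "ereal_of_enat (Cov (ou_dist A) (Lip_ball A L) \<epsilon>) \<le> ereal (real K)"
    if "X \<in> S" "(A, L) \<in> X" for X A L
    using that by (metis ereal_of_enat_le_iff ereal_of_enat_simps(1))
  then show ?thesis using K(1) by (intro exI[of _ "real K"]) auto
qed

lemma finite_set_enumeration:
  assumes "finite F" "F \<noteq> {}" "card F \<le> n" obtains x :: "nat \<Rightarrow> 'a" where "F = x ` {..<n}"
proof -
  obtain h where h: "bij_betw h {0..<card F} F" using ex_bij_betw_nat_finite[OF assms(1)] by blast
  obtain c where c: "c \<in> F" using assms(2) by blast
  define x where "x i = (if i < card F then h i else c)" for i
  have "x ` {..<n} \<subseteq> F" using bij_betwE[OF h] c by (auto simp: x_def)
  moreover have "F \<subseteq> x ` {..<n}"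
  proof
    fix y assume "y \<in> F"
    then obtain i where "i < card F" "y = h i" using bij_betw_imp_surj_on[OF h] by fastforce
    then show "y \<in> x ` {..<n}" using assms(3) by (intro image_eqI[of _ _ i]) (auto simp: x_def)
  qed
  ultimately show thesis using that by blast
qed

lemma finite_cover_if_Cov_le:
  assumes "Cov d X \<epsilon> \<le> enat n" "X \<noteq> {}"
  obtains x :: "nat \<Rightarrow> 'a" where "\<And>i. i < n \<Longrightarrow> x i \<in> X" "\<And>y. y \<in> X \<Longrightarrow> \<exists>i<n. d (x i) y < ereal \<epsilon>"
proof -
  define C where "C = {enat (card F) |F. finite F \<and> F \<subseteq> X \<and> X \<subseteq> (\<Union>x\<in>F. {y\<in>X. d x y < ereal \<epsilon>})}"
  have le: "Inf C \<le> enat n" using assms(1) by (simp add: Cov_def C_def)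
  then have "C \<noteq> {}" by (auto simp: Inf_enat_def)
  then obtain k where "k \<in> C" by blast
  then have "Inf C \<in> C" by (rule wellorder_InfI)
  then obtain m where "m \<in> C" and m: "m = Inf C" by blast
  from \<open>m \<in> C\<close>[unfolded C_def mem_Collect_eq]
  obtain F where F: "m = enat (card F)" "finite F" "F \<subseteq> X"
    "X \<subseteq> (\<Union>x\<in>F. {y\<in>X. d x y < ereal \<epsilon>})"
    by (elim exE conjE) (rule that)
  have "card F \<le> n" using F(1) m le by simp
  moreover have "F \<noteq> {}" using F(4) assms(2) by blast
  ultimately obtain x where x: "F = x ` {..<n}" using finite_set_enumeration[OF F(2)] by metis
  show thesis
  proof (rule that[of x])
    show "x i \<in> X" if "i < n" for i using F(3) x that by blast
    show "\<exists>i<n. d (x i) y < ereal \<epsilon>" if "y \<in> X" for y using F(4) that unfolding x by blast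
  qed
qed

text \<open>The combinatorial invariant of a space with a chosen net \<open>x\<close>: one integer tuple for each state.\<close>

definition rounded_values :: "'a::real_vector order_unit_space \<Rightarrow> real \<Rightarrow> nat \<Rightarrow> (nat \<Rightarrow> 'a) \<Rightarrow> (nat \<Rightarrow> int) set" where
  "rounded_values A \<epsilon> n x = (\<lambda>\<mu>. restrict (\<lambda>i. \<lfloor>\<mu> (x i) / \<epsilon>\<rfloor>) {..<n}) ` states A"

lemma rounded_values_eq_close:
  assumes eq: "rounded_values A \<epsilon> n x = rounded_values B \<epsilon> n y" and \<epsilon>: "\<epsilon> > 0" and \<mu>: "\<mu> \<in> states A"
  shows "\<exists>\<nu>\<in>states B. \<forall>i<n. \<bar>\<mu> (x i) - \<nu> (y i)\<bar> \<le> \<epsilon>"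
proof -
  have "restrict (\<lambda>i. \<lfloor>\<mu> (x i) / \<epsilon>\<rfloor>) {..<n} \<in> rounded_values A \<epsilon> n x"
    unfolding rounded_values_def using \<mu> by (rule imageI)
  then obtain \<nu> where \<nu>: "\<nu> \<in> states B"
    "restrict (\<lambda>i. \<lfloor>\<mu> (x i) / \<epsilon>\<rfloor>) {..<n} = restrict (\<lambda>i. \<lfloor>\<nu> (y i) / \<epsilon>\<rfloor>) {..<n}"
    unfolding eq unfolding rounded_values_def by blast
  have "\<bar>\<mu> (x i) - \<nu> (y i)\<bar> \<le> \<epsilon>" if "i < n" for i
    using fun_cong[OF \<nu>(2), of i] that floor_eq_imp_close[of "\<mu> (x i)" \<epsilon> "\<nu> (y i)"] \<epsilon> by simp
  then show ?thesis using \<nu>(1) by blast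
qed

text \<open>The datum of a class is the invariant of its representative, or \<open>None\<close> if that is improper. Finitely
many data occur, and classes with the same datum are closer than \<open>\<epsilon>\<close>.\<close>

lemma totally_bounded_if_diam_Cov_bounded:
  fixes S :: "'a::real_vector qms set set"
  assumes S: "S \<subseteq> CQM"
    and D: "\<And>X A L. X \<in> S \<Longrightarrow> (A, L) \<in> X \<Longrightarrow> metric_diam (ou_dist A) (Lip_ball A L) \<le> ereal D"
    and K: "\<And>\<epsilon>::real. \<epsilon> > 0 \<Longrightarrow> \<exists>K. \<forall>X A L. X \<in> S \<longrightarrow> (A, L) \<in> X \<longrightarrow>
        ereal_of_enat (Cov (ou_dist A) (Lip_ball A L) \<epsilon>) \<le> ereal K"
  shows "totally_bounded_wrt CQM_dist S"
  unfolding totally_bounded_wrt_def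
proof (intro allI impI)
  fix \<epsilon> :: real assume \<epsilon>: "\<epsilon> > 0"
  define \<delta> where "\<delta> = \<epsilon> / 3"
  have \<delta>: "\<delta> > 0" "2 * \<delta> < \<epsilon>" using \<epsilon> by (auto simp: \<delta>_def)
  obtain k where k: "\<And>X A L. X \<in> S \<Longrightarrow> (A, L) \<in> X \<Longrightarrow>
      ereal_of_enat (Cov (ou_dist A) (Lip_ball A L) \<delta>) \<le> ereal k"
    using K[OF \<delta>(1)] by blast
  define n where "n = nat \<lceil>k\<rceil>"
  define net where "net P x \<longleftrightarrow> (\<forall>i<n. x i \<in> Lip_ball (fst P) (snd P)) \<and>
      (\<forall>a\<in>Lip_ball (fst P) (snd P). \<exists>i<n. ou_norm (fst P) (x i - a) \<le> \<delta>)"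
    for P :: "'a qms" and x :: "nat \<Rightarrow> 'a"
  have "\<exists>x. net (rep X) x" if X: "X \<in> S" and pX: "proper (rep X)" for X
  proof -
    obtain A L where A: "rep X = (A, L)" by (metis surj_pair)
    interpret proper_qms A L using pX A by (simp add: proper_def)
    have "ereal_of_enat (Cov (ou_dist A) (Lip_ball A L) \<delta>) \<le> ereal k"
      using k[OF X] rep_in A X S by (metis subsetD)
    also have "\<dots> \<le> ereal_of_enat (enat n)" by (simp add: n_def real_nat_ceiling_ge)
    finally have "Cov (ou_dist A) (Lip_ball A L) \<delta> \<le> enat n" by (simp only: ereal_of_enat_le_iff)
    moreover have "Lip_ball A L \<noteq> {}"
      using radius_nonneg by (auto simp: Lip_ball_def intro!: exI[of _ 0])
    ultimately obtain x where "\<forall>i<n. x i \<in> Lip_ball A L" "\<forall>a\<in>Lip_ball A L. \<exists>i<n. ou_dist A (x i) a < ereal \<delta>"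
      by (rule finite_cover_if_Cov_le) blast
    then show ?thesis unfolding net_def A fst_conv snd_conv ou_dist_def by (auto intro!: exI[of _ x] less_imp_le)
  qed
  then obtain x where x: "\<And>X. X \<in> S \<Longrightarrow> proper (rep X) \<Longrightarrow> net (rep X) (x X)" by metis
  define datum where "datum X =
      (if proper (rep X) then Some (rounded_values (fst (rep X)) \<delta> n (x X)) else None)" for X
  let ?B = "PiE {..<n} (\<lambda>_. {- \<lceil>D / \<delta>\<rceil> - 1..\<lceil>D / \<delta>\<rceil>})"
  have "datum X \<in> insert None (Some ` Pow ?B)" if X: "X \<in> S" for X
  proof (cases "proper (rep X)")
    case True
    obtain A L where A: "rep X = (A, L)" by (metis surj_pair)
    interpret proper_qms A L using True A by (simp add: proper_def)
    have "ereal (2 * radius A L) \<le> ereal D"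
      using D[OF X] rep_in A X S diam_Lip_ball by (metis subsetD)
    then have r: "radius A L \<le> D" using radius_nonneg by simp
    have "rounded_values A \<delta> n (x X) \<subseteq> ?B"
      unfolding rounded_values_def
    proof (intro image_subsetI)
      fix \<mu> assume \<mu>: "\<mu> \<in> states A"
      have "\<bar>\<mu> (x X i)\<bar> \<le> D" if i: "i < n" for i
      proof -
        have "x X i \<in> Lip_ball A L" using x[OF X True] i A by (simp add: net_def)
        then show ?thesis using state_le_norm[OF \<mu>, of "x X i"] r by (simp add: Lip_ball_def)
      qed
      then show "restrict (\<lambda>i. \<lfloor>\<mu> (x X i) / \<delta>\<rfloor>) {..<n} \<in> ?B"
        unfolding restrict_PiE_iff using floor_divide_bound[OF _ \<delta>(1)] by blast
    qed
    then show ?thesis using True A by (simp add: datum_def)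
  qed (simp add: datum_def)
  then have "datum ` S \<subseteq> insert None (Some ` Pow ?B)" by (rule image_subsetI)
  moreover have "finite (insert None (Some ` Pow ?B))" by (simp add: finite_PiE)
  ultimately have fin: "finite (datum ` S)" by (rule finite_subset)
  obtain F where F: "finite F" "F \<subseteq> S" "\<And>X. X \<in> S \<Longrightarrow> \<exists>Y\<in>F. datum Y = datum X"
    by (rule finite_image_representatives[OF fin]) (rule that)
  have "CQM_dist Y X < ereal \<epsilon>" if X: "X \<in> S" and Y: "Y \<in> S" and eq: "datum Y = datum X" for X Y
  proof -
    obtain A LA where A: "rep Y = (A, LA)" by (metis surj_pair)
    obtain B LB where B: "rep X = (B, LB)" by (metis surj_pair)
    have dist: "CQM_dist Y X = dist_q (A, LA) (B, LB)" using A B by (simp add: CQM_dist_def rep_def)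
    show ?thesis
    proof (cases "proper (rep Y)")
      case True
      then have propX: "proper (rep X)" using eq by (simp add: datum_def split: if_splits)
      interpret proper_qms_pair A LA B LB
        using True propX A B by (intro proper_qms_pair.intro) (simp_all add: proper_def)
      have netA: "net (A, LA) (x Y)" and netB: "net (B, LB) (x X)"
        using x[OF Y True] x[OF X propX] A B by simp_all
      have rv: "rounded_values A \<delta> n (x Y) = rounded_values B \<delta> n (x X)"
        using eq True propX A B by (simp add: datum_def)
      have "dist_q (A, LA) (B, LB) \<le> ereal (2 * \<delta>)"
      proof (rule dist_q_le_if_matching_nets[OF \<delta>(1)])
        show "\<And>i. i < n \<Longrightarrow> x Y i \<in> A.V \<and> LA (x Y i) \<le> 1"
          "\<And>i. i < n \<Longrightarrow> x X i \<in> B.V \<and> LB (x X i) \<le> 1"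
          "\<And>a. a \<in> Lip_ball A LA \<Longrightarrow> \<exists>i<n. A.N (x Y i - a) \<le> \<delta>"
          "\<And>b. b \<in> Lip_ball B LB \<Longrightarrow> \<exists>i<n. B.N (x X i - b) \<le> \<delta>"
          using netA netB by (simp_all add: net_def Lip_ball_def)
        show "\<exists>\<nu>\<in>states B. \<forall>i<n. \<bar>\<mu> (x Y i) - \<nu> (x X i)\<bar> \<le> \<delta>" if "\<mu> \<in> states A" for \<mu>
          using rounded_values_eq_close[OF rv \<delta>(1) that] .
        show "\<exists>\<mu>\<in>states A. \<forall>i<n. \<bar>\<mu> (x Y i) - \<nu> (x X i)\<bar> \<le> \<delta>" if "\<nu> \<in> states B" for \<nu>
          using rounded_values_eq_close[OF rv[symmetric] \<delta>(1) that] by (simp add: abs_minus_commute)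
      qed
      also have "\<dots> < ereal \<epsilon>" using \<delta>(2) by simp
      finally show ?thesis using dist by simp
    next
      case False
      then have "\<not> proper (rep X)" using eq by (simp add: datum_def split: if_splits)
      then have "improper_qms A LA" "improper_qms B LB"
        using False A B quantum_metric_space_cases CQM_subset rep_in X Y S unfolding proper_def
        by (metis fst_conv snd_conv subsetD)+
      then have "dist_q (A, LA) (B, LB) = - \<infinity>" by (rule dist_q_improper)
      then show ?thesis using dist by simp
    qed
  qed
  note near = this
  have "S \<subseteq> (\<Union>X\<in>F. {Y. CQM_dist X Y < ereal \<epsilon>})"
  proof
    fix X assume X: "X \<in> S"
    obtain Y where Y: "Y \<in> F" "datum Y = datum X" using F(3)[OF X] by blast
    then have "Y \<in> S" using F(2) by blast
    then show "X \<in> (\<Union>X\<in>F. {Y. CQM_dist X Y < ereal \<epsilon>})" using near[OF X _ Y(2)] Y(1) by blast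
  qed
  then show "\<exists>F. finite F \<and> F \<subseteq> S \<and> S \<subseteq> (\<Union>X\<in>F. {Y. CQM_dist X Y < ereal \<epsilon>})"
    using F(1,2) by blast
qed

theorem theorem5p5:
  fixes S :: "'a::real_vector qms set set"
  assumes "S \<subseteq> CQM"
  shows "totally_bounded_wrt CQM_dist S \<longleftrightarrow>
    (\<exists>D'::real. \<forall>X\<in>S. \<forall>(A, L)\<in>X. metric_diam (ou_dist A) (Lip_ball A L) \<le> ereal D') \<and>
    (\<forall>\<epsilon>::real. \<epsilon> > 0 \<longrightarrow> (\<exists>K::real. K > 0 \<and>
       (\<forall>X\<in>S. \<forall>(A, L)\<in>X. ereal_of_enat (Cov (ou_dist A) (Lip_ball A L) \<epsilon>) \<le> ereal K)))"
    (is "?tb \<longleftrightarrow> ?diam \<and> ?cov")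
proof (intro iffI conjI)
  assume ?tb
  then show ?diam ?cov
    using diam_bounded_if_totally_bounded[OF assms] Cov_bounded_if_totally_bounded[OF assms] by simp_all
next
  assume bounds: "?diam \<and> ?cov"
  then obtain D where D: "\<forall>X\<in>S. \<forall>(A, L)\<in>X. metric_diam (ou_dist A) (Lip_ball A L) \<le> ereal D"
    by blast
  show ?tb
  proof (rule totally_bounded_if_diam_Cov_bounded[OF assms])
    show "metric_diam (ou_dist A) (Lip_ball A L) \<le> ereal D" if "X \<in> S" "(A, L) \<in> X" for X A L
      using D that by fast
    fix \<epsilon> :: real assume "\<epsilon> > 0"
    then obtain K where "\<forall>X\<in>S. \<forall>(A, L)\<in>X. ereal_of_enat (Cov (ou_dist A) (Lip_ball A L) \<epsilon>) \<le> ereal K"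
      using bounds by blast
    then show "\<exists>K. \<forall>X A L. X \<in> S \<longrightarrow> (A, L) \<in> X \<longrightarrow>
        ereal_of_enat (Cov (ou_dist A) (Lip_ball A L) \<epsilon>) \<le> ereal K"
      by (intro exI[of _ K]) fast
  qed
qed

end
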